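(* For all $\alpha>0$ there is no finitely generated subgroup of $\mathrm{Diff}_+^{1+\alpha}([0,1])$ having intermediate growth.
   Context: $\mathrm{Diff}_+^{1+\alpha}([0,1])$ is the group of orientation preserving $C^1$ diffeomorphisms of $[0,1]$ whose derivative is $\alpha$-H\"older continuous. For a group generated by a finite symmetric set $S$, let $f(n)$ be the number of elements that can be written as a product of no more than $n$ elements of $S$. The group has polynomial growth if $f(n)\le C n^{d}$ for some constants $C,d$ and all $n\ge1$; it has exponential growth if $\lim_{n\to\infty} f(n)^{1/n}>1$; it has intermediate growth if its growth is neither polynomial nor exponential. These notions do not depend on $S$. *)

theory Defs
  imports "HOL-Analysis.Analysis" "HOL-Algebra.Bij" "HOL-Algebra.Generated_Groups"
begin

definition has_continuous_deriv_on :: "(real \<Rightarrow> real) \<Rightarrow> (real \<Rightarrow> real) \<Rightarrow> real set \<Rightarrow> bool"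
  where "has_continuous_deriv_on f f' X \<longleftrightarrow>
    (\<forall>x\<in>X. (f has_real_derivative f' x) (at x within X)) \<and> continuous_on X f'"

definition holder_continuous_on :: "real \<Rightarrow> real set \<Rightarrow> (real \<Rightarrow> real) \<Rightarrow> bool"
  where "holder_continuous_on \<alpha> X h \<longleftrightarrow>
    (\<exists>C. \<forall>x\<in>X. \<forall>y\<in>X. \<bar>h x - h y\<bar> \<le> C * \<bar>x - y\<bar> powr \<alpha>)"

text \<open>Derivatives at the endpoints are one-sided. As in \<^const>\<open>Bij\<close>, maps of the interval are
  represented by functions that are \<^const>\<open>undefined\<close> outside of it. No upper bound is
  imposed on the exponent; for exponents above 1 the derivative is constant and the only
  element is the identity.\<close>

definition diff_unit :: "real \<Rightarrow> (real \<Rightarrow> real) set"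
  where "diff_unit \<alpha> = {f \<in> Bij {0..1}.
    strict_mono_on {0..1} f \<and>
    (\<exists>f'. has_continuous_deriv_on f f' {0..1} \<and> holder_continuous_on \<alpha> {0..1} f') \<and>
    (\<exists>g'. has_continuous_deriv_on (inv_into {0..1} f) g' {0..1})}"

definition Diff_unit :: "real \<Rightarrow> (real \<Rightarrow> real) monoid"
  where "Diff_unit \<alpha> = (BijGroup {0..1}) \<lparr>carrier := diff_unit \<alpha>\<rparr>"


definition finite_symmetric_generating :: "('a, 'b) monoid_scheme \<Rightarrow> 'a set \<Rightarrow> bool"
  where "finite_symmetric_generating G S \<longleftrightarrow>
    finite S \<and> S \<subseteq> carrier G \<and> (\<forall>s\<in>S. inv\<^bsub>G\<^esub> s \<in> S) \<and> generate G S = carrier G"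

definition finitely_generated_group :: "('a, 'b) monoid_scheme \<Rightarrow> bool"
  where "finitely_generated_group G \<longleftrightarrow>
    (\<exists>S. finite S \<and> S \<subseteq> carrier G \<and> generate G S = carrier G)"

definition word_ball :: "('a, 'b) monoid_scheme \<Rightarrow> 'a set \<Rightarrow> nat \<Rightarrow> 'a set"
  where "word_ball G S n =
    {foldr (\<lambda>s x. s \<otimes>\<^bsub>G\<^esub> x) ws \<one>\<^bsub>G\<^esub> | ws. set ws \<subseteq> S \<and> length ws \<le> n}"

definition growth_function :: "('a, 'b) monoid_scheme \<Rightarrow> 'a set \<Rightarrow> nat \<Rightarrow> nat"
  where "growth_function G S n = card (word_ball G S n)"

definition polynomial_growth :: "(nat \<Rightarrow> nat) \<Rightarrow> bool"
  where "polynomial_growth f \<longleftrightarrow>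
    (\<exists>C d :: real. \<forall>n\<ge>1. real (f n) \<le> C * real n powr d)"

definition exponential_growth :: "(nat \<Rightarrow> nat) \<Rightarrow> bool"
  where "exponential_growth f \<longleftrightarrow>
    (\<exists>L > 1. (\<lambda>n. root n (real (f n))) \<longlonglongrightarrow> L)"

text \<open>The growth type is independent of the generating set, so quantifying existentially over
  it is harmless; it makes the nonexistence of groups of intermediate growth a claim
  about every finite symmetric generating set.\<close>

definition intermediate_growth :: "('a, 'b) monoid_scheme \<Rightarrow> bool"
  where "intermediate_growth G \<longleftrightarrow>
    (\<exists>S. finite_symmetric_generating G S \<and>
         \<not> polynomial_growth (growth_function G S) \<and>
         \<not> exponential_growth (growth_function G S))"


lemma continuous_deriv_bounded:
  assumes "has_continuous_deriv_on f f' {0..1}"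
  obtains B where "B > 0" "\<And>x. x \<in> {0..1} \<Longrightarrow> \<bar>f' x\<bar> \<le> B"
proof -
  have "continuous_on {0..1} f'" using assms by (simp add: has_continuous_deriv_on_def)
  then have "bounded (f' ` {0..1})"
    using compact_continuous_image compact_imp_bounded by blast
  then obtain B where "B > 0" "\<forall>y \<in> f' ` {0..1}. norm y \<le> B"
    unfolding bounded_pos by blast
  then show ?thesis by (intro that[of B]) auto
qed

lemma continuous_deriv_lipschitz:
  assumes "has_continuous_deriv_on f f' {0..1}"
  obtains B where "B > 0"
    "\<And>x y. x \<in> {0..1} \<Longrightarrow> y \<in> {0..1} \<Longrightarrow> \<bar>f x - f y\<bar> \<le> B * \<bar>x - y\<bar>"
proof -
  obtain B where B: "B > 0" "\<And>x. x \<in> {0..1} \<Longrightarrow> \<bar>f' x\<bar> \<le> B"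
    by (rule continuous_deriv_bounded[OF assms]) blast
  have "norm (f x - f y) \<le> B * norm (x - y)" if "x \<in> {0..1}" "y \<in> {0..1}" for x y
    by (rule field_differentiable_bound[of "{0..1}" f f'])
       (use assms B that in \<open>auto simp: has_continuous_deriv_on_def\<close>)
  then show ?thesis using that B by simp
qed

lemma holder_nonneg_const:
  assumes "holder_continuous_on \<alpha> X h"
  obtains C where "C \<ge> 0" "\<And>x y. x \<in> X \<Longrightarrow> y \<in> X \<Longrightarrow> \<bar>h x - h y\<bar> \<le> C * \<bar>x - y\<bar> powr \<alpha>"
proof -
  obtain C where C: "\<And>x y. x \<in> X \<Longrightarrow> y \<in> X \<Longrightarrow> \<bar>h x - h y\<bar> \<le> C * \<bar>x - y\<bar> powr \<alpha>"
    using assms by (auto simp: holder_continuous_on_def)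
  have "\<bar>h x - h y\<bar> \<le> \<bar>C\<bar> * \<bar>x - y\<bar> powr \<alpha>" if "x \<in> X" "y \<in> X" for x y
    using C[OF that] by (smt (verit) mult_right_mono powr_ge_zero)
  then show ?thesis using that[of "\<bar>C\<bar>"] by simp
qed

lemma holder_compose:
  assumes h: "holder_continuous_on \<alpha> {0..1} h" and g: "has_continuous_deriv_on g g' {0..1}"
    and gI: "g \<in> {0..1} \<rightarrow> {0..1}" and "\<alpha> > 0"
  shows "holder_continuous_on \<alpha> {0..1} (\<lambda>x. h (g x))"
proof -
  obtain C where C: "C \<ge> 0"
      "\<And>x y. x \<in> {0..1} \<Longrightarrow> y \<in> {0..1} \<Longrightarrow> \<bar>h x - h y\<bar> \<le> C * \<bar>x - y\<bar> powr \<alpha>"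
    using holder_nonneg_const[OF h] by blast
  obtain B where B: "B > 0"
      "\<And>x y. x \<in> {0..1} \<Longrightarrow> y \<in> {0..1} \<Longrightarrow> \<bar>g x - g y\<bar> \<le> B * \<bar>x - y\<bar>"
    using continuous_deriv_lipschitz[OF g] by blast
  have "\<bar>h (g x) - h (g y)\<bar> \<le> (C * B powr \<alpha>) * \<bar>x - y\<bar> powr \<alpha>"
    if xy: "x \<in> {0..1}" "y \<in> {0..1}" for x y
  proof -
    have "\<bar>h (g x) - h (g y)\<bar> \<le> C * \<bar>g x - g y\<bar> powr \<alpha>"
      using C(2) gI xy by blast
    also have "\<dots> \<le> C * (B * \<bar>x - y\<bar>) powr \<alpha>"
      using B(2)[OF xy] C(1) \<open>\<alpha> > 0\<close> by (intro mult_left_mono powr_mono2) auto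
    finally show ?thesis using B(1) by (simp add: powr_mult mult.assoc)
  qed
  then show ?thesis unfolding holder_continuous_on_def by blast
qed

lemma holder_mult:
  assumes h: "holder_continuous_on \<alpha> X h" and k: "holder_continuous_on \<alpha> X k"
    and bh: "\<And>x. x \<in> X \<Longrightarrow> \<bar>h x\<bar> \<le> A" and bk: "\<And>x. x \<in> X \<Longrightarrow> \<bar>k x\<bar> \<le> B"
  shows "holder_continuous_on \<alpha> X (\<lambda>x. h x * k x)"
proof -
  obtain C where C: "C \<ge> 0" "\<And>x y. x \<in> X \<Longrightarrow> y \<in> X \<Longrightarrow> \<bar>h x - h y\<bar> \<le> C * \<bar>x - y\<bar> powr \<alpha>"
    using holder_nonneg_const[OF h] by blast
  obtain D where D: "D \<ge> 0" "\<And>x y. x \<in> X \<Longrightarrow> y \<in> X \<Longrightarrow> \<bar>k x - k y\<bar> \<le> D * \<bar>x - y\<bar> powr \<alpha>"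
    using holder_nonneg_const[OF k] by blast
  have "\<bar>h x * k x - h y * k y\<bar> \<le> (A * D + B * C) * \<bar>x - y\<bar> powr \<alpha>" if "x \<in> X" "y \<in> X" for x y
  proof -
    have "h x * k x - h y * k y = h x * (k x - k y) + k y * (h x - h y)"
      by (simp add: algebra_simps)
    then have "\<bar>h x * k x - h y * k y\<bar> \<le> \<bar>h x\<bar> * \<bar>k x - k y\<bar> + \<bar>k y\<bar> * \<bar>h x - h y\<bar>"
      by (metis abs_mult abs_triangle_ineq)
    also have "\<dots> \<le> A * (D * \<bar>x - y\<bar> powr \<alpha>) + B * (C * \<bar>x - y\<bar> powr \<alpha>)"
    proof (intro add_mono mult_mono)
      show "0 \<le> A" using bh[OF that(1)] by linarith
      show "0 \<le> B" using bk[OF that(2)] by linarith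
    qed (use that bh bk C D in auto)
    finally show ?thesis by (simp add: algebra_simps)
  qed
  then show ?thesis unfolding holder_continuous_on_def by blast
qed

lemma has_continuous_deriv_on_cong:
  assumes "\<And>x. x \<in> X \<Longrightarrow> f x = g x"
  shows "has_continuous_deriv_on f f' X \<longleftrightarrow> has_continuous_deriv_on g f' X"
proof -
  have "(f has_real_derivative f' x) (at x within X) \<longleftrightarrow>
        (g has_real_derivative f' x) (at x within X)" if "x \<in> X" for x
  proof
    assume "(f has_real_derivative f' x) (at x within X)"
    then show "(g has_real_derivative f' x) (at x within X)"
      by (rule has_field_derivative_transform_within[OF _ zero_less_one \<open>x \<in> X\<close>]) (simp add: assms)
  next
    assume "(g has_real_derivative f' x) (at x within X)"
    then show "(f has_real_derivative f' x) (at x within X)"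
      by (rule has_field_derivative_transform_within[OF _ zero_less_one \<open>x \<in> X\<close>]) (simp add: assms)
  qed
  then show ?thesis unfolding has_continuous_deriv_on_def by simp
qed

lemma has_continuous_deriv_on_compose:
  assumes f: "has_continuous_deriv_on f f' {0..1}" and g: "has_continuous_deriv_on g g' {0..1}"
    and gI: "g ` {0..1} = {0..1}"
  shows "has_continuous_deriv_on (\<lambda>x. f (g x)) (\<lambda>x. f' (g x) * g' x) {0..1}"
proof -
  have "continuous_on {0..1} g"
    using g unfolding has_continuous_deriv_on_def by (auto intro: DERIV_continuous_on)
  then have 1: "continuous_on {0..1} (\<lambda>x. f' (g x) * g' x)"
    using f g gI continuous_on_compose2[of "{0..1}" f' "{0..1}" g]
    unfolding has_continuous_deriv_on_def by (intro continuous_on_mult) blast+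
  have "((\<lambda>x. f (g x)) has_real_derivative f' (g x) * g' x) (at x within {0..1})"
    if "x \<in> {0..1}" for x
  proof -
    have "g x \<in> {0..1}" using gI that by blast
    then have "(f has_real_derivative f' (g x)) (at (g x) within g ` {0..1})"
      using f unfolding has_continuous_deriv_on_def gI by blast
    then show ?thesis
      using DERIV_image_chain[of f "f' (g x)" g x "{0..1}" "g' x", unfolded comp_def] g that
      unfolding has_continuous_deriv_on_def by blast
  qed
  with 1 show ?thesis unfolding has_continuous_deriv_on_def by blast
qed

lemma deriv_inverse_product:
  assumes f: "has_continuous_deriv_on f f' {0..1}"
    and g: "has_continuous_deriv_on (inv_into {0..1} f) g' {0..1}"
    and bij: "bij_betw f {0..1} {0..1}" and y: "y \<in> {0..1::real}"
  shows "f' (inv_into {0..1} f y) * g' y = 1"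
proof -
  let ?g = "inv_into {0..1} f"
  have "?g ` {0..1} = {0..1}" using bij by (metis bij_betw_inv_into bij_betw_imp_surj_on)
  then have "has_continuous_deriv_on (\<lambda>x. f (?g x)) (\<lambda>x. f' (?g x) * g' x) {0..1}"
    using has_continuous_deriv_on_compose f g by blast
  moreover have "f (?g x) = x" if "x \<in> {0..1}" for x
    using bij that by (simp add: bij_betw_inv_into_right)
  ultimately have "has_continuous_deriv_on (\<lambda>x. x) (\<lambda>x. f' (?g x) * g' x) {0..1}"
    by (subst (asm) has_continuous_deriv_on_cong) auto
  then have "((\<lambda>x. x) has_vector_derivative f' (?g y) * g' y) (at y within {0..1})"
    using y unfolding has_continuous_deriv_on_def
    by (simp add: has_real_derivative_iff_has_vector_derivative)
  moreover have "((\<lambda>x. x) has_vector_derivative 1) (at y within {0..1})"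
    using has_vector_derivative_id .
  ultimately show ?thesis
    using vector_derivative_unique_within_closed_interval[of 0 1 y "\<lambda>x. x"] y by auto
qed

lemma diff_unit_one: "(\<lambda>x\<in>{0..1}. x) \<in> diff_unit \<alpha>"
proof -
  let ?e = "\<lambda>x\<in>{0..1}. x :: real"
  have B: "?e \<in> Bij {0..1}" by (rule id_Bij)
  have id: "has_continuous_deriv_on (\<lambda>x. x) (\<lambda>_. 1) {0..1}"
    unfolding has_continuous_deriv_on_def by (auto intro!: derivative_eq_intros)
  have "inv_into {0..1} ?e x = x" if "x \<in> {0..1}" for x
    by (rule inv_into_f_eq) (use that in \<open>auto simp: inj_on_def\<close>)
  then have "has_continuous_deriv_on (inv_into {0..1} ?e) (\<lambda>_. 1) {0..1}"
    using id by (subst has_continuous_deriv_on_cong[of _ _ "\<lambda>x. x"]) auto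
  moreover have "has_continuous_deriv_on ?e (\<lambda>_. 1) {0..1}"
    using id by (subst has_continuous_deriv_on_cong[of _ _ "\<lambda>x. x"]) auto
  moreover have "holder_continuous_on \<alpha> {0..1} (\<lambda>_. 1)"
    unfolding holder_continuous_on_def by (auto intro: exI[of _ 0])
  ultimately show ?thesis
    using B unfolding diff_unit_def by (auto simp: strict_mono_on_def)
qed

lemma diff_unit_compose:
  assumes a: "\<alpha> > 0" and f: "f \<in> diff_unit \<alpha>" and g: "g \<in> diff_unit \<alpha>"
  shows "compose {0..1} f g \<in> diff_unit \<alpha>"
proof -
  let ?I = "{0..1::real}" and ?h = "compose {0..1} f g"
  have Bf: "bij_betw f ?I ?I" and Bg: "bij_betw g ?I ?I" and Bij: "f \<in> Bij ?I" "g \<in> Bij ?I"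
    using f g by (auto simp: diff_unit_def Bij_def)
  have gI: "g ` ?I = ?I" using Bg by (simp add: bij_betw_def)
  obtain f' where f': "has_continuous_deriv_on f f' ?I" "holder_continuous_on \<alpha> ?I f'"
    using f by (auto simp: diff_unit_def)
  obtain g' where g': "has_continuous_deriv_on g g' ?I" "holder_continuous_on \<alpha> ?I g'"
    using g by (auto simp: diff_unit_def)
  obtain u where u: "has_continuous_deriv_on (inv_into ?I f) u ?I"
    using f by (auto simp: diff_unit_def)
  obtain v where v: "has_continuous_deriv_on (inv_into ?I g) v ?I"
    using g by (auto simp: diff_unit_def)
  have hB: "?h \<in> Bij ?I" using Bij by (rule compose_Bij)
  have mono: "strict_mono_on ?I ?h"
  proof (rule strict_mono_onI)
    fix x y assume xy: "x \<in> ?I" "y \<in> ?I" "x < y"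
    have "strict_mono_on ?I f" "strict_mono_on ?I g" using f g by (auto simp: diff_unit_def)
    moreover have "g x \<in> ?I" "g y \<in> ?I" using gI xy by blast+
    ultimately have "f (g x) < f (g y)"
      using xy by (meson strict_mono_onD)
    then show "?h x < ?h y" using xy by (simp add: compose_def)
  qed
  have d: "has_continuous_deriv_on ?h (\<lambda>x. f' (g x) * g' x) ?I"
    using has_continuous_deriv_on_compose[OF f'(1) g'(1) gI]
    by (subst has_continuous_deriv_on_cong[of _ _ "\<lambda>x. f (g x)"]) (auto simp: compose_def)
  obtain A where A: "\<And>x. x \<in> ?I \<Longrightarrow> \<bar>f' x\<bar> \<le> A"
    using continuous_deriv_bounded[OF f'(1)] by blast
  obtain B where B: "\<And>x. x \<in> ?I \<Longrightarrow> \<bar>g' x\<bar> \<le> B"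
    using continuous_deriv_bounded[OF g'(1)] by blast
  have hol: "holder_continuous_on \<alpha> ?I (\<lambda>x. f' (g x) * g' x)"
  proof (rule holder_mult)
    show "holder_continuous_on \<alpha> ?I (\<lambda>x. f' (g x))"
      using holder_compose[OF f'(2) g'(1) _ a] gI by blast
    show "holder_continuous_on \<alpha> ?I g'" by (rule g'(2))
    show "\<bar>f' (g x)\<bar> \<le> A" if "x \<in> ?I" for x using A gI that by blast
    show "\<bar>g' x\<bar> \<le> B" if "x \<in> ?I" for x using B that .
  qed
  have fI: "inv_into ?I f ` ?I = ?I" using Bf by (metis bij_betw_inv_into bij_betw_imp_surj_on)
  have inv: "inv_into ?I ?h x = inv_into ?I g (inv_into ?I f x)" if "x \<in> ?I" for x
  proof -
    let ?y = "inv_into ?I f x"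
    have y: "?y \<in> ?I" using fI that by blast
    then have z: "inv_into ?I g ?y \<in> ?I" using gI by (metis inv_into_into)
    have "?h (inv_into ?I g ?y) = x"
      using z y that Bf Bg by (simp add: compose_def bij_betw_inv_into_right)
    moreover have "inj_on ?h ?I" using hB by (auto simp: Bij_def bij_betw_def)
    ultimately show ?thesis using z by (metis inv_into_f_f)
  qed
  have "has_continuous_deriv_on (inv_into ?I ?h) (\<lambda>x. v (inv_into ?I f x) * u x) ?I"
    using has_continuous_deriv_on_compose[OF v u fI] inv
    by (subst has_continuous_deriv_on_cong[of _ _ "\<lambda>x. inv_into ?I g (inv_into ?I f x)"]) auto
  then show ?thesis using hB mono d hol unfolding diff_unit_def by blast
qed

lemma diff_unit_inverse:
  assumes a: "\<alpha> > 0" and f: "f \<in> diff_unit \<alpha>"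
  shows "(\<lambda>x\<in>{0..1}. inv_into {0..1} f x) \<in> diff_unit \<alpha>"
proof -
  let ?I = "{0..1::real}" and ?k = "inv_into {0..1} f"
  let ?g = "restrict ?k ?I"
  have B: "bij_betw f ?I ?I" and Bij: "f \<in> Bij ?I" and m: "strict_mono_on ?I f"
    using f by (auto simp: diff_unit_def Bij_def)
  have gB: "?g \<in> Bij ?I" using Bij by (rule restrict_inv_into_Bij)
  obtain f' where f': "has_continuous_deriv_on f f' ?I" "holder_continuous_on \<alpha> ?I f'"
    using f by (auto simp: diff_unit_def)
  obtain u where u: "has_continuous_deriv_on ?k u ?I"
    using f by (auto simp: diff_unit_def)
  have kI: "?k ` ?I = ?I" using B by (metis bij_betw_inv_into bij_betw_imp_surj_on)
  have fk: "f (?k x) = x" if "x \<in> ?I" for x using B that by (simp add: bij_betw_inv_into_right)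
  have mono: "strict_mono_on ?I ?g"
  proof (rule strict_mono_onI)
    fix x y assume xy: "x \<in> ?I" "y \<in> ?I" "x < y"
    then have k: "?k x \<in> ?I" "?k y \<in> ?I" using kI by blast+
    have "\<not> ?k y < ?k x"
      using strict_mono_onD[OF m k(2) k(1)] fk[OF xy(1)] fk[OF xy(2)] xy(3) by linarith
    moreover have "?k y \<noteq> ?k x"
      using fk[OF xy(1)] fk[OF xy(2)] xy(3) by auto
    ultimately show "?g x < ?g y" using xy by simp
  qed
  have d: "has_continuous_deriv_on ?g u ?I"
    using u by (subst has_continuous_deriv_on_cong[of _ _ ?k]) auto
  have one: "f' (?k y) * u y = 1" if "y \<in> ?I" for y
    using deriv_inverse_product[OF f'(1) u B that] .
  obtain M where M: "M > 0" "\<And>x. x \<in> ?I \<Longrightarrow> \<bar>u x\<bar> \<le> M"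
    using continuous_deriv_bounded[OF u] by blast
  have "holder_continuous_on \<alpha> ?I (\<lambda>x. f' (?k x))"
    using holder_compose[OF f'(2) u _ a] kI by blast
  then obtain C where C: "C \<ge> 0"
      "\<And>x y. x \<in> ?I \<Longrightarrow> y \<in> ?I \<Longrightarrow> \<bar>f' (?k x) - f' (?k y)\<bar> \<le> C * \<bar>x - y\<bar> powr \<alpha>"
    by (rule holder_nonneg_const) blast
  have "\<bar>u x - u y\<bar> \<le> (M * M * C) * \<bar>x - y\<bar> powr \<alpha>" if "x \<in> ?I" "y \<in> ?I" for x y
  proof -
    have "u x - u y = u x * (f' (?k y) * u y) - (f' (?k x) * u x) * u y"
      using one[OF that(1)] one[OF that(2)] by simp
    also have "\<dots> = u x * u y * (f' (?k y) - f' (?k x))" by (simp add: algebra_simps)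
    finally have "\<bar>u x - u y\<bar> = \<bar>u x\<bar> * \<bar>u y\<bar> * \<bar>f' (?k x) - f' (?k y)\<bar>"
      by (simp add: abs_mult abs_minus_commute)
    also have "\<dots> \<le> M * M * (C * \<bar>x - y\<bar> powr \<alpha>)"
      using M C that by (intro mult_mono) auto
    finally show ?thesis by (simp add: mult.assoc)
  qed
  then have hol: "holder_continuous_on \<alpha> ?I u" unfolding holder_continuous_on_def by blast
  have "inv_into ?I ?g x = f x" if "x \<in> ?I" for x
  proof (rule inv_into_f_eq)
    show "inj_on ?g ?I" using gB by (auto simp: Bij_def bij_betw_def)
    show fx: "f x \<in> ?I" using B that by (auto simp: bij_betw_def)
    show "?g (f x) = x" using fx B that by (simp add: bij_betw_inv_into_left)
  qed
  then have "has_continuous_deriv_on (inv_into ?I ?g) f' ?I"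
    using f'(1) by (subst has_continuous_deriv_on_cong[of _ _ f]) auto
  then show ?thesis using gB mono d hol unfolding diff_unit_def by blast
qed

lemma subgroup_diff_unit:
  assumes "\<alpha> > 0"
  shows "subgroup (diff_unit \<alpha>) (BijGroup {0..1})"
proof
  show "diff_unit \<alpha> \<subseteq> carrier (BijGroup {0..1})"
    by (auto simp: diff_unit_def BijGroup_def)
next
  fix f g assume fg: "f \<in> diff_unit \<alpha>" "g \<in> diff_unit \<alpha>"
  then have "f \<in> Bij {0..1}" "g \<in> Bij {0..1}" by (auto simp: diff_unit_def)
  then show "f \<otimes>\<^bsub>BijGroup {0..1}\<^esub> g \<in> diff_unit \<alpha>"
    using diff_unit_compose[OF assms fg] by (simp add: BijGroup_def)
next
  show "\<one>\<^bsub>BijGroup {0..1}\<^esub> \<in> diff_unit \<alpha>"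
    using diff_unit_one by (simp add: BijGroup_def)
next
  fix f assume f: "f \<in> diff_unit \<alpha>"
  then have "f \<in> Bij {0..1}" by (auto simp: diff_unit_def)
  then show "inv\<^bsub>BijGroup {0..1}\<^esub> f \<in> diff_unit \<alpha>"
    using diff_unit_inverse[OF assms f] by (simp add: inv_BijGroup)
qed

lemma group_Diff_unit: "\<alpha> > 0 \<Longrightarrow> group (Diff_unit \<alpha>)"
  unfolding Diff_unit_def
  by (rule subgroup.subgroup_is_group[OF subgroup_diff_unit group_BijGroup])

end

theory Submission
  imports Defs "Jordan_Normal_Form.Spectral_Radius"
begin

text \<open>
  A group that does not have exponential growth has subexponential growth. Subexponential growth
  forces coincidences between the products \<open>h\<^sup>b\<^sup>0 t h\<^sup>b\<^sup>1 t \<cdots>\<close> with exponents 0 and 1, which exhibit \<open>h\<close>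
  as a product of conjugates of \<open>h\<close> by positive powers of \<open>t\<close>. This is used three times.

  First, it gives Milnor's lemma: the common kernel of all homomorphisms to the reals is again finitely
  generated, and so are the iterated kernels \<open>\<Gamma> = \<Gamma>\<^sub>0 \<supseteq> \<Gamma>\<^sub>1 \<supseteq> \<cdots>\<close>. By Plante's argument \<open>\<Gamma>\<^sub>i\<close> preserves a
  measure on each gap between its fixed points, so \<open>\<Gamma>\<^sub>i\<^sub>+\<^sub>1\<close> has a fixed point in that gap, and the gaps of
  the \<open>\<Gamma>\<^sub>i\<close> around a point are strictly nested.

  Second, it bounds the length of the series. A \<open>C\<^sup>1\<^sup>+\<^sup>\<alpha>\<close> diffeomorphism fixing the ends of an interval of
  length \<open>L\<close> moves its points by \<open>O(L\<^sup>1\<^sup>+\<^sup>\<alpha>)\<close>, so that each level of nesting raises lengths to the power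
  \<open>1 + \<alpha>\<close>; once \<open>\<alpha> (1 + \<alpha>)\<^sup>k\<^sup>-\<^sup>1 \<ge> 1\<close>, the powers of an element of \<open>\<Gamma>\<close> have bounded distortion on the gap of
  \<open>\<Gamma>\<^sub>k\<close>. Conjugates of \<open>h \<in> \<Gamma>\<^sub>k\<close> by high powers are then close to the identity, and hence so is \<open>h\<close>.
  Thus \<open>\<Gamma>\<^sub>k\<close> is trivial.

  Third, the quotients \<open>\<Gamma>\<^sub>i / \<Gamma>\<^sub>i\<^sub>+\<^sub>1\<close> are free abelian of finite rank, and an element of \<open>\<Gamma>\<close> acts on them
  without eigenvalues of modulus greater than 1. Its powers therefore have polynomially bounded entries,
  conjugation distorts word lengths polynomially, and polynomial growth follows by induction from
  \<open>\<Gamma>\<^sub>k\<close> up to \<open>\<Gamma>\<close>.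
\<close>

section \<open>Word balls and coincidences of products\<close>

text \<open>A collision of products is useful because the conjugating powers in it are strictly
  positive: replacing \<open>t\<close> by a high power pushes all of them arbitrarily far out, and
  replacing it by its inverse reaches the other side.

  The obstacle is the low regularity. Images of an interval under an element that pushes it off
  itself are disjoint, so their lengths are summable, but an \<alpha>-Hoelder derivative calls for
  summable \<alpha>-th powers of lengths, and these may diverge. Depth in the series repairs this:
  the \<alpha>-th power of the length of the gap at depth k is bounded by a multiple of the length
  at depth 1 itself, which is summable. This is where the number \<alpha> (1 + \<alpha>)^(k - 1)
  comes from.

  That the series ends does not yet bound growth: an extension of a group of polynomial growth by a
  free abelian one may grow exponentially. The induction therefore carries, next to polynomial
  growth, a polynomial bound on the lengths of conjugates by powers of any element of the whole
  group, and the eigenvalue bound serves to pass this on.\<close>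

lemma word_ball_0 [simp]: "word_ball G S 0 = {\<one>\<^bsub>G\<^esub>}"
  by (auto simp: word_ball_def)

lemma word_ball_Suc:
  "word_ball G S (Suc n) = insert \<one>\<^bsub>G\<^esub> ((\<lambda>(s, x). s \<otimes>\<^bsub>G\<^esub> x) ` (S \<times> word_ball G S n))"
proof (intro equalityI subsetI)
  fix y assume "y \<in> word_ball G S (Suc n)"
  then obtain ws where ws: "set ws \<subseteq> S" "length ws \<le> Suc n" "y = foldr (\<lambda>s x. s \<otimes>\<^bsub>G\<^esub> x) ws \<one>\<^bsub>G\<^esub>"
    by (auto simp: word_ball_def)
  show "y \<in> insert \<one>\<^bsub>G\<^esub> ((\<lambda>(s, x). s \<otimes>\<^bsub>G\<^esub> x) ` (S \<times> word_ball G S n))"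
  proof (cases ws)
    case Nil then show ?thesis using ws by simp
  next
    case (Cons a as)
    then have "foldr (\<lambda>s x. s \<otimes>\<^bsub>G\<^esub> x) as \<one>\<^bsub>G\<^esub> \<in> word_ball G S n"
      using ws by (auto simp: word_ball_def)
    then show ?thesis using ws Cons by auto
  qed
next
  fix y assume "y \<in> insert \<one>\<^bsub>G\<^esub> ((\<lambda>(s, x). s \<otimes>\<^bsub>G\<^esub> x) ` (S \<times> word_ball G S n))"
  then consider "y = \<one>\<^bsub>G\<^esub>" | s ws where "s \<in> S" "set ws \<subseteq> S" "length ws \<le> n"
      "y = s \<otimes>\<^bsub>G\<^esub> foldr (\<lambda>s x. s \<otimes>\<^bsub>G\<^esub> x) ws \<one>\<^bsub>G\<^esub>"
    by (auto simp: word_ball_def)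
  then show "y \<in> word_ball G S (Suc n)"
  proof cases
    case 1 then show ?thesis unfolding word_ball_def by (auto intro!: exI[of _ "[]"])
  next
    case 2 then show ?thesis unfolding word_ball_def by (auto intro!: exI[of _ "s # ws"])
  qed
qed

lemma finite_word_ball: "finite S \<Longrightarrow> finite (word_ball G S n)"
  by (induction n) (auto simp: word_ball_Suc)

lemma one_in_word_ball: "\<one>\<^bsub>G\<^esub> \<in> word_ball G S n"
  by (cases n) (auto simp: word_ball_Suc)

lemma word_ball_Suc_step: "s \<in> S \<Longrightarrow> x \<in> word_ball G S n \<Longrightarrow> s \<otimes>\<^bsub>G\<^esub> x \<in> word_ball G S (Suc n)"
  by (force simp: word_ball_Suc)

lemma word_ball_mono:
  assumes "S \<subseteq> T" "m \<le> n"
  shows "word_ball G S m \<subseteq> word_ball G T n"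
  using assms unfolding word_ball_def by fastforce

lemma word_ball_carrier_update [simp]: "word_ball (G\<lparr>carrier := H\<rparr>) S n = word_ball G S n"
  by (simp add: word_ball_def)

context group
begin

lemma word_ball_subset_carrier: "S \<subseteq> carrier G \<Longrightarrow> word_ball G S n \<subseteq> carrier G"
  by (induction n) (auto simp: word_ball_Suc)

lemma word_ball_closed: "x \<in> word_ball G S n \<Longrightarrow> S \<subseteq> carrier G \<Longrightarrow> x \<in> carrier G"
  using word_ball_subset_carrier by blast

lemma word_ball_incl: "s \<in> S \<Longrightarrow> S \<subseteq> carrier G \<Longrightarrow> 1 \<le> n \<Longrightarrow> s \<in> word_ball G S n"
  using word_ball_Suc_step[OF _ one_in_word_ball, of s S G "n - 1"] by auto

lemma word_ball_mult:
  assumes "S \<subseteq> carrier G"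
  shows "x \<in> word_ball G S m \<Longrightarrow> y \<in> word_ball G S n \<Longrightarrow> x \<otimes> y \<in> word_ball G S (m + n)"
proof (induction m arbitrary: x)
  case 0
  then show ?case using word_ball_closed[OF _ assms] by auto
next
  case (Suc m)
  consider "x = \<one>" | s z where "s \<in> S" "z \<in> word_ball G S m" "x = s \<otimes> z"
    using Suc.prems by (auto simp: word_ball_Suc)
  then show ?case
  proof cases
    case 1
    then have "x \<otimes> y \<in> word_ball G S n" using Suc.prems word_ball_closed[OF _ assms] by auto
    then show ?thesis using word_ball_mono[of S S n "Suc m + n" G] by auto
  next
    case 2
    have "x \<otimes> y = s \<otimes> (z \<otimes> y)"
      using 2 Suc.prems word_ball_closed[OF _ assms] assms by (auto intro!: m_assoc)
    then show ?thesis using word_ball_Suc_step[OF 2(1) Suc.IH[OF 2(2) Suc.prems(2)]] by simp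
  qed
qed

lemma word_ball_inv:
  assumes "S \<subseteq> carrier G" "\<And>s. s \<in> S \<Longrightarrow> inv s \<in> S"
  shows "x \<in> word_ball G S n \<Longrightarrow> inv x \<in> word_ball G S n"
proof (induction n arbitrary: x)
  case 0 then show ?case by simp
next
  case (Suc n)
  consider "x = \<one>" | s z where "s \<in> S" "z \<in> word_ball G S n" "x = s \<otimes> z"
    using Suc.prems by (auto simp: word_ball_Suc)
  then show ?case
  proof cases
    case 1 then show ?thesis by (simp add: one_in_word_ball)
  next
    case 2
    then have "inv x = inv z \<otimes> inv s"
      using word_ball_closed[OF _ assms(1)] assms by (auto intro!: inv_mult_group)
    moreover have "inv z \<otimes> inv s \<in> word_ball G S (n + 1)"
      using word_ball_mult[OF assms(1) Suc.IH[OF 2(2)] word_ball_incl[of "inv s" S 1]] assms 2 by auto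
    ultimately show ?thesis by simp
  qed
qed

lemma word_ball_subst:
  assumes S: "S \<subseteq> carrier G" and T: "T \<subseteq> word_ball G S c"
  shows "word_ball G T n \<subseteq> word_ball G S (n * c)"
proof (induction n)
  case 0 then show ?case by simp
next
  case (Suc n)
  show ?case
    unfolding word_ball_Suc[of G T] using Suc T word_ball_mult[OF S, of _ c _ "n * c"]
    by (auto simp: one_in_word_ball)
qed

lemma word_ball_subset_subgroup:
  assumes "subgroup H G" "S \<subseteq> H"
  shows "word_ball G S n \<subseteq> H"
  by (induction n)
     (use assms in \<open>auto simp: word_ball_Suc subgroup.one_closed intro: subgroup.m_closed\<close>)

lemma generate_eq_word_balls:
  assumes "S \<subseteq> carrier G" "\<And>s. s \<in> S \<Longrightarrow> inv s \<in> S"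
  shows "generate G S = (\<Union>n. word_ball G S n)"
proof
  show "(\<Union>n. word_ball G S n) \<subseteq> generate G S"
  proof (rule UN_least)
    show "word_ball G S n \<subseteq> generate G S" for n
      by (rule word_ball_subset_subgroup[OF generate_is_subgroup[OF assms(1)]]) (auto intro: generate.incl)
  qed
  show "generate G S \<subseteq> (\<Union>n. word_ball G S n)"
  proof
    fix x assume "x \<in> generate G S"
    then show "x \<in> (\<Union>n. word_ball G S n)"
    proof induction
      case one then show ?case using one_in_word_ball[of G S 0] by blast
    next
      case (incl h) then show ?case using word_ball_incl[of h S 1] assms(1) by blast
    next
      case (inv h) then show ?case using word_ball_incl[of "inv h" S 1] assms by blast
    next
      case (eng h1 h2) then show ?case using word_ball_mult[OF assms(1)] by blast
    qed
  qed
qed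

lemma finite_subset_word_ball:
  assumes "S \<subseteq> carrier G" "\<And>s. s \<in> S \<Longrightarrow> inv s \<in> S" "finite T" "T \<subseteq> generate G S"
  shows "\<exists>c. T \<subseteq> word_ball G S c"
  using assms(3,4)
proof (induction T)
  case empty then show ?case by simp
next
  case (insert x T)
  then obtain c where c: "T \<subseteq> word_ball G S c" by auto
  obtain d where d: "x \<in> word_ball G S d"
    using insert.prems generate_eq_word_balls[OF assms(1,2)] by auto
  have "insert x T \<subseteq> word_ball G S (max c d)"
    using c d word_ball_mono[of S S c "max c d" G] word_ball_mono[of S S d "max c d" G] by auto
  then show ?case by blast
qed

lemma card_word_ball_add:
  assumes "finite S" "S \<subseteq> carrier G"
  shows "card (word_ball G S (m + n)) \<le> card (word_ball G S m) * card (word_ball G S n)"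
proof -
  have "word_ball G S (m + n) \<subseteq> (\<lambda>(x, y). x \<otimes> y) ` (word_ball G S m \<times> word_ball G S n)"
  proof (induction m)
    case 0 then show ?case using word_ball_closed[OF _ assms(2)] by force
  next
    case (Suc m)
    show ?case
    proof
      fix x assume "x \<in> word_ball G S (Suc m + n)"
      then consider "x = \<one>" | s z where "s \<in> S" "z \<in> word_ball G S (m + n)" "x = s \<otimes> z"
        by (auto simp: word_ball_Suc)
      then show "x \<in> (\<lambda>(x, y). x \<otimes> y) ` (word_ball G S (Suc m) \<times> word_ball G S n)"
      proof cases
        case 1
        then have "x = (\<lambda>(x, y). x \<otimes> y) (\<one>, \<one>)" by simp
        then show ?thesis using one_in_word_ball by (metis SigmaI imageI)
      next
        case 2
        then obtain a b where ab: "a \<in> word_ball G S m" "b \<in> word_ball G S n" "z = a \<otimes> b"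
          using Suc.IH by auto
        have "x = (\<lambda>(x, y). x \<otimes> y) (s \<otimes> a, b)"
          using 2 ab word_ball_closed[OF _ assms(2)] assms(2) m_assoc[of s a b] by auto
        moreover have "(s \<otimes> a, b) \<in> word_ball G S (Suc m) \<times> word_ball G S n"
          using word_ball_Suc_step[OF 2(1) ab(1)] ab(2) by simp
        ultimately show ?thesis by (metis imageI)
      qed
    qed
  qed
  then have "card (word_ball G S (m + n)) \<le> card (word_ball G S m \<times> word_ball G S n)"
    by (intro surj_card_le) (auto simp: finite_word_ball assms)
  then show ?thesis by (simp add: card_cartesian_product)
qed

lemma card_word_ball_pos: "finite S \<Longrightarrow> 1 \<le> card (word_ball G S n)"
  using one_in_word_ball[of G S n] finite_word_ball[of S G n]
  by (metis One_nat_def Suc_leI card_gt_0_iff empty_iff)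

end

text \<open>Growth of every finitely generated subgroup, so that the property is inherited by subgroups.\<close>

definition subexponential_group :: "('a, 'b) monoid_scheme \<Rightarrow> 'a set \<Rightarrow> bool"
  where "subexponential_group G H \<longleftrightarrow>
    (\<forall>F c. finite F \<longrightarrow> F \<subseteq> H \<longrightarrow> 1 < c \<longrightarrow>
      (\<forall>\<^sub>F n in sequentially. real (card (word_ball G F n)) \<le> c ^ n))"

lemma subexponential_group_mono:
  "subexponential_group G H \<Longrightarrow> K \<subseteq> H \<Longrightarrow> subexponential_group G K"
  unfolding subexponential_group_def by blast

text \<open>Division with remainder by \<open>p\<close> bounds \<open>f n\<close> by a power of
  \<open>f p\<close> times one of finitely many values \<open>f r\<close>; the constant so produced
  is absorbed by the gap between \<open>a\<close> and \<open>b\<close>.\<close>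

lemma eventually_power_bound:
  fixes f :: "nat \<Rightarrow> nat" and a b :: real
  assumes zero: "f 0 = 1" and sub: "\<And>m n. f (m + n) \<le> f m * f n"
    and p: "p \<ge> 1" "real (f p) \<le> a ^ p" and ab: "1 \<le> a" "a < b"
  shows "\<forall>\<^sub>F n in sequentially. real (f n) \<le> b ^ n"
proof -
  have pow: "real (f (q * p)) \<le> a ^ (q * p)" for q
  proof (induction q)
    case 0 then show ?case using zero by simp
  next
    case (Suc q)
    have "real (f (Suc q * p)) \<le> real (f p) * real (f (q * p))"
      using sub[of p "q * p"] by (metis mult_Suc of_nat_le_iff of_nat_mult)
    also have "\<dots> \<le> a ^ p * a ^ (q * p)" using Suc p ab by (intro mult_mono) auto
    finally show ?case by (simp add: power_add)
  qed
  define M where "M = (\<Sum>r<p. real (f r))"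
  have M: "real (f r) \<le> M" if "r < p" for r
    unfolding M_def using that by (intro member_le_sum) auto
  have M0: "M > 0" using M[of 0] p(1) zero by auto
  have bound: "real (f n) \<le> M * a ^ n" for n
  proof -
    define q r where "q = n div p" and "r = n mod p"
    have n: "n = q * p + r" and r: "r < p" using p(1) by (simp_all add: q_def r_def)
    have "real (f n) \<le> real (f (q * p)) * real (f r)"
      unfolding n using sub[of "q * p" r] by (metis of_nat_le_iff of_nat_mult)
    also have "\<dots> \<le> a ^ (q * p) * M" using pow M[OF r] ab by (intro mult_mono) auto
    also have "\<dots> \<le> a ^ n * M" using M0 ab by (intro mult_right_mono power_increasing) (auto simp: n)
    finally show ?thesis by (simp add: mult.commute)
  qed
  have ba: "1 < b / a" using ab by simp
  then obtain n0 where "M < (b / a) ^ n0" using real_arch_pow by blast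
  then have "M \<le> (b / a) ^ n" if "n \<ge> n0" for n
    using power_increasing[OF that, of "b / a"] ba by linarith
  then have "\<forall>\<^sub>F n in sequentially. M \<le> (b / a) ^ n" unfolding eventually_sequentially by blast
  then show ?thesis
  proof eventually_elim
    case (elim n)
    have "M * a ^ n \<le> (b / a) ^ n * a ^ n" using elim ab by (intro mult_right_mono) auto
    also have "\<dots> = b ^ n" using ab by (simp add: power_divide)
    finally show ?case using bound[of n] by linarith
  qed
qed

text \<open>Denying \<open>exponential_growth\<close> leaves open that the roots have no limit at
  all. Fekete's argument excludes this: submultiplicativity makes the roots converge to their
  infimum \<open>L\<close>, which is at least 1, and failure of exponential growth then means
  \<open>L = 1\<close>.\<close>

lemma not_exponential_imp_subexponential:
  fixes f :: "nat \<Rightarrow> nat"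
  assumes zero: "f 0 = 1" and pos: "\<And>n. 1 \<le> f n" and sub: "\<And>m n. f (m + n) \<le> f m * f n"
    and nexp: "\<not> exponential_growth f" and c: "(1::real) < c"
  shows "\<forall>\<^sub>F n in sequentially. real (f n) \<le> c ^ n"
proof -
  define r where "r n = root n (real (f n))" for n
  define L where "L = Inf (r ` {1..})"
  have r1: "1 \<le> r n" if "n \<ge> 1" for n
    unfolding r_def using that pos[of n] by (simp add: real_root_ge_1_iff)
  have bdd: "bdd_below (r ` {1..})" using r1 by (auto intro!: bdd_belowI[of _ 1])
  have L1: "1 \<le> L" unfolding L_def using r1 by (intro cInf_greatest) auto
  have Lr: "L \<le> r n" if "n \<ge> 1" for n
    unfolding L_def using bdd that by (intro cInf_lower) auto
  have rn: "real (f n) = r n ^ n" if "n \<ge> 1" for n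
    unfolding r_def using that by simp
  have ev: "\<forall>\<^sub>F n in sequentially. real (f n) \<le> b ^ n" if b: "L < b" for b
  proof -
    obtain p where p: "p \<ge> 1" "r p < (L + b) / 2"
      using cInf_lessD[of "r ` {1..}" "(L + b) / 2"] b unfolding L_def[symmetric] by auto
    have "real (f p) \<le> ((L + b) / 2) ^ p"
      unfolding rn[OF p(1)] using p r1[OF p(1)] by (intro power_mono) auto
    then show ?thesis using eventually_power_bound[of f p "(L + b) / 2" b] zero sub p L1 b by auto
  qed
  have "r \<longlonglongrightarrow> L"
  proof (rule order_tendstoI)
    fix a assume "a < L"
    then show "\<forall>\<^sub>F n in sequentially. a < r n"
      using Lr unfolding eventually_sequentially by (meson less_le_trans)
  next
    fix a assume a: "L < a"
    have "\<forall>\<^sub>F n in sequentially. real (f n) \<le> ((L + a) / 2) ^ n" using a ev by simp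
    then show "\<forall>\<^sub>F n in sequentially. r n < a"
      using eventually_ge_at_top[of 1]
    proof eventually_elim
      case (elim n)
      then have "r n ^ n \<le> ((L + a) / 2) ^ n" using rn by simp
      then have "r n \<le> (L + a) / 2" using elim(2) a L1 r1[OF elim(2)] power_mono_iff[of "r n" "(L + a) / 2" n] by simp
      then show ?case using a by simp
    qed
  qed
  then have "\<not> L > 1" using nexp unfolding exponential_growth_def r_def by blast
  then show ?thesis using ev c by simp
qed

lemma (in group) not_exponential_imp_subexponential_group:
  assumes S: "finite_symmetric_generating (G\<lparr>carrier := H\<rparr>) S" and H: "subgroup H G"
    and nexp: "\<not> exponential_growth (growth_function (G\<lparr>carrier := H\<rparr>) S)"
  shows "subexponential_group G H"
  unfolding subexponential_group_def
proof (intro allI impI)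
  fix F and c :: real assume F: "finite F" "F \<subseteq> H" and c: "1 < c"
  interpret H: group "G\<lparr>carrier := H\<rparr>" using H by (rule subgroup.subgroup_is_group[OF _ is_group])
  have S': "finite S" "S \<subseteq> carrier (G\<lparr>carrier := H\<rparr>)" "\<And>s. s \<in> S \<Longrightarrow> inv\<^bsub>G\<lparr>carrier := H\<rparr>\<^esub> s \<in> S"
    "generate (G\<lparr>carrier := H\<rparr>) S = H"
    using S by (auto simp: finite_symmetric_generating_def)
  have SG: "S \<subseteq> carrier G" using S'(2) H subgroup.subset by fastforce
  obtain d where d: "F \<subseteq> word_ball G S d"
    using H.finite_subset_word_ball[OF S'(2,3) F(1)] F S' by auto
  have gf: "growth_function (G\<lparr>carrier := H\<rparr>) S = (\<lambda>n. card (word_ball G S n))"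
    by (simp add: growth_function_def fun_eq_iff)
  have sub: "\<forall>\<^sub>F n in sequentially. real (card (word_ball G S n)) \<le> b ^ n" if "b > 1" for b
    using not_exponential_imp_subexponential[OF _ _ _ nexp that] card_word_ball_add[OF S'(1) SG]
      card_word_ball_pos[OF S'(1)] unfolding gf by simp
  \<comment> \<open>A ball of radius \<open>n\<close> in \<open>F\<close> lies in one of radius
    \<open>n * Suc d\<close> in \<open>S\<close>, so the rate \<open>c\<close> has to be shared
    among \<open>Suc d\<close> letters. The successor keeps the root meaningful for
    \<open>d = 0\<close> and makes the larger radius at least \<open>n\<close>, hence at least
    \<open>n0\<close>.\<close>
  define b where "b = root (Suc d) c"
  have b: "b > 1" "b ^ Suc d = c"
    using c real_root_pow_pos2[of "Suc d" c] by (auto simp add: b_def simp del: power_Suc)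
  obtain n0 where n0: "real (card (word_ball G S n)) \<le> b ^ n" if "n \<ge> n0" for n
    using sub[OF b(1)] unfolding eventually_sequentially by blast
  have "real (card (word_ball G F n)) \<le> c ^ n" if "n \<ge> n0" for n
  proof -
    have "F \<subseteq> word_ball G S (Suc d)" using d word_ball_mono[of S S d "Suc d" G] by auto
    then have "word_ball G F n \<subseteq> word_ball G S (n * Suc d)" using word_ball_subst[OF SG] by blast
    then have "card (word_ball G F n) \<le> card (word_ball G S (n * Suc d))"
      by (intro card_mono finite_word_ball S'(1))
    also have "real \<dots> \<le> b ^ (n * Suc d)" using that by (intro n0) auto
    also have "\<dots> = c ^ n" using b(2) by (metis power_mult mult.commute)
    finally show ?thesis by simp
  qed
  then show "\<forall>\<^sub>F n in sequentially. real (card (word_ball G F n)) \<le> c ^ n"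
    unfolding eventually_sequentially by blast
qed

section \<open>Coincidences among products of two elements\<close>

context group
begin

text \<open>The element \<open>h\<^sup>b\<^sup>0 t h\<^sup>b\<^sup>1 t \<cdots> h\<^sup>b\<^sup>k t \<cdot> t\<^sup>-\<^sup>k\<^sup>-\<^sup>1\<close>
  with exponents 0 or 1, which is a product of conjugates of \<open>h\<close> by powers of \<open>t\<close>.\<close>

fun conj_word :: "'a \<Rightarrow> 'a \<Rightarrow> bool list \<Rightarrow> 'a" where
  "conj_word t h [] = \<one>"
| "conj_word t h (b # bs) = (if b then h else \<one>) \<otimes> (t \<otimes> conj_word t h bs \<otimes> inv t)"

lemma inv_mult_mult_cancel: "x \<in> carrier G \<Longrightarrow> y \<in> carrier G \<Longrightarrow> inv x \<otimes> (x \<otimes> y) = y"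
  by (simp flip: m_assoc)

lemma mult_inv_mult_cancel: "x \<in> carrier G \<Longrightarrow> y \<in> carrier G \<Longrightarrow> x \<otimes> (inv x \<otimes> y) = y"
  by (simp flip: m_assoc)

lemmas group_word_simps = m_assoc inv_mult_group inv_mult_mult_cancel mult_inv_mult_cancel

lemma conj_word_closed [simp]:
  "t \<in> carrier G \<Longrightarrow> h \<in> carrier G \<Longrightarrow> conj_word t h bs \<in> carrier G"
  by (induction bs) auto

text \<open>\<open>conj_word t h bs\<close> times \<open>t [^] length bs\<close> is a product of
  factors \<open>h \<otimes> t\<close> and \<open>t\<close>, one per bit, so a ball of radius
  \<open>n\<close> with fewer than \<open>2 ^ n\<close> elements identifies two of the words. After
  their common prefix is cancelled, one side begins with \<open>h\<close> and the other does not;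
  solving for \<open>h\<close> leaves conjugates by positive powers of \<open>t\<close>
  only.\<close>

lemma conj_word_coincidence:
  assumes SE: "subexponential_group G H" and H: "H \<subseteq> carrier G" "t \<in> H" "h \<otimes> t \<in> H"
    and h: "h \<in> carrier G"
  shows "\<exists>bs bs'. h = t \<otimes> (conj_word t h bs \<otimes> inv (conj_word t h bs')) \<otimes> inv t"
proof -
  let ?W = "conj_word t h"
  have t: "t \<in> carrier G" using H by blast
  let ?F = "{h \<otimes> t, t}"
  have ball: "?W bs \<otimes> t [^] length bs \<in> word_ball G ?F (length bs)" for bs
  proof (induction bs)
    case Nil then show ?case by simp
  next
    case (Cons b bs)
    have "t [^] Suc (length bs) = t \<otimes> t [^] length bs" using t by (rule nat_pow_Suc2)
    then have "?W (b # bs) \<otimes> t [^] length (b # bs) =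
        (if b then h \<otimes> t else t) \<otimes> (?W bs \<otimes> t [^] length bs)"
      using t h by (simp add: group_word_simps)
    then show ?case using word_ball_Suc_step[OF _ Cons] by auto
  qed
  have ht: "h \<otimes> t \<in> carrier G" using h t by simp
  have "\<forall>\<^sub>F n in sequentially. real (card (word_ball G ?F n)) \<le> (3/2) ^ n"
    using SE H unfolding subexponential_group_def by auto
  then obtain n0 where "real (card (word_ball G ?F n)) \<le> (3/2) ^ n" if "n \<ge> n0" for n
    unfolding eventually_sequentially by blast
  then obtain n where n: "n \<ge> 1" "real (card (word_ball G ?F n)) \<le> (3/2) ^ n"
    by (meson max.cobounded1 max.cobounded2)
  let ?A = "{bs :: bool list. set bs \<subseteq> UNIV \<and> length bs = n}"
  have "\<not> inj_on ?W ?A"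
  proof
    assume inj: "inj_on ?W ?A"
    have "inj_on (\<lambda>bs. ?W bs \<otimes> t [^] n) ?A"
      using inj t h unfolding inj_on_def by simp
    moreover have "(\<lambda>bs. ?W bs \<otimes> t [^] n) ` ?A \<subseteq> word_ball G ?F n" using ball by auto
    ultimately have "card ?A \<le> card (word_ball G ?F n)"
      by (intro card_inj_on_le[of _ ?A]) (auto intro: finite_word_ball)
    then have "2 ^ n \<le> real (card (word_ball G ?F n))"
      using card_lists_length_eq[of "UNIV :: bool set" n] by simp
    moreover have "(3/2::real) ^ n < 2 ^ n" using n(1) by (intro power_strict_mono) auto
    ultimately show False using n(2) by linarith
  qed
  then obtain as bs where neq: "as \<noteq> bs" "length as = length bs" "?W as = ?W bs"
    unfolding inj_on_def by auto
  \<comment> \<open>The lists are quantified anew: the words obtained here are the tails after the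
    first differing bit, in whichever order puts \<open>h\<close> on the left side.\<close>
  have key: "\<exists>as bs. h \<otimes> (t \<otimes> ?W as \<otimes> inv t) = t \<otimes> ?W bs \<otimes> inv t"
    using neq(2,1,3)
  proof (induction as bs rule: list_induct2)
    case Nil then show ?case by simp
  next
    case (Cons a as b bs)
    show ?case
    proof (cases "a = b")
      case True
      then have "t \<otimes> ?W as \<otimes> inv t = t \<otimes> ?W bs \<otimes> inv t"
        using Cons.prems(2) h t by (cases b) simp_all
      then have "?W as = ?W bs" using t h by (simp add: group_word_simps)
      then show ?thesis using Cons True by auto
    next
      case False
      show ?thesis
      proof (cases a)
        case True
        then have "h \<otimes> (t \<otimes> ?W as \<otimes> inv t) = t \<otimes> ?W bs \<otimes> inv t"
          using False Cons.prems(2) h t by simp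
        then show ?thesis by blast
      next
        case a: False
        then have "h \<otimes> (t \<otimes> ?W bs \<otimes> inv t) = t \<otimes> ?W as \<otimes> inv t"
          using False Cons.prems(2) h t by simp
        then show ?thesis by blast
      qed
    qed
  qed
  then obtain as bs where *: "h \<otimes> (t \<otimes> ?W as \<otimes> inv t) = t \<otimes> ?W bs \<otimes> inv t" by blast
  have "h = (t \<otimes> ?W bs \<otimes> inv t) \<otimes> inv (t \<otimes> ?W as \<otimes> inv t)"
    using t h by (subst *[symmetric]) (simp add: group_word_simps)
  also have "\<dots> = t \<otimes> (?W bs \<otimes> inv (?W as)) \<otimes> inv t"
    using t h by (simp add: group_word_simps)
  finally show ?thesis by blast
qed

end

section \<open>Homomorphisms to the reals and Milnor's lemma\<close>

text \<open>The values lie in an arbitrary ring because integer coordinates, real characters and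
  complex eigenfunctionals all occur. The map is total, but only its restriction to \<open>H\<close>
  matters.\<close>

definition additive_on :: "('a, 'b) monoid_scheme \<Rightarrow> 'a set \<Rightarrow> ('a \<Rightarrow> 'c::ring_1) \<Rightarrow> bool"
  where "additive_on G H \<phi> \<longleftrightarrow> (\<forall>x\<in>H. \<forall>y\<in>H. \<phi> (x \<otimes>\<^bsub>G\<^esub> y) = \<phi> x + \<phi> y)"

text \<open>For finitely generated \<open>H\<close> this is the preimage in \<open>H\<close> of the
  torsion of the abelianization. Dividing by it, and not by the commutator subgroup, gives quotients
  without torsion.\<close>

definition real_kernel :: "('a, 'b) monoid_scheme \<Rightarrow> 'a set \<Rightarrow> 'a set"
  where "real_kernel G H = {x \<in> H. \<forall>\<phi> :: 'a \<Rightarrow> real. additive_on G H \<phi> \<longrightarrow> \<phi> x = 0}"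

definition fg_subgroup :: "('a, 'b) monoid_scheme \<Rightarrow> 'a set \<Rightarrow> bool"
  where "fg_subgroup G H \<longleftrightarrow> (\<exists>F. finite F \<and> F \<subseteq> carrier G \<and> H = generate G F)"

context group
begin

lemma fg_subgroup_is_subgroup: "fg_subgroup G H \<Longrightarrow> subgroup H G"
  unfolding fg_subgroup_def using generate_is_subgroup by blast

lemma fg_subgroup_symmetric:
  assumes "fg_subgroup G H"
  shows "\<exists>S. finite S \<and> S \<subseteq> H \<and> (\<forall>s\<in>S. inv s \<in> S) \<and> H = generate G S"
proof -
  obtain F where F: "finite F" "F \<subseteq> carrier G" "H = generate G F"
    using assms unfolding fg_subgroup_def by blast
  let ?S = "F \<union> (\<lambda>s. inv s) ` F"
  have "?S \<subseteq> H" unfolding F(3) by (auto intro: generate.incl generate.inv)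
  moreover have "H = generate G ?S"
  proof
    show "H \<subseteq> generate G ?S" unfolding F(3) by (rule mono_generate) auto
    show "generate G ?S \<subseteq> H" unfolding F(3)
      using \<open>?S \<subseteq> H\<close> F by (intro generate_subgroup_incl generate_is_subgroup) auto
  qed
  moreover have "\<forall>s\<in>?S. inv s \<in> ?S" using F(2) by auto
  ultimately show ?thesis using F(1) by (intro exI[of _ ?S]) auto
qed

lemma additive_on_mult: "additive_on G H \<phi> \<Longrightarrow> x \<in> H \<Longrightarrow> y \<in> H \<Longrightarrow> \<phi> (x \<otimes> y) = \<phi> x + \<phi> y"
  by (simp add: additive_on_def)

lemma additive_on_one:
  assumes "subgroup H G" "additive_on G H \<phi>"
  shows "\<phi> \<one> = 0"
proof -
  have "\<phi> (\<one> \<otimes> \<one>) = \<phi> \<one> + \<phi> \<one>"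
    using assms additive_on_mult subgroup.one_closed by metis
  then show ?thesis by simp
qed

lemma additive_on_inv:
  assumes "subgroup H G" "additive_on G H \<phi>" "x \<in> H"
  shows "\<phi> (inv x) = - \<phi> x"
proof -
  have "\<phi> (x \<otimes> inv x) = \<phi> x + \<phi> (inv x)"
    using assms additive_on_mult subgroup.m_inv_closed by metis
  moreover have "x \<otimes> inv x = \<one>" using assms subgroup.mem_carrier by (metis r_inv)
  ultimately show ?thesis using additive_on_one[OF assms(1,2)] by (simp add: add_eq_0_iff)
qed

lemma additive_on_int_pow:
  assumes "subgroup H G" "additive_on G H \<phi>" "x \<in> H"
  shows "\<phi> (x [^] (i::int)) = of_int i * \<phi> x"
proof -
  have nat: "\<phi> (x [^] (n::nat)) = of_nat n * \<phi> x" for n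
  proof (induction n)
    case 0 then show ?case using additive_on_one[OF assms(1,2)] by simp
  next
    case (Suc n)
    have "x [^] n \<in> H"
      using subgroup_int_pow_closed[OF assms(1,3), of "int n"] by (simp add: int_pow_int)
    then show ?case using Suc additive_on_mult[OF assms(2)] assms(3) by (simp add: algebra_simps)
  qed
  have x: "x \<in> carrier G" using assms subgroup.mem_carrier by metis
  show ?thesis
  proof (cases i rule: int_cases2)
    case (nonneg n)
    then show ?thesis using nat[of n] by (simp add: int_pow_int)
  next
    case (nonpos n)
    have "x [^] n \<in> H"
      using subgroup_int_pow_closed[OF assms(1,3), of "int n"] by (simp add: int_pow_int)
    then show ?thesis
      using nat[of n] additive_on_inv[OF assms(1,2)] x nonpos by (simp add: int_pow_neg int_pow_int)
  qed
qed

lemma real_kernel_subset: "real_kernel G H \<subseteq> H"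
  by (auto simp: real_kernel_def)

lemma real_kernel_subgroup:
  assumes "subgroup H G"
  shows "subgroup (real_kernel G H) G"
proof
  show "real_kernel G H \<subseteq> carrier G" using assms subgroup.subset real_kernel_subset by blast
  show "\<one> \<in> real_kernel G H"
    unfolding real_kernel_def using assms subgroup.one_closed additive_on_one[OF assms] by blast
  show "x \<otimes> y \<in> real_kernel G H" if "x \<in> real_kernel G H" "y \<in> real_kernel G H" for x y
  proof -
    have xy: "x \<in> H" "y \<in> H" using that by (simp_all add: real_kernel_def)
    have "\<phi> (x \<otimes> y) = 0" if "additive_on G H \<phi>" for \<phi> :: "'a \<Rightarrow> real"
      using additive_on_mult[OF that xy] \<open>additive_on G H \<phi>\<close> \<open>x \<in> real_kernel G H\<close> \<open>y \<in> real_kernel G H\<close>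
      unfolding real_kernel_def by auto
    then show ?thesis using subgroup.m_closed[OF assms xy] by (simp add: real_kernel_def)
  qed
  show "inv x \<in> real_kernel G H" if "x \<in> real_kernel G H" for x
  proof -
    have x: "x \<in> H" using that by (simp add: real_kernel_def)
    have "\<phi> (inv x) = 0" if "additive_on G H \<phi>" for \<phi> :: "'a \<Rightarrow> real"
      using additive_on_inv[OF assms that x] that \<open>x \<in> real_kernel G H\<close>
      by (simp add: real_kernel_def)
    then show ?thesis using subgroup.m_inv_closed[OF assms x] by (simp add: real_kernel_def)
  qed
qed

lemma real_kernel_conj:
  assumes H: "subgroup H G" and g: "g \<in> carrier G" "\<And>x. x \<in> H \<Longrightarrow> g \<otimes> x \<otimes> inv g \<in> H"
    and x: "x \<in> real_kernel G H"
  shows "g \<otimes> x \<otimes> inv g \<in> real_kernel G H"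
proof -
  have "\<phi> (g \<otimes> x \<otimes> inv g) = 0" if \<phi>: "additive_on G H \<phi>" for \<phi> :: "'a \<Rightarrow> real"
  proof -
    have "additive_on G H (\<lambda>y. \<phi> (g \<otimes> y \<otimes> inv g))"
      unfolding additive_on_def
    proof (intro ballI)
      fix y z assume yz: "y \<in> H" "z \<in> H"
      then have "g \<otimes> (y \<otimes> z) \<otimes> inv g = (g \<otimes> y \<otimes> inv g) \<otimes> (g \<otimes> z \<otimes> inv g)"
        using g(1) H subgroup.mem_carrier by (simp add: group_word_simps subgroup.mem_carrier[OF H])
      then show "\<phi> (g \<otimes> (y \<otimes> z) \<otimes> inv g) = \<phi> (g \<otimes> y \<otimes> inv g) + \<phi> (g \<otimes> z \<otimes> inv g)"
        using g(2) yz additive_on_mult[OF \<phi>] by simp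
    qed
    then show ?thesis using x unfolding real_kernel_def by blast
  qed
  then show ?thesis using x g(2) unfolding real_kernel_def by blast
qed

section \<open>Conjugation by integer powers and finite generation of kernels\<close>

definition cj :: "'a \<Rightarrow> int \<Rightarrow> 'a \<Rightarrow> 'a"
  where "cj t i x = t [^] i \<otimes> x \<otimes> inv (t [^] i)"

lemma cj_closed [simp]: "t \<in> carrier G \<Longrightarrow> x \<in> carrier G \<Longrightarrow> cj t i x \<in> carrier G"
  by (simp add: cj_def)

lemma cj_0 [simp]: "x \<in> carrier G \<Longrightarrow> cj t 0 x = x"
  by (simp add: cj_def)

lemma cj_1: "t \<in> carrier G \<Longrightarrow> cj t 1 x = t \<otimes> x \<otimes> inv t"
  by (simp add: cj_def)

lemma cj_one [simp]: "t \<in> carrier G \<Longrightarrow> cj t i \<one> = \<one>"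
  by (simp add: cj_def)

lemma cj_add:
  "t \<in> carrier G \<Longrightarrow> x \<in> carrier G \<Longrightarrow> cj t i (cj t j x) = cj t (i + j) x"
  by (simp add: cj_def int_pow_mult group_word_simps)

lemma cj_mult:
  "t \<in> carrier G \<Longrightarrow> x \<in> carrier G \<Longrightarrow> y \<in> carrier G \<Longrightarrow> cj t i (x \<otimes> y) = cj t i x \<otimes> cj t i y"
  by (simp add: cj_def group_word_simps)

lemma cj_inv: "t \<in> carrier G \<Longrightarrow> x \<in> carrier G \<Longrightarrow> cj t i (inv x) = inv (cj t i x)"
  by (simp add: cj_def group_word_simps)

lemma cj_inv_left: "t \<in> carrier G \<Longrightarrow> cj (inv t) i x = cj t (- i) x"
  by (simp add: cj_def int_pow_inv int_pow_neg)

lemma cj_subgroup: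
  assumes "subgroup H G" "t \<in> H" "x \<in> H"
  shows "cj t i x \<in> H"
  unfolding cj_def using assms
  by (intro subgroup.m_closed[OF assms(1)] subgroup.m_inv_closed[OF assms(1)] subgroup_int_pow_closed)

lemma additive_on_cj:
  assumes H: "subgroup H G" and \<phi>: "additive_on G H (\<phi> :: 'a \<Rightarrow> 'c::comm_ring_1)" and tx: "t \<in> H" "x \<in> H"
  shows "\<phi> (cj t i x) = \<phi> x"
proof -
  have t: "t [^] i \<in> H" using H tx by (intro subgroup_int_pow_closed)
  then have "\<phi> (cj t i x) = \<phi> (t [^] i) + \<phi> x + \<phi> (inv (t [^] i))"
    unfolding cj_def using additive_on_mult[OF \<phi>] tx H
    by (simp add: subgroup.m_closed subgroup.m_inv_closed)
  then show ?thesis using additive_on_inv[OF H \<phi> t] by simp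
qed

lemma cj_conj_word_in_subgroup:
  assumes A: "subgroup A G" and th: "t \<in> carrier G" "h \<in> carrier G"
  shows "(\<And>i. k \<le> i \<Longrightarrow> i < k + int (length bs) \<Longrightarrow> cj t i h \<in> A) \<Longrightarrow> cj t k (conj_word t h bs) \<in> A"
proof (induction bs arbitrary: k)
  case Nil
  then show ?case using th A by (simp add: subgroup.one_closed)
next
  case (Cons b bs)
  have "cj t (k + 1) (conj_word t h bs) \<in> A" by (rule Cons.IH) (use Cons.prems in auto)
  moreover have "cj t k (if b then h else \<one>) \<in> A"
    using Cons.prems[of k] A th by (auto simp: subgroup.one_closed)
  moreover have "cj t k (conj_word t h (b # bs)) =
      cj t k (if b then h else \<one>) \<otimes> cj t (k + 1) (conj_word t h bs)"
    using th by (simp only: conj_word.simps cj_1[symmetric]) (auto simp: cj_mult cj_add)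
  ultimately show ?case using A by (simp add: subgroup.m_closed)
qed

text \<open>The coincidence expresses \<open>h\<close> through conjugates with exponents from 1 to
  the length of the longer word; conjugating this relation by \<open>t [^] k\<close> shifts the
  exponents. \<open>R\<close> is chosen before \<open>A\<close> and \<open>k\<close>, which allows
  the recurrence to be iterated.\<close>

lemma conj_recurrence:
  assumes SE: "subexponential_group G H" and H: "subgroup H G" and th: "t \<in> H" "h \<in> H"
  shows "\<exists>R::nat. \<forall>A k. subgroup A G \<longrightarrow> (\<forall>i. k < i \<and> i \<le> k + int R \<longrightarrow> cj t i h \<in> A) \<longrightarrow> cj t k h \<in> A"
proof -
  have c: "t \<in> carrier G" "h \<in> carrier G" using H th by (auto simp: subgroup.mem_carrier)
  obtain bs bs' where eq: "h = t \<otimes> (conj_word t h bs \<otimes> inv (conj_word t h bs')) \<otimes> inv t"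
    using conj_word_coincidence[OF SE subgroup.subset[OF H] th(1) subgroup.m_closed[OF H th(2,1)] c(2)]
    by blast
  let ?R = "max (length bs) (length bs')"
  have "cj t k h \<in> A" if A: "subgroup A G" and *: "\<And>i. k < i \<Longrightarrow> i \<le> k + int ?R \<Longrightarrow> cj t i h \<in> A" for A k
  proof -
    have "cj t k h = cj t k (cj t 1 (conj_word t h bs \<otimes> inv (conj_word t h bs')))"
      using eq c by (simp add: cj_1)
    also have "\<dots> = cj t (k + 1) (conj_word t h bs) \<otimes> inv (cj t (k + 1) (conj_word t h bs'))"
      using c by (simp add: cj_add cj_mult cj_inv)
    also have "\<dots> \<in> A"
      by (intro subgroup.m_closed[OF A] subgroup.m_inv_closed[OF A] cj_conj_word_in_subgroup A c *) auto
    finally show ?thesis .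
  qed
  then show ?thesis by (intro exI[of _ ?R]) blast
qed

text \<open>The recurrence for \<open>t\<close> extends membership in \<open>A\<close> to lower
  exponents, the one for \<open>inv t\<close> to higher ones, so a symmetric window whose radius
  dominates both ranges grows by one on each side at every step.\<close>

lemma conj_finite_range:
  assumes SE: "subexponential_group G H" and H: "subgroup H G" and th: "t \<in> H" "h \<in> H"
  shows "\<exists>R::nat. \<forall>A. subgroup A G \<longrightarrow> (\<forall>i. \<bar>i\<bar> \<le> int R \<longrightarrow> cj t i h \<in> A) \<longrightarrow> (\<forall>i. cj t i h \<in> A)"
proof -
  have c: "t \<in> carrier G" using H th by (auto simp: subgroup.mem_carrier)
  obtain R1 :: nat where R1: "\<forall>A k. subgroup A G \<longrightarrow>
      (\<forall>i. k < i \<and> i \<le> k + int R1 \<longrightarrow> cj t i h \<in> A) \<longrightarrow> cj t k h \<in> A"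
    by (rule exE[OF conj_recurrence[OF SE H th]])
  have it: "inv t \<in> H" using H th(1) by (rule subgroup.m_inv_closed)
  obtain R2 :: nat where R2: "\<forall>A k. subgroup A G \<longrightarrow>
      (\<forall>i. k < i \<and> i \<le> k + int R2 \<longrightarrow> cj (inv t) i h \<in> A) \<longrightarrow> cj (inv t) k h \<in> A"
    by (rule exE[OF conj_recurrence[OF SE H it th(2)]])
  define R where "R = max R1 R2"
  have "cj t i h \<in> A" if A: "subgroup A G" and *: "\<And>i. \<bar>i\<bar> \<le> int R \<Longrightarrow> cj t i h \<in> A" for A i
  proof -
    have "\<forall>i. \<bar>i\<bar> \<le> int R + int n \<longrightarrow> cj t i h \<in> A" for n
    proof (induction n)
      case 0 then show ?case using * by simp
    next
      case (Suc n)
      show ?case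
      proof (intro allI impI)
        fix i assume i: "\<bar>i\<bar> \<le> int R + int (Suc n)"
        consider "\<bar>i\<bar> \<le> int R + int n" | "i = int R + int (Suc n)" | "i = - (int R + int (Suc n))"
          using i by fastforce
        then show "cj t i h \<in> A"
        proof cases
          case 1 then show ?thesis using Suc by blast
        next
          case 2
          have "cj (inv t) (- i) h \<in> A"
          proof (rule R2[rule_format, OF A])
            fix j assume "- i < j \<and> j \<le> - i + int R2"
            then have "\<bar>- j\<bar> \<le> int R + int n" using 2 unfolding R_def by auto
            then show "cj (inv t) j h \<in> A" using Suc c by (simp add: cj_inv_left)
          qed
          then show ?thesis using c by (simp add: cj_inv_left)
        next
          case 3
          show ?thesis
          proof (rule R1[rule_format, OF A])
            fix j assume "i < j \<and> j \<le> i + int R1"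
            then have "\<bar>j\<bar> \<le> int R + int n" using 3 unfolding R_def by auto
            then show "cj t j h \<in> A" using Suc by blast
          qed
        qed
      qed
    qed
    from this[of "nat \<bar>i\<bar>"] show ?thesis by auto
  qed
  then show ?thesis by blast
qed

text \<open>By the previous lemma, finitely many conjugates of the generators suffice to generate the kernel.\<close>

lemma kernel_int_hom_fg:
  assumes SE: "subexponential_group G H" and fg: "fg_subgroup G H"
    and \<phi>: "additive_on G H (\<phi> :: 'a \<Rightarrow> int)" and t: "t \<in> H" "\<phi> t = 1"
  shows "fg_subgroup G {x \<in> H. \<phi> x = 0}"
proof -
  let ?N = "{x \<in> H. \<phi> x = 0}"
  obtain F where F: "finite F" "F \<subseteq> carrier G" "H = generate G F"
    using fg unfolding fg_subgroup_def by blast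
  have H: "subgroup H G" using fg by (rule fg_subgroup_is_subgroup)
  note Hc = subgroup.mem_carrier[OF H]
  have tp: "t [^] i \<in> H" for i :: int using H t(1) by (rule subgroup_int_pow_closed)
  have \<phi>t: "\<phi> (t [^] i) = i" for i :: int using additive_on_int_pow[OF H \<phi> t(1), of i] t(2) by simp
  \<comment> \<open>The generators are pushed into the kernel by powers of \<open>t\<close>, which
    is possible because \<open>\<phi> t = 1\<close>. Finitely many conjugates of the results by
    powers of \<open>t\<close> then generate a subgroup that is stable under conjugation by
    \<open>t\<close>.\<close>
  define F0 where "F0 = (\<lambda>x. x \<otimes> inv (t [^] \<phi> x)) ` F"
  have FH: "F \<subseteq> H" unfolding F(3) by (auto intro: generate.incl)
  have F0: "F0 \<subseteq> ?N"
    using FH tp H \<phi>t unfolding F0_def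
    by (auto simp: additive_on_mult[OF \<phi>] additive_on_inv[OF H \<phi>] subgroup.m_closed subgroup.m_inv_closed)
  have "\<forall>h\<in>F0. \<exists>R::nat. \<forall>A. subgroup A G \<longrightarrow> (\<forall>i. \<bar>i\<bar> \<le> int R \<longrightarrow> cj t i h \<in> A) \<longrightarrow> (\<forall>i. cj t i h \<in> A)"
    using conj_finite_range[OF SE H t(1)] F0 by blast
  then obtain R :: "'a \<Rightarrow> nat" where R: "\<And>h A i. h \<in> F0 \<Longrightarrow> subgroup A G \<Longrightarrow>
      (\<And>i. \<bar>i\<bar> \<le> int (R h) \<Longrightarrow> cj t i h \<in> A) \<Longrightarrow> cj t i h \<in> A"
    by (metis (no_types, lifting))
  define Z where "Z = (\<Union>h\<in>F0. (\<lambda>i. cj t i h) ` {- int (R h)..int (R h)})"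
  define A where "A = generate G Z"
  have Zfin: "finite Z" unfolding Z_def F0_def using F(1) by auto
  have N: "subgroup ?N G"
  proof
    show "?N \<subseteq> carrier G" using Hc by blast
    show "\<one> \<in> ?N" using subgroup.one_closed[OF H] additive_on_one[OF H \<phi>] by simp
  qed (auto simp: additive_on_mult[OF \<phi>] additive_on_inv[OF H \<phi>] subgroup.m_closed[OF H] subgroup.m_inv_closed[OF H])
  have ZN: "Z \<subseteq> ?N"
    unfolding Z_def using F0 by (auto simp: additive_on_cj[OF H \<phi> t(1)] intro!: cj_subgroup[OF H t(1)])
  then have Zc: "Z \<subseteq> carrier G" using Hc by blast
  have A: "subgroup A G" unfolding A_def by (rule generate_is_subgroup[OF Zc])
  note Ac = subgroup.mem_carrier[OF A]
  have AN: "A \<subseteq> ?N" unfolding A_def using ZN by (intro generate_subgroup_incl N)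
  have cjF0: "cj t i h \<in> A" if h: "h \<in> F0" for i h
  proof (rule R[OF h A])
    fix i assume "\<bar>i\<bar> \<le> int (R h)"
    then have "cj t i h \<in> Z" unfolding Z_def using h by (intro UN_I[of h] imageI) auto
    then show "cj t i h \<in> A" unfolding A_def by (rule generate.incl)
  qed
  have cjZ: "cj t k z \<in> A" if "z \<in> Z" for k z
  proof -
    obtain h i where h: "h \<in> F0" "z = cj t i h" using \<open>z \<in> Z\<close> unfolding Z_def by auto
    then have "cj t k z = cj t (k + i) h" using F0 Hc t(1) by (auto intro!: cj_add)
    then show ?thesis using cjF0[OF h(1)] by simp
  qed
  have tc: "t \<in> carrier G" using t Hc by blast
  have cjA: "cj t k a \<in> A" if "a \<in> A" for k a
    using that unfolding A_def
  proof (induction a)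
    case one then show ?case using tc A_def A subgroup.one_closed by auto
  next
    case (incl h) then show ?case using cjZ A_def by blast
  next
    case (inv h)
    have "cj t k (inv h) = inv (cj t k h)" using inv Zc tc by (intro cj_inv) auto
    then show ?case using cjZ[OF inv] subgroup.m_inv_closed[OF A] A_def by simp
  next
    case (eng x y)
    have "cj t k (x \<otimes> y) = cj t k x \<otimes> cj t k y"
      using eng tc Ac unfolding A_def by (intro cj_mult) auto
    then show ?case using eng subgroup.m_closed[OF A] A_def by simp
  qed
  \<comment> \<open>As \<open>A\<close> is stable under conjugation by all powers of
    \<open>t\<close>, these powers can be collected on the right. For an element of the kernel the
    collected exponent is its value under \<open>\<phi>\<close>, namely 0.\<close>
  have "\<exists>a\<in>A. \<exists>j::int. x = a \<otimes> t [^] j" if "x \<in> generate G F" for x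
    using that
  proof (induction x)
    case one
    show ?case using subgroup.one_closed[OF A] by (intro bexI[of _ \<one>] exI[of _ 0]) auto
  next
    case (incl h)
    have "h \<otimes> inv (t [^] \<phi> h) \<in> A" using cjF0[of "h \<otimes> inv (t [^] \<phi> h)" 0] incl F(2) tc
      by (auto simp: F0_def)
    moreover have "h = (h \<otimes> inv (t [^] \<phi> h)) \<otimes> t [^] \<phi> h"
      using incl F(2) tc by (auto simp: m_assoc)
    ultimately show ?case by blast
  next
    case (inv h)
    define a where "a = h \<otimes> inv (t [^] \<phi> h)"
    have a: "a \<in> A" using cjF0[of a 0] inv F(2) tc by (auto simp: F0_def a_def)
    have "inv h = cj t (- \<phi> h) (inv a) \<otimes> t [^] (- \<phi> h)"
      using inv F(2) tc unfolding a_def cj_def by (auto simp: group_word_simps int_pow_neg)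
    moreover have "cj t (- \<phi> h) (inv a) \<in> A" using cjA a subgroup.m_inv_closed[OF A] by blast
    ultimately show ?case by blast
  next
    case (eng x y)
    then obtain a b and i j :: int where ab: "a \<in> A" "b \<in> A" "x = a \<otimes> t [^] i" "y = b \<otimes> t [^] j" by blast
    have "x \<otimes> y = (a \<otimes> cj t i b) \<otimes> t [^] (i + j)"
      using ab Ac tc unfolding cj_def by (simp add: group_word_simps int_pow_mult)
    moreover have "a \<otimes> cj t i b \<in> A" using ab cjA subgroup.m_closed[OF A] by blast
    ultimately show ?case by blast
  qed
  then have dec: "\<exists>a\<in>A. \<exists>j::int. x = a \<otimes> t [^] j" if "x \<in> H" for x using that F(3) by blast
  have "?N \<subseteq> A"
  proof
    fix x assume x: "x \<in> ?N"
    then obtain a and j :: int where a: "a \<in> A" "x = a \<otimes> t [^] j" using dec by blast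
    then have "\<phi> x = j" using additive_on_mult[OF \<phi> _ tp, of a] AN \<phi>t by auto
    then show "x \<in> A" using x a Ac by auto
  qed
  then have "?N = A" using AN by blast
  then show ?thesis unfolding fg_subgroup_def A_def using Zfin Zc by blast
qed

section \<open>Integer coordinates modulo the real kernel\<close>

definition char_basis :: "'a set \<Rightarrow> 'i set \<Rightarrow> ('i \<Rightarrow> 'a) \<Rightarrow> bool"
  where "char_basis H I g \<longleftrightarrow> finite I \<and> g ` I \<subseteq> H \<and>
    (\<forall>x\<in>H. \<exists>e :: 'i \<Rightarrow> int. \<forall>\<phi> :: 'a \<Rightarrow> real. additive_on G H \<phi> \<longrightarrow>
      \<phi> x = (\<Sum>i\<in>I. of_int (e i) * \<phi> (g i)))"

text \<open>The exponent sums of a word in the generators are coefficients valid for all characters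
  at once. Thus \<open>char_basis\<close> says that a family generates \<open>H\<close> modulo its
  real kernel, without forming a quotient group; independence comes only with minimal
  cardinality.\<close>

lemma char_basis_exists:
  assumes fg: "fg_subgroup G H"
  shows "\<exists>I (g :: nat \<Rightarrow> 'a). char_basis H I g"
proof -
  obtain F where F: "finite F" "F \<subseteq> carrier G" "H = generate G F"
    using fg unfolding fg_subgroup_def by blast
  have H: "subgroup H G" using fg by (rule fg_subgroup_is_subgroup)
  obtain n and g :: "nat \<Rightarrow> 'a" where g: "F = g ` {i. i < n}"
    using F(1) finite_imp_nat_seg_image_inj_on by metis
  let ?P = "\<lambda>x. \<exists>e :: nat \<Rightarrow> int. \<forall>\<phi> :: 'a \<Rightarrow> real. additive_on G H \<phi> \<longrightarrow>
      \<phi> x = (\<Sum>i\<in>{..<n}. of_int (e i) * \<phi> (g i))"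
  have FH: "F \<subseteq> H" unfolding F(3) by (auto intro: generate.incl)
  have inF: "?P f" if f: "f \<in> F" for f
  proof -
    obtain k where k: "k < n" "f = g k" using f g by auto
    have "(\<Sum>i<n. of_int (if i = k then 1 else 0) * \<phi> (g i)) = \<phi> f" for \<phi> :: "'a \<Rightarrow> real"
      using k by (simp add: if_distrib[of of_int] if_distrib[of "\<lambda>c. c * _"] cong: if_cong)
    then show ?thesis by (intro exI[of _ "\<lambda>i. if i = k then 1 else 0"]) simp
  qed
  have inv: "?P (inv f)" if f: "f \<in> H" "?P f" for f
  proof -
    obtain e :: "nat \<Rightarrow> int" where e: "\<And>\<phi> :: 'a \<Rightarrow> real. additive_on G H \<phi> \<Longrightarrow>
        \<phi> f = (\<Sum>i\<in>{..<n}. of_int (e i) * \<phi> (g i))" using f(2) by blast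
    show ?thesis
      by (intro exI[of _ "\<lambda>i. - e i"]) (simp add: e additive_on_inv[OF H _ f(1)] sum_negf)
  qed
  have "?P x" if "x \<in> generate G F" for x
    using that
  proof (induction x)
    case one
    then show ?case by (intro exI[of _ "\<lambda>i. 0"]) (simp add: additive_on_one[OF H])
  next
    case (incl h) then show ?case by (rule inF)
  next
    case (inv h) then show ?case using inF FH by (intro \<open>\<And>f. f \<in> H \<Longrightarrow> ?P f \<Longrightarrow> ?P (inv f)\<close>) auto
  next
    case (eng x y)
    obtain e :: "nat \<Rightarrow> int" where e: "\<And>\<phi> :: 'a \<Rightarrow> real. additive_on G H \<phi> \<Longrightarrow>
        \<phi> x = (\<Sum>i\<in>{..<n}. of_int (e i) * \<phi> (g i))" using eng(3) by blast
    obtain e' :: "nat \<Rightarrow> int" where e': "\<And>\<phi> :: 'a \<Rightarrow> real. additive_on G H \<phi> \<Longrightarrow>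
        \<phi> y = (\<Sum>i\<in>{..<n}. of_int (e' i) * \<phi> (g i))" using eng(4) by blast
    have xy: "x \<in> H" "y \<in> H" using eng F(3) by auto
    show ?case
      by (intro exI[of _ "\<lambda>i. e i + e' i"])
         (simp add: e e' additive_on_mult[OF _ xy] sum.distrib distrib_right)
  qed
  then have "char_basis H {..<n} g"
    unfolding char_basis_def using FH g F(3) by auto
  then show ?thesis by blast
qed

lemma sum_eq_if_two_terms:
  fixes f h :: "'i \<Rightarrow> 'c::comm_monoid_add"
  assumes "finite I" "i \<in> I" "j \<in> I" "i \<noteq> j" "\<And>k. k \<in> I \<Longrightarrow> k \<noteq> i \<Longrightarrow> k \<noteq> j \<Longrightarrow> f k = h k"
    and "f i + f j = h i + h j"
  shows "sum f I = sum h I"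
proof -
  have "sum f I = f i + (f j + sum f (I - {i} - {j}))" for f :: "'i \<Rightarrow> 'c"
    using assms(1-4) by (simp add: sum.remove[of I i] sum.remove[of "I - {i}" j])
  moreover have "sum f (I - {i} - {j}) = sum h (I - {i} - {j})" using assms by (intro sum.cong) auto
  ultimately show ?thesis using assms(6) by (metis add.assoc)
qed

text \<open>A Euclidean algorithm on the coefficients of a relation: multiplying one generator by
  another one or its inverse is a reversible change that can be made to lower the sum of absolute
  values. Once a single nonzero coefficient is left, every real character kills its generator, since
  the reals have no torsion, and dropping that generator contradicts minimality.\<close>

lemma char_basis_independent:
  assumes H: "subgroup H G"
    and min: "\<And>I (g :: nat \<Rightarrow> 'a). char_basis H I g \<Longrightarrow> d \<le> card I"
    and g: "char_basis H I g" "card I = d"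
    and e: "\<And>\<phi> :: 'a \<Rightarrow> real. additive_on G H \<phi> \<Longrightarrow> (\<Sum>i\<in>I. of_int (e i) * \<phi> (g i)) = 0"
    and k: "k \<in> (I :: nat set)"
  shows "e k = (0::int)"
  using g(1) e k
proof (induction "nat (\<Sum>i\<in>I. \<bar>e i\<bar>)" arbitrary: g e k rule: less_induct)
  case less
  note k = less.prems(3)
  have fin: "finite I" and gH: "g ` I \<subseteq> H" using less.prems(1) by (auto simp: char_basis_def)
  show ?case
  proof (rule ccontr)
    assume ek: "e k \<noteq> 0"
    show False
    proof (cases "\<exists>j\<in>I. j \<noteq> k \<and> e j \<noteq> 0")
      case False
      have "\<phi> (g k) = 0" if "additive_on G H \<phi>" for \<phi> :: "'a \<Rightarrow> real"
      proof -
        have "(\<Sum>i\<in>I. of_int (e i) * \<phi> (g i)) = of_int (e k) * \<phi> (g k) + (\<Sum>i\<in>I - {k}. of_int (e i) * \<phi> (g i))"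
          using fin k by (simp add: sum.remove)
        also have "(\<Sum>i\<in>I - {k}. of_int (e i) * \<phi> (g i)) = 0"
          using False by (intro sum.neutral) auto
        finally show ?thesis using less.prems(2)[OF that] ek by simp
      qed
      then have "(\<Sum>i\<in>I. of_int (a i) * \<phi> (g i)) = (\<Sum>i\<in>I - {k}. of_int (a i) * \<phi> (g i))"
        if "additive_on G H \<phi>" for \<phi> :: "'a \<Rightarrow> real" and a :: "nat \<Rightarrow> int"
        using that fin k by (simp add: sum.remove)
      then have "char_basis H (I - {k}) g"
        using less.prems(1) unfolding char_basis_def by (auto simp: image_subset_iff)
      then have "d \<le> card (I - {k})" by (rule min)
      then show False using k fin g(2) card_Diff1_less[OF fin k] by simp
    next
      case True
      then obtain i j where ij: "i \<in> I" "j \<in> I" "i \<noteq> j" "e i \<noteq> 0" "e j \<noteq> 0" "\<bar>e j\<bar> \<le> \<bar>e i\<bar>"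
        using k ek by (metis linear)
      \<comment> \<open>With \<open>\<sigma>\<close> the product of the two signs,
        \<open>\<sigma> * e j\<close> has the sign of \<open>e i\<close> and at most its absolute
        value, so subtracting it brings \<open>e i\<close> closer to 0. Multiplying
        \<open>g j\<close> by \<open>g i [^] \<sigma>\<close> is the matching change of
        generators.\<close>
      define \<sigma> where "\<sigma> = sgn (e i) * sgn (e j)"
      define g' where "g' = g(j := g j \<otimes> g i [^] \<sigma>)"
      define e' where "e' = e(i := e i - \<sigma> * e j)"
      have gi: "g i \<in> H" "g j \<in> H" "g i [^] \<sigma> \<in> H"
        using gH ij by (auto intro: subgroup_int_pow_closed[OF H])
      have key: "(\<Sum>l\<in>I. of_int ((a(i := a i - \<sigma> * a j)) l) * \<phi> (g' l)) = (\<Sum>l\<in>I. of_int (a l) * \<phi> (g l))"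
        if \<phi>: "additive_on G H \<phi>" for \<phi> :: "'a \<Rightarrow> real" and a :: "nat \<Rightarrow> int"
      proof (rule sum_eq_if_two_terms[OF fin ij(1-3)])
        show "of_int ((a(i := a i - \<sigma> * a j)) l) * \<phi> (g' l) = of_int (a l) * \<phi> (g l)"
          if "l \<noteq> i" "l \<noteq> j" for l using that by (simp add: g'_def)
        have "\<phi> (g' j) = \<phi> (g j) + of_int \<sigma> * \<phi> (g i)"
          using gi by (simp add: g'_def additive_on_mult[OF \<phi>] additive_on_int_pow[OF H \<phi>])
        then show "of_int ((a(i := a i - \<sigma> * a j)) i) * \<phi> (g' i) + of_int ((a(i := a i - \<sigma> * a j)) j) * \<phi> (g' j) =
            of_int (a i) * \<phi> (g i) + of_int (a j) * \<phi> (g j)"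
          using ij(3) by (simp add: g'_def algebra_simps)
      qed
      have cb: "char_basis H I g'"
        unfolding char_basis_def
      proof (intro conjI ballI)
        show "finite I" by (rule fin)
        show "g' ` I \<subseteq> H" using gH gi subgroup.m_closed[OF H] by (auto simp: g'_def)
        fix x assume "x \<in> H"
        then obtain a :: "nat \<Rightarrow> int" where "\<forall>\<phi> :: 'a \<Rightarrow> real. additive_on G H \<phi> \<longrightarrow>
            \<phi> x = (\<Sum>i\<in>I. of_int (a i) * \<phi> (g i))" using less.prems(1) unfolding char_basis_def by blast
        then show "\<exists>a :: nat \<Rightarrow> int. \<forall>\<phi> :: 'a \<Rightarrow> real. additive_on G H \<phi> \<longrightarrow>
            \<phi> x = (\<Sum>i\<in>I. of_int (a i) * \<phi> (g' i))"
          using key by (intro exI[of _ "a(i := a i - \<sigma> * a j)"]) simp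
      qed
      have ab: "\<bar>e i - \<sigma> * e j\<bar> < \<bar>e i\<bar>"
        using ij by (auto simp: \<sigma>_def sgn_if split: if_splits)
      have "(\<Sum>l\<in>I. \<bar>e' l\<bar>) < (\<Sum>l\<in>I. \<bar>e l\<bar>)"
        using fin ij(1) ab by (intro sum_strict_mono_ex1) (auto simp: e'_def)
      moreover have "0 \<le> (\<Sum>l\<in>I. \<bar>e' l\<bar>)" by (intro sum_nonneg) auto
      ultimately have lt: "nat (\<Sum>l\<in>I. \<bar>e' l\<bar>) < nat (\<Sum>l\<in>I. \<bar>e l\<bar>)" by linarith
      have e'0: "(\<Sum>l\<in>I. of_int (e' l) * \<phi> (g' l)) = 0" if "additive_on G H \<phi>" for \<phi> :: "'a \<Rightarrow> real"
        using key[OF that, of e] less.prems(2)[OF that] by (simp add: e'_def)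
      \<comment> \<open>The induction kills all coefficients of the new relation, but the one at
        \<open>j\<close> was not altered and is nonzero.\<close>
      have "e' j = 0" by (rule less.hyps[OF lt cb e'0 ij(2)])
      then show False using ij by (simp add: e'_def)
    qed
  qed
qed

text \<open>A generating family of least cardinality has no relations, so integer coordinates are
  unique, and uniqueness makes each coordinate additive. The number \<open>d\<close> is the rank of
  the free abelian quotient by the real kernel.\<close>

lemma dual_basis_exists:
  assumes fg: "fg_subgroup G H"
  obtains d :: nat and g :: "nat \<Rightarrow> 'a" and c :: "nat \<Rightarrow> 'a \<Rightarrow> int" where
    "\<And>i. i < d \<Longrightarrow> g i \<in> H" "\<And>i. i < d \<Longrightarrow> additive_on G H (c i)"
    "\<And>i j. i < d \<Longrightarrow> j < d \<Longrightarrow> c i (g j) = (if i = j then 1 else 0)"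
    "real_kernel G H = {x \<in> H. \<forall>i<d. c i x = 0}"
proof -
  have H: "subgroup H G" using fg by (rule fg_subgroup_is_subgroup)
  obtain I0 and g0 :: "nat \<Rightarrow> 'a" where "char_basis H I0 g0" using char_basis_exists[OF fg] by blast
  then have ex: "\<exists>d I (g :: nat \<Rightarrow> 'a). char_basis H I g \<and> card I = d" by blast
  define d where "d = (LEAST d. \<exists>I (g :: nat \<Rightarrow> 'a). char_basis H I g \<and> card I = d)"
  obtain I and g1 :: "nat \<Rightarrow> 'a" where I: "char_basis H I g1" "card I = d"
    using LeastI_ex[OF ex] unfolding d_def by blast
  have min: "d \<le> card I" if "char_basis H I g" for I and g :: "nat \<Rightarrow> 'a"
    unfolding d_def using that by (intro Least_le) blast
  have finI: "finite I" using I by (simp add: char_basis_def)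
  obtain h where h: "bij_betw h {0..<d} I" using ex_bij_betw_nat_finite[OF finI] I(2) by blast
  define g where "g = g1 \<circ> h"
  have reindex: "(\<Sum>i\<in>{0..<d}. of_int (e (h i)) * \<phi> (g i)) = (\<Sum>i\<in>I. of_int (e i) * \<phi> (g1 i))"
    for e :: "nat \<Rightarrow> int" and \<phi> :: "'a \<Rightarrow> real"
    unfolding g_def o_def using h by (rule sum.reindex_bij_betw)
  have g: "char_basis H {0..<d} g"
    unfolding char_basis_def
  proof (intro conjI ballI)
    show "g ` {0..<d} \<subseteq> H"
      using I(1) h unfolding g_def char_basis_def bij_betw_def by (auto simp: image_subset_iff)
    fix x assume "x \<in> H"
    then obtain e :: "nat \<Rightarrow> int" where "\<forall>\<phi> :: 'a \<Rightarrow> real. additive_on G H \<phi> \<longrightarrow>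
        \<phi> x = (\<Sum>i\<in>I. of_int (e i) * \<phi> (g1 i))" using I(1) unfolding char_basis_def by blast
    then show "\<exists>e :: nat \<Rightarrow> int. \<forall>\<phi> :: 'a \<Rightarrow> real. additive_on G H \<phi> \<longrightarrow>
        \<phi> x = (\<Sum>i\<in>{0..<d}. of_int (e i) * \<phi> (g i))"
      using reindex by (intro exI[of _ "e \<circ> h"]) simp
  qed simp
  have "\<forall>x. \<exists>e :: nat \<Rightarrow> int. x \<in> H \<longrightarrow> (\<forall>\<phi> :: 'a \<Rightarrow> real. additive_on G H \<phi> \<longrightarrow>
      \<phi> x = (\<Sum>i\<in>{0..<d}. of_int (e i) * \<phi> (g i)))"
    using g unfolding char_basis_def by blast
  then obtain e :: "'a \<Rightarrow> nat \<Rightarrow> int" where e: "\<And>x \<phi>. x \<in> H \<Longrightarrow> additive_on G H (\<phi> :: 'a \<Rightarrow> real) \<Longrightarrow>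
      \<phi> x = (\<Sum>i\<in>{0..<d}. of_int (e x i) * \<phi> (g i))" by metis
  have uniq: "a i = b i" if i: "i < d" and ab: "\<And>\<phi> :: 'a \<Rightarrow> real. additive_on G H \<phi> \<Longrightarrow>
      (\<Sum>i\<in>{0..<d}. of_int (a i) * \<phi> (g i)) = (\<Sum>i\<in>{0..<d}. of_int (b i) * \<phi> (g i))" for a b :: "nat \<Rightarrow> int" and i
  proof -
    have "(\<lambda>i. a i - b i) i = 0"
      by (rule char_basis_independent[OF H min g])
         (use i ab in \<open>auto simp: left_diff_distrib sum_subtractf\<close>)
    then show ?thesis by simp
  qed
  have gH: "g i \<in> H" if "i < d" for i using g that by (auto simp: char_basis_def)
  have add: "additive_on G H (\<lambda>x. e x i)" if i: "i < d" for i
    unfolding additive_on_def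
  proof (intro ballI)
    fix x y assume xy: "x \<in> H" "y \<in> H"
    have "e (x \<otimes> y) i = (\<lambda>i. e x i + e y i) i"
    proof (rule uniq[OF i])
      fix \<phi> :: "'a \<Rightarrow> real" assume \<phi>: "additive_on G H \<phi>"
      show "(\<Sum>i\<in>{0..<d}. of_int (e (x \<otimes> y) i) * \<phi> (g i)) = (\<Sum>i\<in>{0..<d}. of_int (e x i + e y i) * \<phi> (g i))"
        using e[OF _ \<phi>] xy subgroup.m_closed[OF H xy] additive_on_mult[OF \<phi> xy]
        by (simp add: distrib_right sum.distrib)
    qed
    then show "e (x \<otimes> y) i = e x i + e y i" .
  qed
  have dual: "e (g j) i = (if i = j then 1 else 0)" if ij: "i < d" "j < d" for i j
  proof -
    have "e (g j) i = (\<lambda>i. if i = j then 1 else 0) i"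
    proof (rule uniq[OF ij(1)])
      fix \<phi> :: "'a \<Rightarrow> real" assume \<phi>: "additive_on G H \<phi>"
      show "(\<Sum>i\<in>{0..<d}. of_int (e (g j) i) * \<phi> (g i)) = (\<Sum>i\<in>{0..<d}. of_int (if i = j then 1 else 0) * \<phi> (g i))"
        using e[OF gH[OF ij(2)] \<phi>] ij(2)
        by (simp add: if_distrib[of of_int] if_distrib[of "\<lambda>c. c * _"] cong: if_cong)
    qed
    then show ?thesis .
  qed
  have ker: "real_kernel G H = {x \<in> H. \<forall>i<d. e x i = 0}"
  proof (intro equalityI subsetI)
    fix x assume x: "x \<in> real_kernel G H"
    have "e x i = (\<lambda>_. 0) i" if "i < d" for i
    proof (rule uniq[OF that])
      fix \<phi> :: "'a \<Rightarrow> real" assume \<phi>: "additive_on G H \<phi>"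
      show "(\<Sum>i\<in>{0..<d}. of_int (e x i) * \<phi> (g i)) = (\<Sum>i\<in>{0..<d}. of_int 0 * \<phi> (g i))"
        using e[OF _ \<phi>, of x] x \<phi> by (auto simp: real_kernel_def)
    qed
    then show "x \<in> {x \<in> H. \<forall>i<d. e x i = 0}" using x by (auto simp: real_kernel_def)
  next
    fix x assume x: "x \<in> {x \<in> H. \<forall>i<d. e x i = 0}"
    then have "\<phi> x = 0" if "additive_on G H \<phi>" for \<phi> :: "'a \<Rightarrow> real" using e[OF _ that, of x] by simp
    then show "x \<in> real_kernel G H" using x by (auto simp: real_kernel_def)
  qed
  show thesis by (rule that[of d g "\<lambda>i x. e x i"]) (use gH add dual ker in auto)
qed

text \<open>Milnor's lemma. The kernel is cut out one coordinate at a time: \<open>g j\<close> has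
  vanishing earlier coordinates and value 1 under \<open>c j\<close>, so it lies in the current
  subgroup and serves there as the element \<open>t\<close> of
  \<open>kernel_int_hom_fg\<close>.\<close>

lemma real_kernel_fg:
  assumes SE: "subexponential_group G H" and fg: "fg_subgroup G H"
  shows "fg_subgroup G (real_kernel G H)"
proof -
  have H: "subgroup H G" using fg by (rule fg_subgroup_is_subgroup)
  obtain d :: nat and g :: "nat \<Rightarrow> 'a" and c :: "nat \<Rightarrow> 'a \<Rightarrow> int" where
    b: "\<And>i. i < d \<Longrightarrow> g i \<in> H" "\<And>i. i < d \<Longrightarrow> additive_on G H (c i)"
    "\<And>i j. i < d \<Longrightarrow> j < d \<Longrightarrow> c i (g j) = (if i = j then 1 else 0)"
    "real_kernel G H = {x \<in> H. \<forall>i<d. c i x = 0}"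
    using dual_basis_exists[OF fg] by blast
  have "fg_subgroup G {x \<in> H. \<forall>i<j. c i x = 0}" if "j \<le> d" for j
    using that
  proof (induction j)
    case 0 then show ?case using fg by simp
  next
    case (Suc j)
    let ?N = "{x \<in> H. \<forall>i<j. c i x = 0}"
    have "fg_subgroup G {x \<in> ?N. c j x = 0}"
    proof (rule kernel_int_hom_fg[of ?N "c j" "g j"])
      show "subexponential_group G ?N" using SE by (rule subexponential_group_mono) auto
      show "additive_on G ?N (c j)" using b(2)[of j] Suc.prems by (auto simp: additive_on_def)
    qed (use Suc b in auto)
    also have "{x \<in> ?N. c j x = 0} = {x \<in> H. \<forall>i<Suc j. c i x = 0}" by (auto simp: less_Suc_eq)
    finally show ?case .
  qed
  then show ?thesis using b(4) by simp
qed

end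

section \<open>Plante's invariant measure\<close>

lemma convergent_subseq_finite:
  fixes f :: "nat \<Rightarrow> 'a \<Rightarrow> real"
  assumes "finite S" "\<And>s. s \<in> S \<Longrightarrow> bounded (range (\<lambda>k. f k s))"
  shows "\<exists>q :: nat \<Rightarrow> nat. strict_mono q \<and> (\<forall>s\<in>S. convergent (\<lambda>k. f (q k) s))"
  using assms
proof (induction S)
  case empty
  show ?case by (intro exI[of _ id]) (simp add: strict_mono_def)
next
  case (insert s S)
  then obtain q :: "nat \<Rightarrow> nat" where q: "strict_mono q" "\<forall>s\<in>S. convergent (\<lambda>k. f (q k) s)" by auto
  have "bounded (range (\<lambda>k. f (q k) s))"
    by (rule bounded_subset[OF insert.prems[of s]]) auto
  then obtain l and p :: "nat \<Rightarrow> nat" where p: "strict_mono p" "((\<lambda>k. f (q k) s) \<circ> p) \<longlonglongrightarrow> l"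
    using bounded_imp_convergent_subsequence[of "\<lambda>k. f (q k) s"] by auto
  have "convergent (\<lambda>k. f ((q \<circ> p) k) t)" if "t \<in> insert s S" for t
  proof (cases "t = s")
    case True then show ?thesis using p(2) by (auto simp: convergent_def o_def)
  next
    case False
    then have "convergent ((\<lambda>k. f (q k) t) \<circ> p)" using q(2) that p(1) by (auto intro: convergent_subseq_convergent)
    then show ?thesis by (simp add: o_def)
  qed
  moreover have "strict_mono (q \<circ> p)" using q(1) p(1) by (simp add: strict_mono_def)
  ultimately show ?case by blast
qed

text \<open>Abstracts the action of a term of the series on one of its gaps. The base point
  \<open>u\<close> is arbitrary; the measure is built by counting the elements of balls that carry
  \<open>u\<close> into a given interval.\<close>

locale interval_action = group G for G (structure) +
  fixes act :: "'a \<Rightarrow> real \<Rightarrow> real" and S H :: "'a set" and a b u :: real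
  assumes finite_S: "finite S" and S_carrier: "S \<subseteq> carrier G"
    and S_inv: "s \<in> S \<Longrightarrow> inv s \<in> S" and H_eq: "H = generate G S"
    and subexp: "subexponential_group G H"
    and act_one: "x \<in> {a<..<b} \<Longrightarrow> act \<one> x = x"
    and act_mult: "g \<in> H \<Longrightarrow> h \<in> H \<Longrightarrow> x \<in> {a<..<b} \<Longrightarrow> act (g \<otimes> h) x = act g (act h x)"
    and act_mem: "g \<in> H \<Longrightarrow> x \<in> {a<..<b} \<Longrightarrow> act g x \<in> {a<..<b}"
    and act_less: "g \<in> H \<Longrightarrow> x \<in> {a<..<b} \<Longrightarrow> y \<in> {a<..<b} \<Longrightarrow> x < y \<Longrightarrow> act g x < act g y"
    and no_fixed: "x \<in> {a<..<b} \<Longrightarrow> \<exists>g\<in>H. act g x \<noteq> x"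
    and u_mem: "u \<in> {a<..<b}"
begin

abbreviation "J \<equiv> {a<..<b}"
abbreviation "B \<equiv> word_ball G S"

lemma H_subgroup: "subgroup H G"
  unfolding H_eq by (rule generate_is_subgroup[OF S_carrier])

lemma H_carrier: "g \<in> H \<Longrightarrow> g \<in> carrier G"
  using H_subgroup subgroup.mem_carrier by metis

lemma S_H: "S \<subseteq> H"
  unfolding H_eq by (auto intro: generate.incl)

lemma B_H: "B n \<subseteq> H"
  by (rule word_ball_subset_subgroup[OF H_subgroup S_H])

lemma H_B: "g \<in> H \<Longrightarrow> \<exists>n. g \<in> B n"
  using generate_eq_word_balls[OF S_carrier S_inv] H_eq by auto

lemmas H_closed = subgroup.m_closed[OF H_subgroup] subgroup.m_inv_closed[OF H_subgroup] subgroup.one_closed[OF H_subgroup]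

lemma act_inv:
  assumes "g \<in> H" "x \<in> J"
  shows "act (inv g) (act g x) = x" "act g (act (inv g) x) = x"
  using act_mult[of "inv g" g x] act_mult[of g "inv g" x] assms H_closed(2)[OF assms(1)] H_carrier[OF assms(1)] act_one
  by auto

lemma act_less_iff: "g \<in> H \<Longrightarrow> x \<in> J \<Longrightarrow> y \<in> J \<Longrightarrow> act g x < act g y \<longleftrightarrow> x < y"
  using act_less[of g x y] act_less[of g y x] by (metis less_irrefl less_linear less_trans)

lemma act_le_iff: "g \<in> H \<Longrightarrow> x \<in> J \<Longrightarrow> y \<in> J \<Longrightarrow> act g x \<le> act g y \<longleftrightarrow> x \<le> y"
  using act_less_iff[of g y x] by (simp add: not_less[symmetric])

lemma act_le_inv_iff: "g \<in> H \<Longrightarrow> x \<in> J \<Longrightarrow> y \<in> J \<Longrightarrow> act g x \<le> y \<longleftrightarrow> x \<le> act (inv g) y"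
  using act_le_iff[of g x "act (inv g) y"] act_inv(2)[of g y] act_mem[of "inv g" y] H_closed(2)[of g] by auto

lemma act_less_inv_iff: "g \<in> H \<Longrightarrow> x \<in> J \<Longrightarrow> y \<in> J \<Longrightarrow> act g x < y \<longleftrightarrow> x < act (inv g) y"
  using act_less_iff[of g x "act (inv g) y"] act_inv(2)[of g y] act_mem[of "inv g" y] H_closed(2)[of g] by auto

lemma fixed_by_generators:
  assumes x: "x \<in> J" and s: "\<And>s. s \<in> S \<Longrightarrow> act s x = x" and g: "g \<in> H"
  shows "act g x = x"
proof -
  have "act g x = x" if "g \<in> B n" for n
    using that
  proof (induction n arbitrary: g)
    case 0 then show ?case using act_one x by auto
  next
    case (Suc n)
    have "act (t \<otimes> z) x = x" if "t \<in> S" "z \<in> B n" for t z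
      using act_mult[of t z x] that S_H B_H[of n] x s Suc.IH by auto
    then show ?case using Suc.prems act_one x by (auto simp: word_ball_Suc)
  qed
  then show ?thesis using H_B[OF g] by blast
qed

text \<open>\<open>up\<close> and \<open>dn\<close> need not be group elements, but at each point
  they agree with a generator or the identity, which is how their iterates are controlled by word
  length.\<close>

definition up :: "real \<Rightarrow> real" where "up y = Max ((\<lambda>s. act s y) ` insert \<one> S)"
definition dn :: "real \<Rightarrow> real" where "dn y = Min ((\<lambda>s. act s y) ` insert \<one> S)"

lemma up_attained: "\<exists>s\<in>insert \<one> S. up y = act s y"
  using Max_in[of "(\<lambda>s. act s y) ` insert \<one> S"] finite_S unfolding up_def by auto

lemma dn_attained: "\<exists>s\<in>insert \<one> S. dn y = act s y"
  using Min_in[of "(\<lambda>s. act s y) ` insert \<one> S"] finite_S unfolding dn_def by auto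

lemma act_le_up: "s \<in> insert \<one> S \<Longrightarrow> act s y \<le> up y"
  unfolding up_def using finite_S by (intro Max_ge) auto

lemma dn_le_act: "s \<in> insert \<one> S \<Longrightarrow> dn y \<le> act s y"
  unfolding dn_def using finite_S by (intro Min_le) auto

lemma insert_S_H: "s \<in> insert \<one> S \<Longrightarrow> s \<in> H"
  using S_H H_closed(3) by auto

lemma up_ge: "y \<in> J \<Longrightarrow> y \<le> up y"
  using act_le_up[of \<one> y] act_one by simp

lemma up_mem: "y \<in> J \<Longrightarrow> up y \<in> J"
  using up_attained[of y] act_mem insert_S_H by metis

lemma dn_mem: "y \<in> J \<Longrightarrow> dn y \<in> J"
  using dn_attained[of y] act_mem insert_S_H by metis

lemma up_less: "x \<in> J \<Longrightarrow> y \<in> J \<Longrightarrow> x < y \<Longrightarrow> up x < up y"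
  using up_attained[of x] act_less insert_S_H act_le_up by (metis less_le_trans)

lemma dn_less: "x \<in> J \<Longrightarrow> y \<in> J \<Longrightarrow> x < y \<Longrightarrow> dn x < dn y"
  using dn_attained[of y] act_less insert_S_H dn_le_act by (metis le_less_trans)

lemma dn_up_le: "y \<in> J \<Longrightarrow> dn (up y) \<le> y"
proof -
  assume y: "y \<in> J"
  obtain s where s: "s \<in> insert \<one> S" "up y = act s y" using up_attained by blast
  then have "inv s \<in> insert \<one> S" using S_inv by auto
  then have "dn (up y) \<le> act (inv s) (up y)" by (rule dn_le_act)
  then show ?thesis using s y act_inv insert_S_H by simp
qed

lemma le_dn_of_up_le: "x \<in> J \<Longrightarrow> y \<in> J \<Longrightarrow> up x \<le> y \<Longrightarrow> x \<le> dn y"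
proof -
  assume x: "x \<in> J" and y: "y \<in> J" and le: "up x \<le> y"
  obtain s where s: "s \<in> insert \<one> S" "dn y = act s y" using dn_attained by blast
  then have "inv s \<in> insert \<one> S" using S_inv by auto
  then have "act (inv s) x \<le> y" using act_le_up[of "inv s" x] le by simp
  then show ?thesis
    using s act_le_inv_iff[of "inv s" x y] x y insert_S_H[of s] H_closed(2)[of s] H_carrier[of s] by simp
qed

lemma up_pow_mem: "y \<in> J \<Longrightarrow> (up ^^ c) y \<in> J"
  by (induction c) (auto simp del: greaterThanLessThan_iff intro: up_mem)

lemma dn_pow_mem: "y \<in> J \<Longrightarrow> (dn ^^ c) y \<in> J"
  by (induction c) (auto simp del: greaterThanLessThan_iff intro: dn_mem)

lemma up_pow_less: "x \<in> J \<Longrightarrow> y \<in> J \<Longrightarrow> x < y \<Longrightarrow> (up ^^ c) x < (up ^^ c) y"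
  by (induction c) (auto simp del: greaterThanLessThan_iff intro: up_less up_pow_mem)

lemma dn_pow_less: "x \<in> J \<Longrightarrow> y \<in> J \<Longrightarrow> x < y \<Longrightarrow> (dn ^^ c) x < (dn ^^ c) y"
  by (induction c) (auto simp del: greaterThanLessThan_iff intro: dn_less dn_pow_mem)

lemma dn_pow_up_pow: "y \<in> J \<Longrightarrow> (dn ^^ c) ((up ^^ c) y) \<le> y"
proof (induction c)
  case 0 then show ?case by simp
next
  case (Suc c)
  have m: "(up ^^ c) y \<in> J" using Suc.prems by (rule up_pow_mem)
  have "(dn ^^ Suc c) ((up ^^ Suc c) y) = (dn ^^ c) (dn (up ((up ^^ c) y)))"
    by (simp add: funpow_swap1)
  also have "\<dots> \<le> (dn ^^ c) ((up ^^ c) y)"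
    using dn_up_le[OF m] dn_pow_less[of "dn (up ((up ^^ c) y))" "(up ^^ c) y" c] dn_mem[OF up_mem[OF m]] m
    by (cases "dn (up ((up ^^ c) y)) = (up ^^ c) y") auto
  also have "\<dots> \<le> y" using Suc by simp
  finally show ?case .
qed

text \<open>Otherwise the supremum of the iterates would lie in \<open>J\<close> and be fixed by
  every generator, against \<open>no_fixed\<close>.\<close>

lemma up_unbounded:
  assumes y: "y \<in> J" and z: "z \<in> J"
  shows "\<exists>c. z < (up ^^ c) y"
proof (rule ccontr)
  assume "\<nexists>c. z < (up ^^ c) y"
  then have le: "(up ^^ c) y \<le> z" for c by (meson not_le)
  define L where "L = Sup (range (\<lambda>c. (up ^^ c) y))"
  have bdd: "bdd_above (range (\<lambda>c. (up ^^ c) y))" using le by (auto intro!: bdd_aboveI[of _ z])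
  have leL: "(up ^^ c) y \<le> L" for c unfolding L_def using bdd by (intro cSup_upper) auto
  have "L \<le> z" unfolding L_def using le by (intro cSup_least) auto
  then have L: "L \<in> J" using leL[of 0] y z by auto
  have ub: "act s L \<le> L" if s: "s \<in> S" for s
  proof (rule ccontr)
    assume "\<not> act s L \<le> L"
    then have "act (inv s) L < L"
      using act_less_inv_iff[of "inv s" L L] L s S_H H_closed(2)[of s] H_carrier[of s] by auto
    then obtain c where c: "act (inv s) L < (up ^^ c) y"
      using less_cSup_iff[OF _ bdd] unfolding L_def[symmetric] by auto
    have "L < act s ((up ^^ c) y)"
      using c act_less_inv_iff[of "inv s" L "(up ^^ c) y"] L up_pow_mem[OF y, of c] s S_H H_closed(2)[of s] H_carrier[of s] by auto
    also have "\<dots> \<le> (up ^^ Suc c) y" using act_le_up[of s] s by simp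
    finally show False using leL[of "Suc c"] by simp
  qed
  have "act s L = L" if s: "s \<in> S" for s
    using ub[OF s] ub[OF S_inv[OF s]] act_le_inv_iff[of "inv s" L L] L s S_H H_closed(2)[of s] H_carrier[of s] by auto
  then show False using fixed_by_generators[OF L] no_fixed[OF L] by blast
qed

lemma up_gt: "y \<in> J \<Longrightarrow> y < up y"
proof (rule ccontr)
  assume y: "y \<in> J" and "\<not> y < up y"
  then have "up y = y" using up_ge by force
  then have "(up ^^ c) y = y" for c by (induction c) auto
  then show False using up_unbounded[OF y y] by auto
qed

lemma up_pow_ball: "y \<in> J \<Longrightarrow> \<exists>w\<in>B c. (up ^^ c) y = act w y"
proof (induction c)
  case 0 then show ?case using act_one by auto
next
  case (Suc c)
  then obtain w where w: "w \<in> B c" "(up ^^ c) y = act w y" by blast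
  obtain s where s: "s \<in> insert \<one> S" "up (act w y) = act s (act w y)" using up_attained by blast
  have wH: "w \<in> H" using w B_H by blast
  have "s \<otimes> w \<in> B (Suc c)"
    using s(1) w(1) word_ball_Suc_step[of s S w G c] word_ball_mono[of S S c "Suc c" G] H_carrier[OF wH] by auto
  moreover have "(up ^^ Suc c) y = act (s \<otimes> w) y"
    using s w act_mult[of s w y] insert_S_H[OF s(1)] wH Suc.prems by simp
  ultimately show ?case by blast
qed

lemma dn_pow_ball: "y \<in> J \<Longrightarrow> \<exists>w\<in>B c. (dn ^^ c) y = act w y"
proof (induction c)
  case 0 then show ?case using act_one by auto
next
  case (Suc c)
  then obtain w where w: "w \<in> B c" "(dn ^^ c) y = act w y" by blast
  obtain s where s: "s \<in> insert \<one> S" "dn (act w y) = act s (act w y)" using dn_attained by blast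
  have wH: "w \<in> H" using w B_H by blast
  have "s \<otimes> w \<in> B (Suc c)"
    using s(1) w(1) word_ball_Suc_step[of s S w G c] word_ball_mono[of S S c "Suc c" G] H_carrier[OF wH] by auto
  moreover have "(dn ^^ Suc c) y = act (s \<otimes> w) y"
    using s w act_mult[of s w y] insert_S_H[OF s(1)] wH Suc.prems by simp
  ultimately show ?case by blast
qed

text \<open>The window from \<open>u\<close> to \<open>up u\<close> is as wide as one step of
  \<open>up\<close>, so neither \<open>up\<close> nor \<open>dn\<close> can jump across it. It plays
  the part of a fundamental domain and of the unit of measure.\<close>

definition v :: real where "v = up u"

lemma u_less_v: "u < v" and v_mem: "v \<in> J"
  unfolding v_def using up_gt up_mem u_mem by auto

text \<open>Points below \<open>u\<close> are raised by \<open>up\<close> until they first reach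
  \<open>u\<close>, the others are lowered by \<open>dn\<close> until they first fall below
  \<open>v\<close>; by the choice of \<open>v\<close> both land in the window. The iterates are
  monotone, so the endpoints \<open>x\<close> and \<open>z\<close> alone bound the number of steps
  for all points between them.\<close>

lemma uniform_return:
  assumes x: "x \<in> J" and z: "z \<in> J"
  shows "\<exists>c. \<forall>y\<in>{x..z}. \<exists>w\<in>B c. u \<le> act w y \<and> act w y < v"
proof -
  obtain c1 where c1: "u < (up ^^ c1) x" using up_unbounded[OF x u_mem] by blast
  obtain c2 where c2: "z < (up ^^ c2) u" using up_unbounded[OF u_mem z] by blast
  have dnz: "(dn ^^ c2) z < u"
    using dn_pow_less[OF z up_pow_mem[OF u_mem] c2, of c2] dn_pow_up_pow[OF u_mem, of c2] by linarith
  have "\<exists>w\<in>B (max c1 c2). u \<le> act w y \<and> act w y < v" if "y \<in> {x..z}" for y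
  proof -
    have y: "y \<in> J" "x \<le> y" "y \<le> z" using that x z by auto
    show ?thesis
    proof (cases "y < u")
      case True
      have "(up ^^ c1) x \<le> (up ^^ c1) y"
        using up_pow_less[OF x y(1), of c1] y(2) by (cases "x = y") auto
      then have ex: "u \<le> (up ^^ c1) y" using c1 by simp
      define i where "i = (LEAST i. u \<le> (up ^^ i) y)"
      have i: "u \<le> (up ^^ i) y" unfolding i_def using ex by (rule LeastI)
      have ic: "i \<le> c1" unfolding i_def using ex by (rule Least_le)
      have "i \<noteq> 0" using i True by (cases i) auto
      then obtain j where j: "i = Suc j" using not0_implies_Suc by blast
      then have "\<not> u \<le> (up ^^ j) y" unfolding i_def using not_less_Least[of j "\<lambda>i. u \<le> (up ^^ i) y"] by simp
      then have "up ((up ^^ j) y) < v" unfolding v_def using up_less[OF up_pow_mem[OF y(1)] u_mem] by simp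
      then have "(up ^^ i) y < v" using j by simp
      moreover obtain w where "w \<in> B i" "(up ^^ i) y = act w y" using up_pow_ball[OF y(1)] by blast
      moreover have "B i \<subseteq> B (max c1 c2)" using ic by (intro word_ball_mono) auto
      ultimately show ?thesis using i by (intro bexI[of _ w]) auto
    next
      case False
      have "(dn ^^ c2) y \<le> (dn ^^ c2) z"
        using dn_pow_less[OF y(1) z, of c2] y(3) by (cases "y = z") auto
      then have ex: "(dn ^^ c2) y < v" using dnz u_less_v by simp
      define i where "i = (LEAST i. (dn ^^ i) y < v)"
      have i: "(dn ^^ i) y < v" unfolding i_def using ex by (rule LeastI)
      have ic: "i \<le> c2" unfolding i_def using ex by (rule Least_le)
      have "u \<le> (dn ^^ i) y"
      proof (cases i)
        case 0 then show ?thesis using False by simp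
      next
        case (Suc j)
        then have "\<not> (dn ^^ j) y < v" unfolding i_def using not_less_Least[of j "\<lambda>i. (dn ^^ i) y < v"] by simp
        then show ?thesis using le_dn_of_up_le[OF u_mem dn_pow_mem[OF y(1)], of j] Suc unfolding v_def by simp
      qed
      moreover obtain w where "w \<in> B i" "(dn ^^ i) y = act w y" using dn_pow_ball[OF y(1)] by blast
      moreover have "B i \<subseteq> B (max c1 c2)" using ic by (intro word_ball_mono) auto
      ultimately show ?thesis using i by (intro bexI[of _ w]) auto
    qed
  qed
  then show ?thesis by blast
qed

section \<open>Orbit counts and their averages\<close>

definition orb :: "nat \<Rightarrow> real \<Rightarrow> real \<Rightarrow> 'a set"
  where "orb n x y = {\<gamma> \<in> B n. x \<le> act \<gamma> u \<and> act \<gamma> u < y}"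

text \<open>The number of ball elements that carry \<open>u\<close> into the interval from
  \<open>x\<close> to \<open>y\<close>, with a sign if \<open>y < x\<close>. As a difference of two
  counts it is additive in the endpoints without any order assumption. Group elements are counted,
  not orbit points, so that left translation is injective.\<close>

definition D :: "nat \<Rightarrow> real \<Rightarrow> real \<Rightarrow> real"
  where "D n x y = real (card {\<gamma> \<in> B n. act \<gamma> u < y}) - real (card {\<gamma> \<in> B n. act \<gamma> u < x})"

definition N :: "nat \<Rightarrow> real" where "N n = D n u v"

lemma finite_B: "finite (B n)"
  using finite_S by (rule finite_word_ball)

lemma finite_orb: "finite (orb n x y)"
  unfolding orb_def using finite_B by simp

lemma D_eq_card: "x \<le> y \<Longrightarrow> D n x y = real (card (orb n x y))"
proof -
  assume "x \<le> y"
  then have "{\<gamma> \<in> B n. act \<gamma> u < y} = {\<gamma> \<in> B n. act \<gamma> u < x} \<union> orb n x y" unfolding orb_def by auto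
  moreover have "card ({\<gamma> \<in> B n. act \<gamma> u < x} \<union> orb n x y) = card {\<gamma> \<in> B n. act \<gamma> u < x} + card (orb n x y)"
    using finite_B by (intro card_Un_disjoint) (auto simp: orb_def)
  ultimately show ?thesis unfolding D_def by simp
qed

lemma D_trans: "D n x y + D n y z = D n x z"
  unfolding D_def by simp

lemma D_swap: "D n y x = - D n x y"
  unfolding D_def by simp

lemma orb_mono: "m \<le> n \<Longrightarrow> orb m x y \<subseteq> orb n x y"
  unfolding orb_def using word_ball_mono[of S S m n G] by auto

lemma D_mono: "x \<le> y \<Longrightarrow> m \<le> n \<Longrightarrow> D m x y \<le> D n x y"
  using orb_mono[of m n x y] finite_orb by (simp add: D_eq_card card_mono)

lemma N_mono: "m \<le> n \<Longrightarrow> N m \<le> N n"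
  unfolding N_def using u_less_v by (intro D_mono) auto

lemma N_ge_1: "1 \<le> N n"
proof -
  have "\<one> \<in> orb n u v" unfolding orb_def using one_in_word_ball act_one u_mem u_less_v by auto
  then have "card (orb n u v) \<noteq> 0" using finite_orb by auto
  then show ?thesis unfolding N_def using D_eq_card u_less_v by auto
qed

lemma N_le_card: "N n \<le> card (B n)"
  unfolding N_def using D_eq_card[of u v n] u_less_v finite_B by (auto simp: orb_def intro!: card_mono)

lemma D_shift_le:
  assumes "h \<in> B l" "x \<in> J" "y \<in> J" "x \<le> y"
  shows "D n x y \<le> D (n + l) (act h x) (act h y)"
proof -
  have hH: "h \<in> H" using assms B_H by blast
  have "act h x \<le> act h y" using act_le_iff hH assms by simp
  moreover have "card (orb n x y) \<le> card (orb (n + l) (act h x) (act h y))"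
  proof (rule card_inj_on_le[of "\<lambda>\<gamma>. h \<otimes> \<gamma>"])
    show "inj_on (\<lambda>\<gamma>. h \<otimes> \<gamma>) (orb n x y)"
    proof (rule inj_onI)
      fix f g assume fg: "f \<in> orb n x y" "g \<in> orb n x y" "h \<otimes> f = h \<otimes> g"
      then have "f \<in> H" "g \<in> H" using B_H unfolding orb_def by auto
      then show "f = g" using fg(3) hH H_carrier by simp
    qed
    show "(\<lambda>\<gamma>. h \<otimes> \<gamma>) ` orb n x y \<subseteq> orb (n + l) (act h x) (act h y)"
    proof
      fix z assume "z \<in> (\<lambda>\<gamma>. h \<otimes> \<gamma>) ` orb n x y"
      then obtain \<gamma> where \<gamma>: "\<gamma> \<in> B n" "x \<le> act \<gamma> u" "act \<gamma> u < y" "z = h \<otimes> \<gamma>" unfolding orb_def by auto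
      have \<gamma>H: "\<gamma> \<in> H" using \<gamma> B_H by blast
      have "h \<otimes> \<gamma> \<in> B (n + l)" using word_ball_mult[OF S_carrier assms(1) \<gamma>(1)] by (simp add: add.commute)
      moreover have "act z u = act h (act \<gamma> u)" using \<gamma> act_mult[OF hH \<gamma>H u_mem] by simp
      moreover have "act \<gamma> u \<in> J" using act_mem[OF \<gamma>H u_mem] .
      ultimately show "z \<in> orb (n + l) (act h x) (act h y)"
        using \<gamma> act_le_iff[OF hH assms(2), of "act \<gamma> u"] act_less_iff[OF hH _ assms(3), of "act \<gamma> u"]
        unfolding orb_def by simp
    qed
  qed (rule finite_orb)
  ultimately show ?thesis using D_eq_card assms(4) by simp
qed

lemma D_shift_ge:
  assumes "h \<in> B l" "x \<in> J" "y \<in> J" "x \<le> y"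
  shows "D n (act h x) (act h y) \<le> D (n + l) x y"
proof -
  have hH: "h \<in> H" using assms B_H by blast
  have "inv h \<in> B l" using assms(1) by (intro word_ball_inv S_carrier S_inv)
  then show ?thesis
    using D_shift_le[of "inv h" l "act h x" "act h y" n] act_mem[OF hH] act_inv(1)[OF hH] act_le_iff[OF hH] assms by simp
qed

text \<open>An element outside \<open>B m\<close> that carries \<open>u\<close> into the given
  interval is followed by a return word of length at most \<open>c\<close>. The product carries
  \<open>u\<close> into the window and lies in \<open>B (n + c)\<close> but not in
  \<open>B (m - c)\<close>; recording the return word, one of \<open>card (B c)\<close> many, makes
  the assignment injective. Boundary effects on any interval are thus dominated by those on the
  window.\<close>

lemma D_shell_le:
  assumes c: "\<forall>y\<in>{x..z}. \<exists>w\<in>B c. u \<le> act w y \<and> act w y < v"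
    and x: "x \<in> J" "z \<in> J" "x \<le> z" and mn: "m \<le> n" "c \<le> m"
  shows "D n x z - D m x z \<le> real (card (B c)) * (N (n + c) - N (m - c))"
proof -
  obtain w where w: "\<And>y. y \<in> {x..z} \<Longrightarrow> w y \<in> B c \<and> u \<le> act (w y) y \<and> act (w y) y < v"
    using c by metis
  let ?f = "\<lambda>\<gamma>. (w (act \<gamma> u), w (act \<gamma> u) \<otimes> \<gamma>)"
  let ?X = "orb n x z - orb m x z" and ?Y = "orb (n + c) u v - orb (m - c) u v"
  have "card ?X \<le> card (B c \<times> ?Y)"
  proof (rule card_inj_on_le[of ?f])
    show "inj_on ?f ?X"
    proof (rule inj_onI)
      fix g h assume gh: "g \<in> ?X" "h \<in> ?X" "?f g = ?f h"
      then have "w (act g u) \<in> B c" using w[of "act g u"] unfolding orb_def by auto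
      then have "w (act g u) \<in> carrier G" "g \<in> carrier G" "h \<in> carrier G"
        using gh B_H H_carrier unfolding orb_def by blast+
      then show "g = h" using gh(3) by auto
    qed
    show "?f ` ?X \<subseteq> B c \<times> ?Y"
    proof
      fix p assume "p \<in> ?f ` ?X"
      then obtain g where g: "g \<in> B n" "x \<le> act g u" "act g u < z" "g \<notin> B m" and p: "p = ?f g"
        unfolding orb_def by auto
      define h where "h = w (act g u)"
      have h: "h \<in> B c" "u \<le> act h (act g u)" "act h (act g u) < v"
        using w[of "act g u"] g unfolding h_def by auto
      have gh: "g \<in> H" "h \<in> H" using g h B_H by auto
      have eq: "act (h \<otimes> g) u = act h (act g u)" using act_mult[OF gh(2,1) u_mem] .
      have "h \<otimes> g \<in> B (n + c)" using word_ball_mult[OF S_carrier h(1) g(1)] by (simp add: add.commute)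
      moreover have "h \<otimes> g \<notin> B (m - c)"
      proof
        assume "h \<otimes> g \<in> B (m - c)"
        then have "inv h \<otimes> (h \<otimes> g) \<in> B (c + (m - c))"
          using word_ball_inv[OF S_carrier S_inv h(1)] by (intro word_ball_mult S_carrier)
        then show False using g(4) mn gh H_carrier by (simp add: inv_mult_mult_cancel)
      qed
      ultimately show "p \<in> B c \<times> ?Y" unfolding p h_def[symmetric] using h eq by (simp add: orb_def)
    qed
  qed (use finite_B finite_orb in auto)
  moreover have "card ?X = card (orb n x z) - card (orb m x z)"
    using orb_mono[OF mn(1)] finite_orb by (intro card_Diff_subset) auto
  moreover have "card ?Y = card (orb (n + c) u v) - card (orb (m - c) u v)"
    using orb_mono[of "m - c" "n + c"] mn finite_orb by (intro card_Diff_subset) auto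
  moreover have "card (orb m x z) \<le> card (orb n x z)" "card (orb (m - c) u v) \<le> card (orb (n + c) u v)"
    using orb_mono[of m n x z] orb_mono[of "m - c" "n + c" u v] mn finite_orb by (simp_all add: card_mono)
  ultimately have "real (card (orb n x z)) - real (card (orb m x z)) \<le>
      real (card (B c)) * (real (card (orb (n + c) u v)) - real (card (orb (m - c) u v)))"
    by (simp add: card_cartesian_product flip: of_nat_diff of_nat_mult)
  then show ?thesis unfolding N_def using D_eq_card x(3) u_less_v by simp
qed

text \<open>If no such radius existed, \<open>N\<close> would be multiplied by at least a fixed
  factor above 1 on every stretch of length \<open>2 * k\<close>, although it is bounded by the
  cardinality of balls.\<close>

lemma slow_growth_times: "\<exists>n\<ge>k. N (n + k) \<le> (1 + 1 / (real k + 1)) * N (n - k)"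
proof (rule ccontr)
  define q where "q = 1 + 1 / (real k + 1)"
  assume "\<not> ?thesis"
  then have *: "q * N (n - k) < N (n + k)" if "n \<ge> k" for n
    using that unfolding q_def by (meson not_le)
  have step: "q * N m \<le> N (m + 2 * k)" for m using *[of "m + k"] by (simp add: mult_2 add.assoc)
  have q: "q > 1" unfolding q_def by simp
  have pw: "q ^ j \<le> N (2 * k * j)" for j
  proof (induction j)
    case 0 then show ?case using N_ge_1 by simp
  next
    case (Suc j)
    have "q * q ^ j \<le> q * N (2 * k * j)" using Suc q by simp
    also have "\<dots> \<le> N (2 * k * Suc j)" using step[of "2 * k * j"] by (simp add: algebra_simps)
    finally show ?case by simp
  qed
  \<comment> \<open>Any index larger than \<open>2 * k\<close> makes the growth by \<open>e\<close>
    per step too slow for a factor \<open>q\<close> per \<open>2 * k\<close> steps;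
    \<open>4 * k + 1\<close> is such an index and is positive also for \<open>k = 0\<close>.\<close>
  define e where "e = root (4 * k + 1) q"
  have e: "e > 1" "e ^ (4 * k + 1) = q"
    using q real_root_pow_pos2[of "4 * k + 1" q] by (auto simp: e_def simp del: power_Suc power_add)
  have "\<forall>\<^sub>F n in sequentially. real (card (B n)) \<le> e ^ n"
    using subexp finite_S S_H e(1) unfolding subexponential_group_def by blast
  then obtain n0 where n0: "\<And>n. n \<ge> n0 \<Longrightarrow> real (card (B n)) \<le> e ^ n" unfolding eventually_sequentially by blast
  show False
  proof (cases "k = 0")
    case True
    then show False using step[of 0] q N_ge_1[of 0] by (simp add: mult_le_cancel_right1)
  next
    case False
    define j where "j = Suc n0"
    have "2 * k * j \<ge> n0" using False unfolding j_def by (cases k) auto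
    then have "q ^ j \<le> e ^ (2 * k * j)" using pw[of j] N_le_card[of "2 * k * j"] n0 by fastforce
    moreover have "q ^ j = e ^ ((4 * k + 1) * j)" using e(2) by (metis power_mult)
    moreover have "e ^ (2 * k * j) < e ^ ((4 * k + 1) * j)"
      using e(1) False unfolding j_def by (intro power_strict_increasing) (auto simp: algebra_simps)
    ultimately show False by simp
  qed
qed

text \<open>The margins \<open>k\<close> tend to infinity, so every fixed margin \<open>j\<close> is
  eventually covered, with relative error at most \<open>1 / (k + 1)\<close>. The third property,
  the case of margin 1, is what bounds the translation of a generator uniformly.\<close>

lemma slow_times_sequence:
  obtains r :: "nat \<Rightarrow> nat" where "\<And>k. k \<le> r k"
    "\<And>j. (\<lambda>k. (N (r k + j) - N (r k - j)) / N (r k)) \<longlonglongrightarrow> 0"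
    "\<And>k. 1 \<le> k \<Longrightarrow> N (r k + 1) \<le> 2 * N (r k)"
proof -
  obtain r where r: "\<And>k. k \<le> r k" "\<And>k. N (r k + k) \<le> (1 + 1 / (real k + 1)) * N (r k - k)"
    using slow_growth_times by metis
  have bound: "N (r k + j) - N (r k - j) \<le> N (r k) / (real k + 1)" if "j \<le> k" for j k
  proof -
    have "N (r k + j) - N (r k - j) \<le> N (r k + k) - N (r k - k)"
      using that by (intro diff_mono N_mono) auto
    also have "\<dots> \<le> N (r k - k) / (real k + 1)" using r(2)[of k] by (simp add: algebra_simps)
    also have "\<dots> \<le> N (r k) / (real k + 1)" by (intro divide_right_mono N_mono) auto
    finally show ?thesis .
  qed
  show thesis
  proof (rule that[OF r(1)])
    fix j
    show "(\<lambda>k. (N (r k + j) - N (r k - j)) / N (r k)) \<longlonglongrightarrow> 0"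
    proof (rule tendsto_sandwich[of "\<lambda>_. 0" _ _ "\<lambda>k. 1 / (real k + 1)"])
      have "0 \<le> (N (r k + j) - N (r k - j)) / N (r k)" for k
        using N_ge_1[of "r k"] N_mono[of "r k - j" "r k + j"] by simp
      then show "\<forall>\<^sub>F k in sequentially. 0 \<le> (N (r k + j) - N (r k - j)) / N (r k)" by simp
      have "(N (r k + j) - N (r k - j)) / N (r k) \<le> 1 / (real k + 1)" if "j \<le> k" for k
        using bound[OF that] N_ge_1[of "r k"] by (simp add: field_simps)
      then show "\<forall>\<^sub>F k in sequentially. (N (r k + j) - N (r k - j)) / N (r k) \<le> 1 / (real k + 1)"
        unfolding eventually_sequentially by blast
      show "(\<lambda>k. 1 / (real k + 1)) \<longlonglongrightarrow> 0"
        using LIMSEQ_inverse_real_of_nat by (simp add: inverse_eq_divide add.commute)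
    qed simp
  next
    fix k :: nat assume "1 \<le> k"
    have "N (r k + 1) - N (r k - 1) \<le> N (r k) / (real k + 1)" using bound \<open>1 \<le> k\<close> by blast
    also have "\<dots> \<le> N (r k)" using N_ge_1[of "r k"] by (simp add: field_simps)
    finally show "N (r k + 1) \<le> 2 * N (r k)" using N_mono[of "r k - 1" "r k"] by simp
  qed
qed

text \<open>Plante's averaging: along times at which the orbit of \<open>u\<close> meets \<open>[u, v)\<close> at a nearly constant rate,
  normalized orbit counts converge to an invariant measure, and the measure of \<open>[u, g u)\<close> is a
  homomorphism in \<open>g\<close>.\<close>

lemma translation_homomorphism:
  obtains \<tau> :: "'a \<Rightarrow> real" where "additive_on G H \<tau>" "\<And>g. g \<in> H \<Longrightarrow> v \<le> act g u \<Longrightarrow> 1 \<le> \<tau> g"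
proof -
  obtain r :: "nat \<Rightarrow> nat" where r: "\<And>k. k \<le> r k"
    "\<And>j. (\<lambda>k. (N (r k + j) - N (r k - j)) / N (r k)) \<longlonglongrightarrow> 0"
    "\<And>k. 1 \<le> k \<Longrightarrow> N (r k + 1) \<le> 2 * N (r k)"
    using slow_times_sequence by blast
  have N0: "N n > 0" for n using N_ge_1[of n] by linarith
  \<comment> \<open>Translation by an element of length \<open>l\<close> changes counts by at most
    the shell between the radii \<open>n - l\<close> and \<open>n + l\<close>. By
    \<open>D_shell_le\<close> this shell is dominated by one of the window, which is negligible
    against \<open>N\<close> at the chosen times.\<close>
  have inv_le: "(\<lambda>k. (D (r k) (act h x) (act h y) - D (r k) x y) / N (r k)) \<longlonglongrightarrow> 0"
    if h: "h \<in> H" and xy: "x \<in> J" "y \<in> J" "x \<le> y" for h x y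
  proof -
    obtain l where l: "h \<in> B l" using H_B[OF h] by blast
    obtain c where c: "\<forall>z\<in>{x..y}. \<exists>w\<in>B c. u \<le> act w z \<and> act w z < v"
      using uniform_return[OF xy(1,2)] by blast
    let ?e = "\<lambda>k. real (card (B c)) * ((N (r k + (l + c)) - N (r k - (l + c))) / N (r k))"
    have "\<bar>D n (act h x) (act h y) - D n x y\<bar> \<le> real (card (B c)) * (N (n + (l + c)) - N (n - (l + c)))"
      if n: "l + c \<le> n" for n
    proof -
      have "D n (act h x) (act h y) \<le> D (n + l) x y" by (rule D_shift_ge[OF l xy])
      moreover have "D (n - l) x y \<le> D n (act h x) (act h y)"
        using D_shift_le[OF l xy, of "n - l"] n by simp
      moreover have "D (n - l) x y \<le> D n x y" "D n x y \<le> D (n + l) x y"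
        using xy(3) by (auto intro!: D_mono)
      moreover have "D (n + l) x y - D (n - l) x y \<le> real (card (B c)) * (N (n + l + c) - N (n - l - c))"
        using n by (intro D_shell_le c xy) auto
      ultimately show ?thesis by (simp add: add.assoc)
    qed
    then have "\<bar>(D (r k) (act h x) (act h y) - D (r k) x y) / N (r k)\<bar> \<le> ?e k" if "l + c \<le> k" for k
      using r(1)[of k] that N0[of "r k"] by (simp add: abs_divide divide_right_mono)
    then have "\<forall>\<^sub>F k in sequentially. norm ((D (r k) (act h x) (act h y) - D (r k) x y) / N (r k)) \<le> ?e k"
      unfolding eventually_sequentially real_norm_def by blast
    moreover have "?e \<longlonglongrightarrow> 0" using tendsto_mult_left[OF r(2)[of "l + c"], of "real (card (B c))"] by simp
    ultimately show ?thesis by (rule Lim_null_comparison)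
  qed
  have invariant: "(\<lambda>k. (D (r k) (act h x) (act h y) - D (r k) x y) / N (r k)) \<longlonglongrightarrow> 0"
    if h: "h \<in> H" and xy: "x \<in> J" "y \<in> J" for h x y
  proof (cases "x \<le> y")
    case True then show ?thesis using inv_le h xy by blast
  next
    case False
    then have "(\<lambda>k. - ((D (r k) (act h y) (act h x) - D (r k) y x) / N (r k))) \<longlonglongrightarrow> - 0"
      using h xy by (intro tendsto_minus inv_le) auto
    then show ?thesis
      by (simp add: D_swap[of _ "act h x"] D_swap[of _ x] minus_divide_left del: divide_minus_left)
  qed
  define \<tau>' where "\<tau>' k g = D (r k) u (act g u) / N (r k)" for k g
  \<comment> \<open>If \<open>s\<close> moves \<open>u\<close> to the right, then at most to
    \<open>v\<close>, and the count is at most \<open>N\<close>. If it moves \<open>u\<close> to the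
    left, the interval is first carried by \<open>inv s\<close> to the right of \<open>u\<close>,
    which costs one unit of radius and hence the factor 2. Index 0, to which this factor does not
    apply, is accounted for by its own value.\<close>
  have "bounded (range (\<lambda>k. \<tau>' k s))" if s: "s \<in> S" for s
  proof -
    have "\<bar>\<tau>' k s\<bar> \<le> 2" if k: "1 \<le> k" for k
    proof -
      have sH: "s \<in> H" "inv s \<in> H" using s S_H S_inv by auto
      have sJ: "act s u \<in> J" using act_mem sH u_mem by blast
      have "\<bar>D (r k) u (act s u)\<bar> \<le> 2 * N (r k)"
      proof (cases "u \<le> act s u")
        case True
        have "act s u \<le> v" unfolding v_def using act_le_up s by simp
        then have "D (r k) u (act s u) \<le> N (r k)"
          unfolding N_def using True D_trans[of "r k" u "act s u" v] D_eq_card[of "act s u" v "r k"] by simp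
        moreover have "0 \<le> D (r k) u (act s u)" using D_eq_card True by simp
        ultimately show ?thesis using N0[of "r k"] by simp
      next
        case False
        have iu: "u \<le> act (inv s) u" using False act_le_inv_iff[OF sH(1) u_mem u_mem] by simp
        have "act (inv s) u \<le> v" unfolding v_def using act_le_up[of "inv s"] S_inv s by simp
        then have le: "D (r k + 1) u (act (inv s) u) \<le> N (r k + 1)"
          unfolding N_def using D_trans[of "r k + 1" u "act (inv s) u" v] D_eq_card[of "act (inv s) u" v "r k + 1"] by simp
        have "inv s \<in> B 1" using s S_inv S_carrier by (intro word_ball_incl) auto
        then have "D (r k) (act s u) u \<le> D (r k + 1) (act (inv s) (act s u)) (act (inv s) u)"
          using False by (intro D_shift_le sJ u_mem) auto
        also have "\<dots> \<le> N (r k + 1)" using le act_inv(1)[OF sH(1) u_mem] by simp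
        also have "\<dots> \<le> 2 * N (r k)" using r(3) k by blast
        finally have "D (r k) (act s u) u \<le> 2 * N (r k)" .
        moreover have "0 \<le> D (r k) (act s u) u" using D_eq_card False by simp
        ultimately show ?thesis using D_swap[of "r k" "act s u" u] by simp
      qed
      then show ?thesis unfolding \<tau>'_def using N0[of "r k"] by (simp add: abs_divide field_simps)
    qed
    then have le2: "\<bar>\<tau>' k s\<bar> \<le> 2" if "k \<noteq> 0" for k using that by simp
    have "\<bar>\<tau>' k s\<bar> \<le> 2 + \<bar>\<tau>' 0 s\<bar>" for k
    proof (cases "k = 0")
      case False
      show ?thesis using le2[OF False] by linarith
    qed simp
    then show ?thesis unfolding bounded_iff by auto
  qed
  then obtain q :: "nat \<Rightarrow> nat" where q: "strict_mono q" "\<forall>s\<in>S. convergent (\<lambda>k. \<tau>' (q k) s)"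
    using convergent_subseq_finite[OF finite_S, of \<tau>'] by blast
  \<comment> \<open>The interval from \<open>u\<close> to its image under
    \<open>g \<otimes> h\<close> splits at the image under \<open>g\<close>, and its second part is
    the translate by \<open>g\<close> of the interval from \<open>u\<close> to its image under
    \<open>h\<close>. Asymptotic invariance turns this into asymptotic additivity.\<close>
  have add: "(\<lambda>k. \<tau>' (q k) (g \<otimes> h) - \<tau>' (q k) g - \<tau>' (q k) h) \<longlonglongrightarrow> 0" if gh: "g \<in> H" "h \<in> H" for g h
  proof -
    let ?f = "\<lambda>k. (D (r k) (act g u) (act g (act h u)) - D (r k) u (act h u)) / N (r k)"
    have "?f \<longlonglongrightarrow> 0" using invariant gh u_mem act_mem by blast
    then have "(?f \<circ> q) \<longlonglongrightarrow> 0" using q(1) by (rule LIMSEQ_subseq_LIMSEQ)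
    moreover have "?f k = \<tau>' k (g \<otimes> h) - \<tau>' k g - \<tau>' k h" for k
      unfolding \<tau>'_def using D_trans[of "r k" u "act g u" "act g (act h u)"] act_mult[OF gh u_mem]
      by (simp flip: diff_divide_distrib)
    ultimately show ?thesis by (simp add: o_def)
  qed
  have conv_mult: "(\<lambda>k. \<tau>' (q k) (g \<otimes> h)) \<longlonglongrightarrow> x + y"
    if "g \<in> H" "h \<in> H" "(\<lambda>k. \<tau>' (q k) g) \<longlonglongrightarrow> x" "(\<lambda>k. \<tau>' (q k) h) \<longlonglongrightarrow> y" for g h x y
    using tendsto_add[OF tendsto_add[OF add[OF that(1,2)] that(3)] that(4)] by simp
  have conv: "convergent (\<lambda>k. \<tau>' (q k) g)" if "g \<in> B n" for g n
    using that
  proof (induction n arbitrary: g)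
    case 0
    then have "\<tau>' k g = 0" for k unfolding \<tau>'_def using act_one u_mem by (simp add: D_def)
    then show ?case by (simp add: convergent_const)
  next
    case (Suc n)
    consider "g = \<one>" | s z where "s \<in> S" "z \<in> B n" "g = s \<otimes> z"
      using Suc.prems by (auto simp: word_ball_Suc)
    then show ?case
    proof cases
      case 1
      then have "\<tau>' k g = 0" for k unfolding \<tau>'_def using act_one u_mem by (simp add: D_def)
      then show ?thesis by (simp add: convergent_const)
    next
      case 2
      then have "s \<in> H" "z \<in> H" using S_H B_H by auto
      then show ?thesis using conv_mult[of s z] q(2) Suc.IH[OF 2(2)] 2 unfolding convergent_def by blast
    qed
  qed
  define \<tau> where "\<tau> g = lim (\<lambda>k. \<tau>' (q k) g)" for g
  have \<tau>: "(\<lambda>k. \<tau>' (q k) g) \<longlonglongrightarrow> \<tau> g" if g: "g \<in> H" for g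
    using H_B[OF g] conv unfolding \<tau>_def by (auto simp: convergent_LIMSEQ_iff)
  show thesis
  proof (rule that[of \<tau>])
    show "additive_on G H \<tau>"
      unfolding additive_on_def
    proof (intro ballI)
      fix g h assume gh: "g \<in> H" "h \<in> H"
      show "\<tau> (g \<otimes> h) = \<tau> g + \<tau> h"
        using LIMSEQ_unique[OF \<tau>[OF H_closed(1)[OF gh]] conv_mult[OF gh \<tau>[OF gh(1)] \<tau>[OF gh(2)]]] .
    qed
  next
    fix g assume g: "g \<in> H" "v \<le> act g u"
    have "1 \<le> \<tau>' k g" for k
    proof -
      have "N (r k) \<le> D (r k) u (act g u)"
        unfolding N_def using D_trans[of "r k" u v "act g u"] D_eq_card[OF g(2), of "r k"] by simp
      then show ?thesis unfolding \<tau>'_def using N0[of "r k"] by simp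
    qed
    then show "1 \<le> \<tau> g" using \<tau>[OF g(1)] by (intro LIMSEQ_le_const) auto
  qed
qed

text \<open>On the kernel the translation homomorphism vanishes, so no element of it carries
  \<open>u\<close> to \<open>v\<close> or beyond. The kernel orbit of \<open>u\<close> is therefore
  bounded inside \<open>J\<close>, and its supremum is a fixed point.\<close>

lemma real_kernel_fixed_point: "\<exists>p\<in>J. \<forall>g\<in>real_kernel G H. act g p = p"
proof -
  let ?K = "real_kernel G H"
  obtain \<tau> :: "'a \<Rightarrow> real" where \<tau>: "additive_on G H \<tau>" "\<And>g. g \<in> H \<Longrightarrow> v \<le> act g u \<Longrightarrow> 1 \<le> \<tau> g"
    using translation_homomorphism by blast
  have K: "subgroup ?K G" using real_kernel_subgroup H_subgroup by blast
  have KH: "g \<in> H" if "g \<in> ?K" for g using that real_kernel_subset by blast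
  have lt: "act g u < v" if "g \<in> ?K" for g
    using that \<tau>(1) \<tau>(2)[OF KH[OF that]] by (force simp: real_kernel_def)
  define p where "p = Sup ((\<lambda>g. act g u) ` ?K)"
  have bdd: "bdd_above ((\<lambda>g. act g u) ` ?K)" using lt by (force intro!: bdd_aboveI[of _ v])
  have ne: "?K \<noteq> {}" using subgroup.one_closed[OF K] by blast
  have le: "act g u \<le> p" if "g \<in> ?K" for g unfolding p_def using bdd that by (intro cSup_upper) auto
  have "p \<le> v" unfolding p_def using lt ne by (intro cSup_least) (auto intro: less_imp_le)
  moreover have "u \<le> p" using le[OF subgroup.one_closed[OF K]] act_one u_mem by simp
  ultimately have p: "p \<in> J" using u_mem v_mem by auto
  have ub: "act g p \<le> p" if g: "g \<in> ?K" for g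
  proof (rule ccontr)
    assume "\<not> act g p \<le> p"
    then have "act (inv g) p < p"
      using act_less_inv_iff[of "inv g" p p] p KH[OF g] H_closed(2) H_carrier[of g] by auto
    then obtain h where h: "h \<in> ?K" "act (inv g) p < act h u"
      unfolding p_def using less_cSup_iff[OF _ bdd] ne by auto
    then have "p < act g (act h u)"
      using act_less_inv_iff[of "inv g" p "act h u"] p act_mem[OF KH[OF h(1)] u_mem] KH[OF g] H_closed(2) H_carrier[of g]
      by auto
    also have "\<dots> = act (g \<otimes> h) u" using act_mult KH g h u_mem by simp
    also have "\<dots> \<le> p" using le subgroup.m_closed[OF K g h(1)] by blast
    finally show False by simp
  qed
  have "act g p = p" if g: "g \<in> ?K" for g
    using ub[OF g] ub[OF subgroup.m_inv_closed[OF K g]] act_le_inv_iff[of "inv g" p p] p KH[OF g] H_closed(2) H_carrier[of g]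
    by (auto intro: antisym)
  then show ?thesis using p by blast
qed

end

section \<open>Diffeomorphisms and gaps of fixed points\<close>

lemma has_continuous_deriv_mvt:
  assumes f: "has_continuous_deriv_on f f' {0..1}" and xy: "0 \<le> x" "x < y" "y \<le> 1"
  shows "\<exists>z. x < z \<and> z < y \<and> f y - f x = f' z * (y - x)"
proof -
  have "(f has_derivative (\<lambda>h. f' z * h)) (at z within {x..y})" if "x \<le> z" "z \<le> y" for z
  proof -
    have "(f has_real_derivative f' z) (at z within {0..1})"
      using f that xy by (simp add: has_continuous_deriv_on_def)
    then have "(f has_real_derivative f' z) (at z within {x..y})"
      by (rule has_field_derivative_subset) (use xy in auto)
    then show ?thesis by (simp add: has_field_derivative_def)
  qed
  then obtain z where "z \<in> {x<..<y}" "f y - f x = f' z * (y - x)"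
    using mvt_simple[OF xy(2), of f "\<lambda>z h. f' z * h"] by blast
  then show ?thesis by auto
qed

text \<open>One constant serves all intervals with fixed ends, however short; the bound will be
  applied to the images of a gap under all iterates of an element.\<close>

definition displacement_const :: "real \<Rightarrow> (real \<Rightarrow> real) \<Rightarrow> real \<Rightarrow> bool"
  where "displacement_const \<alpha> f C \<longleftrightarrow> 0 \<le> C \<and> (\<forall>a b x. 0 \<le> a \<longrightarrow> a \<le> x \<longrightarrow> x \<le> b \<longrightarrow> b \<le> 1 \<longrightarrow> f a = a \<longrightarrow> f b = b
    \<longrightarrow> \<bar>f x - x\<bar> \<le> C * (b - a) powr (1 + \<alpha>))"

text \<open>The mean value theorem on \<open>[a, b]\<close> gives a point with derivative 1, so the derivative deviates
  from 1 by \<open>O((b - a)\<^sup>\<alpha>)\<close>.\<close>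

lemma displacement_const_exists:
  assumes f: "f \<in> diff_unit \<alpha>" and "\<alpha> > 0"
  shows "\<exists>C. displacement_const \<alpha> f C"
proof -
  obtain f' where f': "has_continuous_deriv_on f f' {0..1}" "holder_continuous_on \<alpha> {0..1} f'"
    using f by (auto simp: diff_unit_def)
  obtain C where C: "C \<ge> 0" "\<And>x y. x \<in> {0..1} \<Longrightarrow> y \<in> {0..1} \<Longrightarrow> \<bar>f' x - f' y\<bar> \<le> C * \<bar>x - y\<bar> powr \<alpha>"
    using holder_nonneg_const[OF f'(2)] by blast
  have "\<bar>f x - x\<bar> \<le> C * (b - a) powr (1 + \<alpha>)"
    if x: "0 \<le> a" "a \<le> x" "x \<le> b" "b \<le> 1" "f a = a" "f b = b" for a b x
  proof (cases "a = x")
    case True then show ?thesis using x C(1) by simp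
  next
    case False
    then have ax: "a < x" "a < b" "x \<le> 1" using x by auto
    obtain p where p: "a < p" "p < x" "f x - f a = f' p * (x - a)"
      using has_continuous_deriv_mvt[OF f'(1) x(1) ax(1,3)] by blast
    obtain q where q: "a < q" "q < b" "f b - f a = f' q * (b - a)"
      using has_continuous_deriv_mvt[OF f'(1) x(1) ax(2) x(4)] by blast
    have pq: "\<bar>f' p - f' q\<bar> \<le> C * \<bar>p - q\<bar> powr \<alpha>" by (rule C(2)) (use p q x ax in auto)
    have "f' q = 1" using q(3) x ax by simp
    then have "f x - x = (f' p - f' q) * (x - a)" using p(3) x by (simp add: algebra_simps)
    then have "\<bar>f x - x\<bar> = \<bar>f' p - f' q\<bar> * (x - a)" using ax by (simp add: abs_mult)
    also have "\<dots> \<le> (C * \<bar>p - q\<bar> powr \<alpha>) * (b - a)"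
      using x ax C(1) by (intro mult_mono pq) auto
    also have "\<dots> \<le> (C * (b - a) powr \<alpha>) * (b - a)"
      using p q x ax C \<open>\<alpha> > 0\<close> by (intro mult_right_mono mult_left_mono powr_mono2) auto
    also have "\<dots> = C * (b - a) powr (1 + \<alpha>)" using ax by (simp add: powr_add)
    finally show ?thesis .
  qed
  then show ?thesis unfolding displacement_const_def using C(1) by blast
qed

lemma displacement_const_finite:
  assumes "finite S" "S \<subseteq> diff_unit \<alpha>" "\<alpha> > 0"
  shows "\<exists>C. 0 \<le> C \<and> (\<forall>s\<in>S. displacement_const \<alpha> s C)"
  using assms(1,2)
proof (induction S)
  case empty then show ?case by auto
next
  case (insert s S)
  have up: "displacement_const \<alpha> f (max C D)" if "displacement_const \<alpha> f C" for f C D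
    unfolding displacement_const_def
  proof (intro conjI allI impI)
    show "0 \<le> max C D" using that unfolding displacement_const_def by (simp add: le_max_iff_disj)
    fix a b x :: real
    assume x: "0 \<le> a" "a \<le> x" "x \<le> b" "b \<le> 1" "f a = a" "f b = b"
    have "\<bar>f x - x\<bar> \<le> C * (b - a) powr (1 + \<alpha>)" using that x by (simp add: displacement_const_def)
    also have "\<dots> \<le> max C D * (b - a) powr (1 + \<alpha>)" by (intro mult_right_mono) auto
    finally show "\<bar>f x - x\<bar> \<le> max C D * (b - a) powr (1 + \<alpha>)" .
  qed
  obtain C where C: "0 \<le> C" "\<forall>s\<in>S. displacement_const \<alpha> s C" using insert by auto
  obtain D where D: "displacement_const \<alpha> s D" using displacement_const_exists insert.prems assms(3) by blast
  have "displacement_const \<alpha> t (max C D)" if "t \<in> insert s S" for t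
    using that C(2) D up[of t C D] up[of t D C] by (auto simp: max.commute)
  then show ?case using C(1) by (intro exI[of _ "max C D"]) auto
qed

text \<open>In essence, the logarithm of the derivative is \<alpha>-Hoelder: the derivative is, and
  it is bounded away from 0 because the inverse is continuously differentiable. Two mean slopes are
  two values of the derivative. The inequality is written without division so that it can be
  multiplied along an orbit.\<close>

lemma slope_distortion:
  assumes f: "f \<in> diff_unit \<alpha>" and "\<alpha> > 0"
  shows "\<exists>C\<ge>0. \<forall>a b x y. 0 \<le> a \<longrightarrow> a \<le> x \<longrightarrow> x < y \<longrightarrow> y \<le> b \<longrightarrow> b \<le> 1 \<longrightarrow>
    (f b - f a) * (y - x) \<le> exp (C * (b - a) powr \<alpha>) * (f y - f x) * (b - a)"
proof -
  obtain f' where f': "has_continuous_deriv_on f f' {0..1}" "holder_continuous_on \<alpha> {0..1} f'"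
    using f by (auto simp: diff_unit_def)
  obtain g' where g': "has_continuous_deriv_on (inv_into {0..1} f) g' {0..1}"
    using f by (auto simp: diff_unit_def)
  have bij: "bij_betw f {0..1} {0..1}" and mono: "strict_mono_on {0..1} f"
    using f by (auto simp: diff_unit_def Bij_def)
  obtain C where C: "C \<ge> 0" "\<And>x y. x \<in> {0..1} \<Longrightarrow> y \<in> {0..1} \<Longrightarrow> \<bar>f' x - f' y\<bar> \<le> C * \<bar>x - y\<bar> powr \<alpha>"
    using holder_nonneg_const[OF f'(2)] by blast
  obtain M where M: "M > 0" "\<And>x. x \<in> {0..1} \<Longrightarrow> \<bar>g' x\<bar> \<le> M"
    using continuous_deriv_bounded[OF g'] by blast
  have lower: "1 \<le> M * \<bar>f' x\<bar>" if "x \<in> {0..1}" for x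
  proof -
    have fx: "f x \<in> {0..1}" using bij that by (auto simp: bij_betw_def)
    have "inv_into {0..1} f (f x) = x" using bij that by (simp add: bij_betw_inv_into_left)
    then have "f' x * g' (f x) = 1" using deriv_inverse_product[OF f'(1) g' bij fx] by simp
    then have "1 = \<bar>f' x\<bar> * \<bar>g' (f x)\<bar>" by (metis abs_mult abs_one)
    also have "\<dots> \<le> \<bar>f' x\<bar> * M" using M(2)[OF fx] by (intro mult_left_mono) auto
    finally show ?thesis by (simp add: mult.commute)
  qed
  have "(f b - f a) * (y - x) \<le> exp (M * C * (b - a) powr \<alpha>) * (f y - f x) * (b - a)"
    if x: "0 \<le> a" "a \<le> x" "x < y" "y \<le> b" "b \<le> 1" for a b x y
  proof -
    obtain p where p: "x < p" "p < y" "f y - f x = f' p * (y - x)"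
      using has_continuous_deriv_mvt[OF f'(1), of x y] x by auto
    obtain q where q: "a < q" "q < b" "f b - f a = f' q * (b - a)"
      using has_continuous_deriv_mvt[OF f'(1), of a b] x by auto
    have "f x < f y" using mono x by (auto simp: strict_mono_on_def)
    then have "0 < f' p * (y - x)" using p(3) by linarith
    then have fp: "f' p > 0" using zero_less_mult_pos2[of "f' p" "y - x"] x(3) by linarith
    have "f' q \<le> f' p + C * \<bar>q - p\<bar> powr \<alpha>" using C(2)[of q p] p q x by auto
    also have "\<dots> \<le> f' p + C * (b - a) powr \<alpha>"
      using p q x C \<open>\<alpha> > 0\<close> by (intro add_left_mono mult_left_mono powr_mono2) auto
    also have "\<dots> \<le> f' p + (M * f' p) * (C * (b - a) powr \<alpha>)"
    proof -
      have "1 \<le> M * f' p" using lower[of p] p x fp by auto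
      then have "1 * (C * (b - a) powr \<alpha>) \<le> (M * f' p) * (C * (b - a) powr \<alpha>)"
        using C(1) by (intro mult_right_mono) auto
      then show ?thesis by simp
    qed
    also have "\<dots> = (1 + M * C * (b - a) powr \<alpha>) * f' p" by (simp add: algebra_simps)
    also have "\<dots> \<le> exp (M * C * (b - a) powr \<alpha>) * f' p"
      using fp by (intro mult_right_mono exp_ge_add_one_self) auto
    finally have "f' q * ((b - a) * (y - x)) \<le> exp (M * C * (b - a) powr \<alpha>) * f' p * ((b - a) * (y - x))"
      using x by (intro mult_right_mono) auto
    then show ?thesis unfolding p(3) q(3) by (simp add: mult_ac)
  qed
  then show ?thesis using C(1) M(1) by (intro exI[of _ "M * C"]) auto
qed

section \<open>Common fixed points and gaps\<close>

interpretation unit_bij: group "BijGroup {0..1::real}"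
  by (rule group_BijGroup)

abbreviation unit_bij_group :: "(real \<Rightarrow> real) monoid" ("\<B>") where "\<B> \<equiv> BijGroup {0..1}"

lemma unit_bij_carrier: "f \<in> carrier \<B> \<longleftrightarrow> f \<in> Bij {0..1}"
  by (simp add: BijGroup_def)

lemma unit_bij_mem: "f \<in> carrier \<B> \<Longrightarrow> x \<in> {0..1} \<Longrightarrow> f x \<in> {0..1}"
  unfolding unit_bij_carrier by (auto simp: Bij_def bij_betw_def)

lemma unit_bij_mult: "f \<in> carrier \<B> \<Longrightarrow> g \<in> carrier \<B> \<Longrightarrow> x \<in> {0..1} \<Longrightarrow> (f \<otimes>\<^bsub>\<B>\<^esub> g) x = f (g x)"
  by (simp add: BijGroup_def compose_def)

lemma unit_bij_one: "x \<in> {0..1} \<Longrightarrow> \<one>\<^bsub>\<B>\<^esub> x = x"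
  by (simp add: BijGroup_def)

lemma unit_bij_inv:
  assumes "f \<in> carrier \<B>" "x \<in> {0..1}"
  shows "(inv\<^bsub>\<B>\<^esub> f) (f x) = x" "f ((inv\<^bsub>\<B>\<^esub> f) x) = x"
  using unit_bij_mult[of "inv\<^bsub>\<B>\<^esub> f" f x] unit_bij_mult[of f "inv\<^bsub>\<B>\<^esub> f" x] assms
  by (simp_all add: unit_bij_one)

lemma unit_bij_eq_one:
  assumes "f \<in> carrier \<B>" "\<And>x. x \<in> {0..1} \<Longrightarrow> f x = x"
  shows "f = \<one>\<^bsub>\<B>\<^esub>"
proof
  fix x show "f x = \<one>\<^bsub>\<B>\<^esub> x"
    using assms by (cases "x \<in> {0..1}") (auto simp: BijGroup_def Bij_def extensional_def)
qed

lemma diff_unit_carrier: "f \<in> diff_unit \<alpha> \<Longrightarrow> f \<in> carrier \<B>"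
  by (auto simp: diff_unit_def BijGroup_def)

lemma diff_unit_less_iff:
  assumes "f \<in> diff_unit \<alpha>" "x \<in> {0..1}" "y \<in> {0..1}"
  shows "f x < f y \<longleftrightarrow> x < y"
proof -
  have "strict_mono_on {0..1} f" using assms by (auto simp: diff_unit_def)
  then show ?thesis using assms(2,3) by (rule strict_mono_on_less)
qed

lemma diff_unit_le_iff:
  assumes "f \<in> diff_unit \<alpha>" "x \<in> {0..1}" "y \<in> {0..1}"
  shows "f x \<le> f y \<longleftrightarrow> x \<le> y"
  using diff_unit_less_iff[OF assms(1,3,2)] by (simp add: not_less[symmetric])

lemma diff_unit_continuous: "f \<in> diff_unit \<alpha> \<Longrightarrow> continuous_on {0..1} f"
  unfolding diff_unit_def has_continuous_deriv_on_def by (auto intro: DERIV_continuous_on)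

text \<open>A connected component of the complement of the set of common fixed points of
  \<open>H\<close>.\<close>

definition fixed_gap :: "(real \<Rightarrow> real) set \<Rightarrow> real \<Rightarrow> real \<Rightarrow> bool"
  where "fixed_gap H a b \<longleftrightarrow> 0 \<le> a \<and> a < b \<and> b \<le> 1 \<and> (\<forall>h\<in>H. h a = a \<and> h b = b) \<and>
    (\<forall>x. a < x \<longrightarrow> x < b \<longrightarrow> (\<exists>h\<in>H. h x \<noteq> x))"

lemma diff_unit_endpoints:
  assumes "f \<in> diff_unit \<alpha>"
  shows "f 0 = 0" "f 1 = 1"
proof -
  note c = diff_unit_carrier[OF assms]
  have m: "(inv\<^bsub>\<B>\<^esub> f) 0 \<in> {0..1}" "(inv\<^bsub>\<B>\<^esub> f) 1 \<in> {0..1}"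
    using unit_bij_mem[OF unit_bij.inv_closed[OF c]] by simp_all
  have "f 0 \<le> f ((inv\<^bsub>\<B>\<^esub> f) 0)" "f ((inv\<^bsub>\<B>\<^esub> f) 1) \<le> f 1"
    using m diff_unit_le_iff[OF assms] by auto
  then show "f 0 = 0" "f 1 = 1"
    using unit_bij_inv(2)[OF c, of 0] unit_bij_inv(2)[OF c, of 1] unit_bij_mem[OF c, of 0] unit_bij_mem[OF c, of 1] by auto
qed

lemma fixed_gap_exists:
  assumes H: "H \<subseteq> diff_unit \<alpha>" and z: "z \<in> {0..1}" "h \<in> H" "h z \<noteq> z"
  shows "\<exists>a b. fixed_gap H a b \<and> a < z \<and> z < b"
proof -
  define X where "X = {x \<in> {0..1}. \<forall>h\<in>H. h x = x}"
  have "closed {x \<in> {0..1}. h x - x = 0}" if "h \<in> H" for h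
    using diff_unit_continuous[of h \<alpha>] that H
    by (intro continuous_closed_preimage_constant continuous_intros) auto
  then have "closed (\<Inter>h\<in>H. {x \<in> {0..1}. h x - x = 0})" by blast
  also have "(\<Inter>h\<in>H. {x \<in> {0..1}. h x - x = 0}) = X" unfolding X_def using z(2) by auto
  finally have cl: "closed X" .
  have ends: "0 \<in> X" "1 \<in> X" unfolding X_def using H diff_unit_endpoints by auto
  have zX: "z \<notin> X" unfolding X_def using z by auto
  have "compact (X \<inter> {0..z})" "compact (X \<inter> {z..1})" using cl by (auto intro: closed_Int_compact)
  moreover have "X \<inter> {0..z} \<noteq> {}" "X \<inter> {z..1} \<noteq> {}" using ends z by auto
  ultimately obtain a b where a: "a \<in> X \<inter> {0..z}" "\<And>x. x \<in> X \<inter> {0..z} \<Longrightarrow> x \<le> a"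
    and b: "b \<in> X \<inter> {z..1}" "\<And>x. x \<in> X \<inter> {z..1} \<Longrightarrow> b \<le> x"
    using compact_attains_sup compact_attains_inf by metis
  have az: "a < z" "z < b" using a(1) b(1) zX by (auto simp: less_le)
  have "\<exists>h\<in>H. h x \<noteq> x" if x: "a < x" "x < b" for x
  proof (rule ccontr)
    assume "\<not> ?thesis"
    then have "x \<in> X" unfolding X_def using x a(1) b(1) by auto
    then show False using a(2)[of x] b(2)[of x] x a(1) b(1) by (cases "x \<le> z") auto
  qed
  then have "fixed_gap H a b" unfolding fixed_gap_def using a(1) b(1) az unfolding X_def by auto
  then show ?thesis using az by blast
qed

text \<open>An element normalizing \<open>H\<close> permutes the common fixed points of
  \<open>H\<close>; being increasing, it respects neighbouring ones.\<close>

lemma fixed_gap_image: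
  assumes f: "f \<in> diff_unit \<alpha>" and H: "H \<subseteq> carrier \<B>" and gap: "fixed_gap H a b"
    and conj: "\<And>h. h \<in> H \<Longrightarrow> f \<otimes>\<^bsub>\<B>\<^esub> h \<otimes>\<^bsub>\<B>\<^esub> inv\<^bsub>\<B>\<^esub> f \<in> H"
      "\<And>h. h \<in> H \<Longrightarrow> inv\<^bsub>\<B>\<^esub> f \<otimes>\<^bsub>\<B>\<^esub> h \<otimes>\<^bsub>\<B>\<^esub> f \<in> H"
  shows "fixed_gap H (f a) (f b)"
proof -
  note fc = diff_unit_carrier[OF f]
  note ic = unit_bij.inv_closed[OF fc]
  have ab: "a \<in> {0..1}" "b \<in> {0..1}" "a < b" using gap by (auto simp: fixed_gap_def)
  have fixed: "h (f x) = f x" if h: "h \<in> H" and x: "x \<in> {0..1}" "\<forall>h\<in>H. h x = x" for h x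
  proof -
    have hc: "h \<in> carrier \<B>" using h H by blast
    have "f x = f ((inv\<^bsub>\<B>\<^esub> f \<otimes>\<^bsub>\<B>\<^esub> h \<otimes>\<^bsub>\<B>\<^esub> f) x)"
      using bspec[OF x(2) conj(2)[OF h]] by simp
    also have "\<dots> = f ((inv\<^bsub>\<B>\<^esub> f) (h (f x)))"
      using x(1) hc fc ic unit_bij_mem[OF fc x(1)] by (simp add: unit_bij_mult)
    also have "\<dots> = h (f x)" by (rule unit_bij_inv(2)[OF fc unit_bij_mem[OF hc unit_bij_mem[OF fc x(1)]]])
    finally show ?thesis by simp
  qed
  have "\<exists>h\<in>H. h x \<noteq> x" if x: "f a < x" "x < f b" for x
  proof -
    have xU: "x \<in> {0..1}" using x unit_bij_mem[OF fc ab(1)] unit_bij_mem[OF fc ab(2)] by auto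
    define y where "y = (inv\<^bsub>\<B>\<^esub> f) x"
    have y: "y \<in> {0..1}" "f y = x" unfolding y_def using unit_bij_mem[OF ic xU] unit_bij_inv[OF fc xU] by auto
    then have "a < y" "y < b" using x diff_unit_less_iff[OF f] ab by auto
    then obtain h where h: "h \<in> H" "h y \<noteq> y" using gap unfolding fixed_gap_def by blast
    then have hc: "h \<in> carrier \<B>" using H by blast
    have "(f \<otimes>\<^bsub>\<B>\<^esub> h \<otimes>\<^bsub>\<B>\<^esub> inv\<^bsub>\<B>\<^esub> f) x = f (h y)"
      using xU hc fc ic unit_bij_mem[OF ic xU] by (simp add: unit_bij_mult y_def)
    moreover have "f (h y) \<noteq> f y"
      using h(2) diff_unit_less_iff[OF f unit_bij_mem[OF hc y(1)] y(1)] diff_unit_less_iff[OF f y(1) unit_bij_mem[OF hc y(1)]]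
      by (metis less_irrefl neq_iff)
    ultimately show ?thesis using conj(1)[OF h(1)] y(2) by metis
  qed
  moreover have "f a < f b" using diff_unit_less_iff[OF f] ab by simp
  moreover have "\<forall>h\<in>H. h a = a" "\<forall>h\<in>H. h b = b" using gap by (auto simp: fixed_gap_def)
  ultimately show ?thesis
    unfolding fixed_gap_def using fixed ab unit_bij_mem[OF fc ab(1)] unit_bij_mem[OF fc ab(2)] by auto
qed

lemma generators_fix:
  assumes "S \<subseteq> carrier \<B>" "x \<in> {0..1}" "\<And>s. s \<in> S \<Longrightarrow> s x = x" "h \<in> generate \<B> S"
  shows "h x = x"
  using assms(4)
proof induction
  case one then show ?case using unit_bij_one assms(2) by simp
next
  case (incl h) then show ?case using assms(3) by simp
next
  case (inv h)
  then have "(inv\<^bsub>\<B>\<^esub> h) (h x) = x" using assms(1,2) by (intro unit_bij_inv) auto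
  then show ?case using assms(3)[OF inv] by simp
next
  case (eng h1 h2)
  then have "h1 \<in> carrier \<B>" "h2 \<in> carrier \<B>" using unit_bij.generate_in_carrier[OF assms(1)] by auto
  then show ?case using eng assms(2) by (simp add: unit_bij_mult)
qed

text \<open>An endpoint of the inner gap that is interior to the outer one is moved by some
  generator of \<open>H\<close>. As \<open>H\<close> normalizes \<open>K\<close>, images of fixed
  points of \<open>K\<close> are again fixed and cannot fall inside a gap, so this generator throws
  the whole inner gap off itself. That a generator does so, and not just some element, makes the
  later length estimate uniform.\<close>

lemma inner_gap_displaced:
  assumes S: "S \<subseteq> diff_unit \<alpha>" and HS: "H = generate \<B> S" and K: "K \<subseteq> carrier \<B>"
    and normal: "\<And>h k. h \<in> H \<Longrightarrow> k \<in> K \<Longrightarrow> inv\<^bsub>\<B>\<^esub> h \<otimes>\<^bsub>\<B>\<^esub> k \<otimes>\<^bsub>\<B>\<^esub> h \<in> K"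
    and outer: "fixed_gap H a b" and inner: "fixed_gap K c d" and nest: "a \<le> c" "d \<le> b" "(c, d) \<noteq> (a, b)"
  shows "\<exists>s\<in>S. d \<le> s c \<or> s d \<le> c"
proof -
  have SB: "S \<subseteq> carrier \<B>" using S diff_unit_carrier by blast
  have SH: "S \<subseteq> H" unfolding HS by (auto intro: generate.incl)
  have U: "c \<in> {0..1}" "d \<in> {0..1}" "c < d" using inner by (auto simp: fixed_gap_def)
  have fixK: "\<forall>k\<in>K. k c = c" "\<forall>k\<in>K. k d = d" using inner by (auto simp: fixed_gap_def)
  have moved: "g x \<le> c \<or> d \<le> g x"
    if g: "g \<in> H" and x: "x \<in> {0..1}" "\<forall>k\<in>K. k x = x" for g x
  proof (rule ccontr)
    have gc: "g \<in> carrier \<B>" using g HS unit_bij.generate_in_carrier[OF SB] by blast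
    assume "\<not> ?thesis"
    then have "c < g x" "g x < d" by auto
    then obtain k where k: "k \<in> K" "k (g x) \<noteq> g x" using inner unfolding fixed_gap_def by blast
    then have kc: "k \<in> carrier \<B>" using K by blast
    have "g x = g ((inv\<^bsub>\<B>\<^esub> g \<otimes>\<^bsub>\<B>\<^esub> k \<otimes>\<^bsub>\<B>\<^esub> g) x)" 
      using bspec[OF x(2) normal[OF g k(1)]] by simp
    also have "\<dots> = g ((inv\<^bsub>\<B>\<^esub> g) (k (g x)))" using x(1) gc kc unit_bij_mem[OF gc x(1)] by (simp add: unit_bij_mult)
    also have "\<dots> = k (g x)" by (rule unit_bij_inv(2)[OF gc unit_bij_mem[OF kc unit_bij_mem[OF gc x(1)]]])
    finally show False using k(2) by simp
  qed
  have invH: "inv\<^bsub>\<B>\<^esub> s \<in> H" if "s \<in> S" for s unfolding HS using that by (rule generate.inv)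
  have notfix: "\<exists>s\<in>S. s x \<noteq> x" if "a < x" "x < b" for x
  proof (rule ccontr)
    assume "\<not> ?thesis"
    then have "\<forall>h\<in>H. h x = x"
      using generators_fix[OF SB, of x] that outer unfolding HS fixed_gap_def by auto
    then show False using outer that unfolding fixed_gap_def by blast
  qed
  show ?thesis
  proof (cases "c = a")
    case False
    then have "a < c" "c < b" using nest U by auto
    then obtain s where s: "s \<in> S" "s c \<noteq> c" using notfix by blast
    have sd: "s \<in> diff_unit \<alpha>" and sc: "s \<in> carrier \<B>" using s S SB by auto
    note ic = unit_bij.inv_closed[OF sc]
    have "d \<le> s c \<or> s c < c" using moved[of s c] s SH U fixK by auto
    \<comment> \<open>The preimage of \<open>c\<close> is fixed by \<open>K\<close> and lies to the
      right of \<open>c\<close>, hence not before \<open>d\<close>; applying \<open>s\<close> gives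
      the claim.\<close>
    moreover have "s d \<le> c" if "s c < c"
    proof -
      let ?q = "(inv\<^bsub>\<B>\<^esub> s) c"
      have q: "?q \<in> {0..1}" "s ?q = c" using unit_bij_mem[OF ic U(1)] unit_bij_inv[OF sc U(1)] by auto
      then have "c < ?q" using that diff_unit_less_iff[OF sd U(1) q(1)] by simp
      then have "d \<le> ?q" using moved[OF invH[OF s(1)] U(1) fixK(1)] by auto
      then show ?thesis using diff_unit_le_iff[OF sd U(2) q(1)] q(2) by simp
    qed
    ultimately show ?thesis using s by blast
  next
    case True
    then have "a < d" "d < b" using nest U by auto
    then obtain s where s: "s \<in> S" "s d \<noteq> d" using notfix by blast
    have sd: "s \<in> diff_unit \<alpha>" and sc: "s \<in> carrier \<B>" using s S SB by auto
    note ic = unit_bij.inv_closed[OF sc]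
    have "s d \<le> c \<or> d < s d" using moved[of s d] s SH U fixK by auto
    moreover have "d \<le> s c" if "d < s d"
    proof -
      let ?q = "(inv\<^bsub>\<B>\<^esub> s) d"
      have q: "?q \<in> {0..1}" "s ?q = d" using unit_bij_mem[OF ic U(2)] unit_bij_inv[OF sc U(2)] by auto
      then have "?q < d" using that diff_unit_less_iff[OF sd q(1) U(2)] by simp
      then have "?q \<le> c" using moved[OF invH[OF s(1)] U(2) fixK(2)] by auto
      then show ?thesis using diff_unit_le_iff[OF sd q(1) U(1)] q(2) by simp
    qed
    ultimately show ?thesis using s by blast
  qed
qed

section \<open>The series of iterated kernels and its nested gaps\<close>

definition kernel_series :: "('a, 'b) monoid_scheme \<Rightarrow> 'a set \<Rightarrow> nat \<Rightarrow> 'a set"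
  where "kernel_series G H i = (real_kernel G ^^ i) H"

lemma kernel_series_0 [simp]: "kernel_series G H 0 = H"
  by (simp add: kernel_series_def)

lemma kernel_series_Suc: "kernel_series G H (Suc i) = real_kernel G (kernel_series G H i)"
  by (simp add: kernel_series_def)

context group
begin

lemma kernel_series_Suc_subset: "kernel_series G H (Suc i) \<subseteq> kernel_series G H i"
  unfolding kernel_series_Suc by (rule real_kernel_subset)

lemma kernel_series_antimono: "i \<le> j \<Longrightarrow> kernel_series G H j \<subseteq> kernel_series G H i"
  by (rule lift_Suc_antimono_le[of "kernel_series G H"]) (rule kernel_series_Suc_subset)

lemma kernel_series_fg:
  assumes "subexponential_group G H" "fg_subgroup G H"
  shows "fg_subgroup G (kernel_series G H i)"
proof (induction i)
  case 0 then show ?case using assms by simp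
next
  case (Suc i)
  have "subexponential_group G (kernel_series G H i)"
    using assms(1) kernel_series_antimono[of 0 i H] by (intro subexponential_group_mono[OF assms(1)]) simp
  then show ?case unfolding kernel_series_Suc using Suc by (rule real_kernel_fg)
qed

lemma kernel_series_subgroup: "subgroup H G \<Longrightarrow> subgroup (kernel_series G H i) G"
  by (induction i) (auto simp: kernel_series_Suc intro: real_kernel_subgroup)

lemma kernel_series_conj:
  assumes H: "subgroup H G" and g: "g \<in> H" and x: "x \<in> kernel_series G H i"
  shows "g \<otimes> x \<otimes> inv g \<in> kernel_series G H i"
  using x
proof (induction i arbitrary: x)
  case 0
  then show ?case using H g by (simp add: subgroup.m_closed subgroup.m_inv_closed)
next
  case (Suc i)
  have "g \<in> carrier G" using H g by (rule subgroup.mem_carrier)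
  then show ?case
    using Suc.prems unfolding kernel_series_Suc
    by (intro real_kernel_conj kernel_series_subgroup H Suc.IH)
qed

lemma kernel_series_conj_inv:
  assumes H: "subgroup H G" and g: "g \<in> H" and x: "x \<in> kernel_series G H i"
  shows "inv g \<otimes> x \<otimes> g \<in> kernel_series G H i"
  using kernel_series_conj[OF H subgroup.m_inv_closed[OF H g] x] subgroup.mem_carrier[OF H g] by simp

lemma kernel_series_cj:
  assumes "subgroup H G" "t \<in> H" "x \<in> kernel_series G H i"
  shows "cj t n x \<in> kernel_series G H i"
  unfolding cj_def using assms by (intro kernel_series_conj subgroup_int_pow_closed)

end

lemma gap_interior_fixed_point:
  assumes K: "K \<subseteq> diff_unit \<alpha>" "fg_subgroup \<B> K" "subexponential_group \<B> K" and gap: "fixed_gap K a b"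
  shows "\<exists>p. a < p \<and> p < b \<and> (\<forall>g\<in>real_kernel \<B> K. g p = p)"
proof -
  obtain S where S: "finite S" "S \<subseteq> K" "\<forall>s\<in>S. inv\<^bsub>\<B>\<^esub> s \<in> S" "K = generate \<B> S"
    using unit_bij.fg_subgroup_symmetric[OF K(2)] by blast
  have Kc: "K \<subseteq> carrier \<B>" using K(1) diff_unit_carrier by blast
  have ab: "0 \<le> a" "a < b" "b \<le> 1" and fixK: "\<And>g. g \<in> K \<Longrightarrow> g a = a \<and> g b = b"
    and nofix: "\<And>x. a < x \<Longrightarrow> x < b \<Longrightarrow> \<exists>h\<in>K. h x \<noteq> x"
    using gap unfolding fixed_gap_def by auto
  have U: "x \<in> {0..1}" if "x \<in> {a<..<b}" for x using that ab by auto
  have "interval_action \<B> (\<lambda>g. g) S K a b ((a + b) / 2)"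
  proof unfold_locales
    show "finite S" by (rule S(1))
    show "S \<subseteq> carrier \<B>" using S(2) Kc by blast
    show "inv\<^bsub>\<B>\<^esub> s \<in> S" if "s \<in> S" for s using S(3) that by blast
    show "K = generate \<B> S" by (rule S(4))
    show "subexponential_group \<B> K" by (rule K(3))
    show "\<one>\<^bsub>\<B>\<^esub> x = x" if "x \<in> {a<..<b}" for x using unit_bij_one U[OF that] by simp
    show "(g \<otimes>\<^bsub>\<B>\<^esub> h) x = g (h x)" if "g \<in> K" "h \<in> K" "x \<in> {a<..<b}" for g h x
      using unit_bij_mult[of g h x] that Kc U by blast
    show less: "g x < g y" if "g \<in> K" "x \<in> {a<..<b}" "y \<in> {a<..<b}" "x < y" for g x y
      using diff_unit_less_iff[of g \<alpha> x y] that K(1) U by blast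
    show "g x \<in> {a<..<b}" if g: "g \<in> K" and x: "x \<in> {a<..<b}" for g x
      using diff_unit_less_iff[of g \<alpha> a x] diff_unit_less_iff[of g \<alpha> x b] fixK[OF g] g K(1) U[OF x] x ab by auto
    show "\<exists>g\<in>K. g x \<noteq> x" if "x \<in> {a<..<b}" for x using nofix that by auto
    show "(a + b) / 2 \<in> {a<..<b}" using ab by (simp add: field_simps)
  qed
  then have "\<exists>p\<in>{a<..<b}. \<forall>g\<in>real_kernel \<B> K. g p = p"
    by (rule interval_action.real_kernel_fixed_point)
  then show ?thesis by auto
qed

text \<open>As \<open>h\<close> lies in every term up to \<open>k\<close> and moves
  \<open>z\<close>, each of these terms has a gap around \<open>z\<close>. Passing to a smaller
  group keeps the fixed points, so the gaps shrink, and strictly so because the next term has a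
  fixed point inside the previous gap.\<close>

lemma nested_gaps:
  assumes \<Gamma>: "\<Gamma> \<subseteq> diff_unit \<alpha>" "fg_subgroup \<B> \<Gamma>" "subexponential_group \<B> \<Gamma>"
    and z: "z \<in> {0..1}" "h \<in> kernel_series \<B> \<Gamma> k" "h z \<noteq> z"
  obtains a b :: "nat \<Rightarrow> real" where
    "\<And>i. i \<le> k \<Longrightarrow> fixed_gap (kernel_series \<B> \<Gamma> i) (a i) (b i)" "a k < z" "z < b k"
    "\<And>i. i < k \<Longrightarrow> a i \<le> a (Suc i) \<and> b (Suc i) \<le> b i \<and> (a (Suc i), b (Suc i)) \<noteq> (a i, b i)"
proof -
  let ?K = "kernel_series \<B> \<Gamma>"
  have sub: "?K i \<subseteq> diff_unit \<alpha>" for i using \<Gamma>(1) unit_bij.kernel_series_antimono[of 0 i \<Gamma>] by auto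
  have "\<exists>a b. i \<le> k \<longrightarrow> fixed_gap (?K i) a b \<and> a < z \<and> z < b" for i
    using fixed_gap_exists[of "?K i" \<alpha> z h] sub[of i] z unit_bij.kernel_series_antimono[of i k \<Gamma>] by blast
  then obtain a b where ab: "\<And>i. i \<le> k \<Longrightarrow> fixed_gap (?K i) (a i) (b i) \<and> a i < z \<and> z < b i" by metis
  have "a i \<le> a (Suc i) \<and> b (Suc i) \<le> b i \<and> (a (Suc i), b (Suc i)) \<noteq> (a i, b i)" if i: "i < k" for i
  proof -
    have g: "fixed_gap (?K i) (a i) (b i)" "a i < z" "z < b i"
      and g': "fixed_gap (?K (Suc i)) (a (Suc i)) (b (Suc i))" "a (Suc i) < z" "z < b (Suc i)"
      using ab[of i] ab[of "Suc i"] i by auto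
    have not_in: "x \<le> a (Suc i) \<or> b (Suc i) \<le> x" if "\<forall>h\<in>?K (Suc i). h x = x" for x
      using g'(1) that unfolding fixed_gap_def by (meson not_le)
    have "\<forall>h\<in>?K (Suc i). h (a i) = a i" "\<forall>h\<in>?K (Suc i). h (b i) = b i"
      using g(1) unit_bij.kernel_series_Suc_subset[of \<Gamma> i] unfolding fixed_gap_def by blast+
    then have 1: "a i \<le> a (Suc i)" "b (Suc i) \<le> b i" using not_in[of "a i"] not_in[of "b i"] g g' by auto
    have "subexponential_group \<B> (?K i)"
      using unit_bij.kernel_series_antimono[of 0 i \<Gamma>] by (intro subexponential_group_mono[OF \<Gamma>(3)]) simp
    then obtain p where p: "a i < p" "p < b i" "\<forall>g\<in>?K (Suc i). g p = p"
      using gap_interior_fixed_point[OF sub unit_bij.kernel_series_fg[OF \<Gamma>(3,2)] _ g(1)]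
      unfolding kernel_series_Suc by blast
    then show ?thesis using 1 not_in[of p] by auto
  qed
  then show thesis using that[of a b] ab by blast
qed

section \<open>Bounded distortion and the end of the series\<close>

lemma unit_bij_pow_Suc:
  assumes "f \<in> carrier \<B>" "x \<in> {0..1}"
  shows "(f [^]\<^bsub>\<B>\<^esub> Suc n) x = f ((f [^]\<^bsub>\<B>\<^esub> n) x)"
  using unit_bij.nat_pow_Suc2[OF assms(1), of n] unit_bij_mult[OF assms(1) unit_bij.nat_pow_closed[OF assms(1)] assms(2)]
  by simp

text \<open>The one-step estimates are multiplied along the orbit of the interval, and the exponents
  add up to the sum of the \<alpha>-th powers of its successive lengths. Boundedness of this sum is
  what has to be secured.\<close>

lemma iterate_distortion:
  assumes fG: "f \<in> diff_unit \<alpha>" and C: "\<And>a b x y. 0 \<le> a \<Longrightarrow> a \<le> x \<Longrightarrow> x < y \<Longrightarrow> y \<le> b \<Longrightarrow> b \<le> 1 \<Longrightarrow>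
      (f b - f a) * (y - x) \<le> exp (C * (b - a) powr \<alpha>) * (f y - f x) * (b - a)"
    and F: "\<And>n. F n \<in> diff_unit \<alpha>" "\<And>n x. x \<in> {0..1} \<Longrightarrow> F (Suc n) x = f (F n x)" "\<And>x. x \<in> {0..1} \<Longrightarrow> F 0 x = x"
    and xy: "0 \<le> a" "a \<le> x" "x < y" "y \<le> b" "b \<le> 1"
  shows "(y - x) * (F n b - F n a) \<le> exp (C * (\<Sum>j<n. (F j b - F j a) powr \<alpha>)) * (F n y - F n x) * (b - a)"
proof (induction n)
  case 0 then show ?case using F(3) xy by (simp add: mult.commute)
next
  case (Suc n)
  have U: "a \<in> {0..1}" "b \<in> {0..1}" "x \<in> {0..1}" "y \<in> {0..1}" using xy by auto
  let ?A = "F n a" and ?B = "F n b" and ?X = "F n x" and ?Y = "F n y"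
  have ord: "0 \<le> ?A" "?A \<le> ?X" "?X < ?Y" "?Y \<le> ?B" "?B \<le> 1" "?A < ?B"
    using diff_unit_le_iff[OF F(1)] diff_unit_less_iff[OF F(1)] U xy unit_bij_mem[OF diff_unit_carrier[OF F(1)] U(1), of n]
      unit_bij_mem[OF diff_unit_carrier[OF F(1)] U(2), of n] by auto
  define E where "E = exp (C * (\<Sum>j<n. (F j b - F j a) powr \<alpha>))"
  define e where "e = exp (C * (?B - ?A) powr \<alpha>)"
  have step: "(f ?B - f ?A) * (?Y - ?X) \<le> e * (f ?Y - f ?X) * (?B - ?A)"
    unfolding e_def by (rule C[OF ord(1-5)])
  have incr: "0 \<le> f ?B - f ?A"
    using diff_unit_less_iff[OF F(1) U(1,2), of "Suc n"] F(2)[OF U(1)] F(2)[OF U(2)] xy by simp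
  have "(y - x) * (f ?B - f ?A) * (?B - ?A) = ((y - x) * (?B - ?A)) * (f ?B - f ?A)" by simp
  also have "\<dots> \<le> (E * (?Y - ?X) * (b - a)) * (f ?B - f ?A)"
    using Suc incr unfolding E_def by (rule mult_right_mono)
  also have "\<dots> = E * (b - a) * ((f ?B - f ?A) * (?Y - ?X))" by simp
  also have "\<dots> \<le> E * (b - a) * (e * (f ?Y - f ?X) * (?B - ?A))"
    using step xy unfolding E_def by (intro mult_left_mono) auto
  also have "\<dots> = (E * e * (f ?Y - f ?X) * (b - a)) * (?B - ?A)" by simp
  finally have "(y - x) * (f ?B - f ?A) \<le> E * e * (f ?Y - f ?X) * (b - a)"
    using ord(6) by (simp add: mult_le_cancel_right)
  moreover have "E * e = exp (C * (\<Sum>j<Suc n. (F j b - F j a) powr \<alpha>))"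
    unfolding E_def e_def by (simp add: exp_add distrib_left)
  ultimately show ?case using F(2) U by simp
qed

text \<open>The conjugated word is a composition of conjugates of \<open>h\<close>, or identities,
  with consecutive exponents. All of them preserve the interval, so the displacements simply add up
  and no Lipschitz constants enter.\<close>

lemma conj_word_displacement:
  assumes N: "subgroup N \<B>" "N \<subseteq> diff_unit \<alpha>" and th: "t \<in> carrier \<B>" "h \<in> carrier \<B>"
    and mem: "\<And>i. unit_bij.cj t i h \<in> N"
    and ends: "0 \<le> a" "a \<le> b" "b \<le> 1" "\<And>g. g \<in> N \<Longrightarrow> g a = a \<and> g b = b"
    and disp: "\<And>i x. 1 \<le> i \<Longrightarrow> x \<in> {a..b} \<Longrightarrow> \<bar>unit_bij.cj t (int i) h x - x\<bar> \<le> e i"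
    and e: "\<And>i. 0 \<le> e i" and j: "1 \<le> j" and x: "x \<in> {a..b}"
  shows "\<bar>unit_bij.cj t (int j) (unit_bij.conj_word t h bs) x - x\<bar> \<le> (\<Sum>i<length bs. e (j + i))"
  using j
proof (induction bs arbitrary: j)
  case Nil
  then show ?case using x ends th by (simp add: unit_bij_one)
next
  case (Cons c bs)
  let ?V = "unit_bij.cj t (int (Suc j)) (unit_bij.conj_word t h bs)"
  let ?u = "unit_bij.cj t (int j) (if c then h else \<one>\<^bsub>\<B>\<^esub>)"
  have VN: "?V \<in> N" by (intro unit_bij.cj_conj_word_in_subgroup N th mem)
  then have Vc: "?V \<in> carrier \<B>" using N(1) by (metis subgroup.mem_carrier)
  have uN: "?u \<in> N" using mem subgroup.one_closed[OF N(1)] th by auto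
  then have uc: "?u \<in> carrier \<B>" using N(1) by (metis subgroup.mem_carrier)
  have U: "a \<in> {0..1}" "b \<in> {0..1}" "x \<in> {0..1}" using ends x by auto
  have y: "?V x \<in> {a..b}"
    using diff_unit_le_iff[of ?V \<alpha> a x] diff_unit_le_iff[of ?V \<alpha> x b] VN N(2) ends(4)[OF VN] U x by auto
  have "unit_bij.cj t (int j) (unit_bij.conj_word t h (c # bs)) = ?u \<otimes>\<^bsub>\<B>\<^esub> ?V"
    using th by (simp only: unit_bij.conj_word.simps unit_bij.cj_1[symmetric])
      (auto simp: unit_bij.cj_mult unit_bij.cj_add add.commute)
  then have eq: "unit_bij.cj t (int j) (unit_bij.conj_word t h (c # bs)) x = ?u (?V x)"
    using unit_bij_mult[OF uc Vc U(3)] by simp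
  have "\<bar>?u (?V x) - ?V x\<bar> \<le> e j"
    using disp[OF Cons.prems y] e[of j] y U ends th by (cases c) (auto simp: unit_bij_one)
  moreover have "\<bar>?V x - x\<bar> \<le> (\<Sum>i<length bs. e (Suc j + i))" using Cons.IH[of "Suc j"] by simp
  moreover have "(\<Sum>i<length (c # bs). e (j + i)) = e j + (\<Sum>i<length bs. e (Suc j + i))"
    by (simp add: sum.lessThan_Suc_shift del: sum.lessThan_Suc)
  ultimately show ?case unfolding eq by linarith
qed

text \<open>A generator may throw the gap to the left; its inverse then throws it to the
  right.\<close>

lemma gap_escape:
  assumes \<Gamma>: "\<Gamma> \<subseteq> diff_unit \<alpha>" "fg_subgroup \<B> \<Gamma>"
    and K: "K \<subseteq> carrier \<B>" "\<And>h k. h \<in> \<Gamma> \<Longrightarrow> k \<in> K \<Longrightarrow> inv\<^bsub>\<B>\<^esub> h \<otimes>\<^bsub>\<B>\<^esub> k \<otimes>\<^bsub>\<B>\<^esub> h \<in> K"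
    and gaps: "fixed_gap \<Gamma> a b" "fixed_gap K c d" "a \<le> c" "d \<le> b" "(c, d) \<noteq> (a, b)"
  shows "\<exists>f\<in>\<Gamma>. d \<le> f c"
proof -
  obtain S where S: "finite S" "S \<subseteq> \<Gamma>" "\<forall>s\<in>S. inv\<^bsub>\<B>\<^esub> s \<in> S" "\<Gamma> = generate \<B> S"
    using unit_bij.fg_subgroup_symmetric[OF \<Gamma>(2)] by blast
  have Sd: "S \<subseteq> diff_unit \<alpha>" using S(2) \<Gamma>(1) by blast
  obtain s where s: "s \<in> S" "d \<le> s c \<or> s d \<le> c"
    using inner_gap_displaced[OF Sd S(4) K gaps] by blast
  show ?thesis
  proof (cases "d \<le> s c")
    case True then show ?thesis using s S(2) by blast
  next
    case False
    then have le: "s d \<le> c" using s(2) by blast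
    have i: "inv\<^bsub>\<B>\<^esub> s \<in> \<Gamma>" using S s(1) by blast
    have sc: "s \<in> carrier \<B>" using Sd s(1) diff_unit_carrier by blast
    have U: "c \<in> {0..1}" "d \<in> {0..1}" using gaps(2) by (auto simp: fixed_gap_def)
    have "(inv\<^bsub>\<B>\<^esub> s) (s d) \<le> (inv\<^bsub>\<B>\<^esub> s) c"
      using diff_unit_le_iff[of "inv\<^bsub>\<B>\<^esub> s" \<alpha> "s d" c] i \<Gamma>(1) le U unit_bij_mem[OF sc U(2)] by blast
    then show ?thesis using i unit_bij_inv(1)[OF sc U(2)] by auto
  qed
qed

text \<open>A generator that throws the inner gap off itself moves one of its endpoints by at least
  the length of that gap, while it fixes the ends of the outer gap.\<close>

lemma inner_gap_size:
  assumes S: "S \<subseteq> diff_unit \<alpha>" and HS: "H = generate \<B> S" and K: "K \<subseteq> carrier \<B>"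
    and normal: "\<And>h k. h \<in> H \<Longrightarrow> k \<in> K \<Longrightarrow> inv\<^bsub>\<B>\<^esub> h \<otimes>\<^bsub>\<B>\<^esub> k \<otimes>\<^bsub>\<B>\<^esub> h \<in> K"
    and gaps: "fixed_gap H a b" "fixed_gap K c d" "a \<le> c" "d \<le> b" "(c, d) \<noteq> (a, b)"
    and C: "\<And>s. s \<in> S \<Longrightarrow> displacement_const \<alpha> s C"
  shows "d - c \<le> C * (b - a) powr (1 + \<alpha>)"
proof -
  obtain s where s: "s \<in> S" "d \<le> s c \<or> s d \<le> c"
    using inner_gap_displaced[OF S HS K normal gaps] by blast
  have "s \<in> H" unfolding HS using s(1) by (rule generate.incl)
  then have ab: "s a = a" "s b = b" "0 \<le> a" "b \<le> 1" using gaps(1) by (auto simp: fixed_gap_def)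
  have cd: "c < d" using gaps(2) by (simp add: fixed_gap_def)
  have "\<bar>s x - x\<bar> \<le> C * (b - a) powr (1 + \<alpha>)" if "a \<le> x" "x \<le> b" for x
    using C[OF s(1)] that ab unfolding displacement_const_def by blast
  from this[of c] this[of d] show ?thesis using s(2) gaps(3,4) cd by auto
qed

lemma powr_iterate_bound:
  fixes L :: "nat \<Rightarrow> nat \<Rightarrow> real"
  assumes \<alpha>: "\<alpha> > 0" and L0: "\<And>i n. 0 \<le> L i n" and C: "\<And>i. 0 \<le> C i"
    and step: "\<And>i n. 1 \<le> i \<Longrightarrow> i < k \<Longrightarrow> L (Suc i) n \<le> C i * L i n powr (1 + \<alpha>)"
    and i: "1 \<le> i" "i \<le> k"
  shows "\<exists>E\<ge>0. \<forall>n. L i n \<le> E * L 1 n powr ((1 + \<alpha>) ^ (i - 1))"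
  using i
proof (induction i rule: dec_induct)
  case base
  then show ?case using L0 by (intro exI[of _ 1]) (auto simp: powr_one_gt_zero_iff le_less)
next
  case (step i)
  then obtain E where E: "E \<ge> 0" "\<And>n. L i n \<le> E * L 1 n powr ((1 + \<alpha>) ^ (i - 1))" by auto
  have "L (Suc i) n \<le> (C i * E powr (1 + \<alpha>)) * L 1 n powr ((1 + \<alpha>) ^ (Suc i - 1))" for n
  proof -
    have "L (Suc i) n \<le> C i * L i n powr (1 + \<alpha>)" using assms(4) step by simp
    also have "\<dots> \<le> C i * (E * L 1 n powr ((1 + \<alpha>) ^ (i - 1))) powr (1 + \<alpha>)"
      using C L0 E \<alpha> by (intro mult_left_mono powr_mono2) auto
    also have "\<dots> = (C i * E powr (1 + \<alpha>)) * L 1 n powr ((1 + \<alpha>) ^ (i - 1) * (1 + \<alpha>))"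
      using E by (simp add: powr_mult powr_powr)
    also have "(1 + \<alpha>) ^ (i - 1) * (1 + \<alpha>) = (1 + \<alpha>) ^ (Suc i - 1)"
      using step(1) by (simp flip: power_Suc2)
    finally show ?thesis .
  qed
  then show ?case using C E(1) by (intro exI[of _ "C i * E powr (1 + \<alpha>)"]) auto
qed

text \<open>Suppose \<open>h\<close> in the \<open>k\<close>-th term moves \<open>z\<close>, and let
  \<open>f\<close> push the gap of the first term off itself. Disjointness of the images makes the
  \<alpha>-th powers of the lengths of the images of the \<open>k\<close>-th gap summable, which
  gives \<open>f\<close> bounded distortion there. Conjugating \<open>h\<close> back by the
  \<open>n\<close>-th iterate then yields a displacement of order \<open>s n\<close>; the
  coincidence for a high power of \<open>f\<close> expresses \<open>h\<close> through such
  conjugates, so its displacement is bounded by an arbitrarily late tail of a convergent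
  series.\<close>

lemma kernel_series_trivial:
  assumes \<alpha>: "\<alpha> > 0" and \<Gamma>: "\<Gamma> \<subseteq> diff_unit \<alpha>" "fg_subgroup \<B> \<Gamma>" "subexponential_group \<B> \<Gamma>"
    and k: "1 \<le> k" "1 \<le> \<alpha> * (1 + \<alpha>) ^ (k - 1)"
  shows "kernel_series \<B> \<Gamma> k = {\<one>\<^bsub>\<B>\<^esub>}"
proof (rule ccontr)
  let ?K = "kernel_series \<B> \<Gamma>"
  assume "?K k \<noteq> {\<one>\<^bsub>\<B>\<^esub>}"
  have \<Gamma>g: "subgroup \<Gamma> \<B>" using \<Gamma>(2) by (rule unit_bij.fg_subgroup_is_subgroup)
  have Kg: "subgroup (?K i) \<B>" for i using \<Gamma>g by (rule unit_bij.kernel_series_subgroup)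
  have K\<Gamma>: "?K i \<subseteq> \<Gamma>" for i using unit_bij.kernel_series_antimono[of 0 i \<Gamma>] by simp
  have Kd: "?K i \<subseteq> diff_unit \<alpha>" for i using K\<Gamma> \<Gamma>(1) by blast
  have Kc: "?K i \<subseteq> carrier \<B>" for i using Kg by (rule subgroup.subset)
  have "\<one>\<^bsub>\<B>\<^esub> \<in> ?K k" using Kg by (rule subgroup.one_closed)
  then obtain h where h: "h \<in> ?K k" "h \<noteq> \<one>\<^bsub>\<B>\<^esub>" using \<open>?K k \<noteq> {\<one>\<^bsub>\<B>\<^esub>}\<close> by blast
  have hc: "h \<in> carrier \<B>" using h(1) Kc by blast
  obtain z where z: "z \<in> {0..1}" "h z \<noteq> z" using unit_bij_eq_one[OF hc] h(2) by blast
  obtain a b :: "nat \<Rightarrow> real" where gap: "\<And>i. i \<le> k \<Longrightarrow> fixed_gap (?K i) (a i) (b i)"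
    and zab: "a k < z" "z < b k"
    and nest: "\<And>i. i < k \<Longrightarrow> a i \<le> a (Suc i) \<and> b (Suc i) \<le> b i \<and> (a (Suc i), b (Suc i)) \<noteq> (a i, b i)"
    using nested_gaps[OF \<Gamma> z(1) h(1) z(2)] by blast
  have U: "a i \<in> {0..1}" "b i \<in> {0..1}" "a i < b i" if "i \<le> k" for i
    using gap[OF that] by (auto simp: fixed_gap_def)
  have conj_inv: "inv\<^bsub>\<B>\<^esub> g \<otimes>\<^bsub>\<B>\<^esub> x \<otimes>\<^bsub>\<B>\<^esub> g \<in> ?K i" if "g \<in> \<Gamma>" "x \<in> ?K i" for g x i
    using unit_bij.kernel_series_conj_inv[OF \<Gamma>g that] .
  obtain f where f: "f \<in> \<Gamma>" "b 1 \<le> f (a 1)"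
    using gap_escape[OF \<Gamma>(1,2) Kc[of 1] conj_inv, of "a 0" "b 0" "a 1" "b 1"] gap[of 0] gap[of 1] nest[of 0] k(1)
    by auto
  have fd: "f \<in> diff_unit \<alpha>" and fc: "f \<in> carrier \<B>" using f \<Gamma>(1) diff_unit_carrier by blast+
  define F where "F n = f [^]\<^bsub>\<B>\<^esub> (n::nat)" for n
  have F\<Gamma>: "F n \<in> \<Gamma>" for n
    unfolding F_def using unit_bij.subgroup_int_pow_closed[OF \<Gamma>g f(1), of "int n"] by (simp add: int_pow_int)
  have Fd: "F n \<in> diff_unit \<alpha>" and Fc: "F n \<in> carrier \<B>" for n using F\<Gamma> \<Gamma>(1) diff_unit_carrier by blast+
  have F0: "F 0 x = x" if "x \<in> {0..1}" for x unfolding F_def using that by (simp add: unit_bij_one)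
  have FSuc: "F (Suc n) x = f (F n x)" if "x \<in> {0..1}" for n x unfolding F_def using unit_bij_pow_Suc[OF fc that] .
  have FSuc': "F (Suc n) x = F n (f x)" if "x \<in> {0..1}" for n x
    unfolding F_def using unit_bij_mult[OF unit_bij.nat_pow_closed[OF fc, of n] fc that] by simp
  have FU: "F n x \<in> {0..1}" if "x \<in> {0..1}" for n x using unit_bij_mem[OF Fc that] .
  have Fgap: "fixed_gap (?K i) (F n (a i)) (F n (b i))" if "i \<le> k" for i n
    using fixed_gap_image[OF Fd Kc gap[OF that]] unit_bij.kernel_series_conj[OF \<Gamma>g F\<Gamma>] conj_inv[OF F\<Gamma>] by blast
  \<comment> \<open>The length of the \<open>n\<close>-th image of the \<open>i\<close>-th gap. The
    value 0 beyond \<open>k\<close>, where no gap is given, makes nonnegativity hold for all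
    indices.\<close>
  define L where "L i n = (if i \<le> k then F n (b i) - F n (a i) else 0)" for i n
  have Lpos: "0 < L i n" if "i \<le> k" for i n
    using diff_unit_less_iff[OF Fd U(1,2)[OF that], of n] U(3)[OF that] that unfolding L_def by simp
  have L0: "0 \<le> L i n" for i n using Lpos[of i n] by (cases "i \<le> k") (auto simp: L_def)
  have "\<exists>C\<ge>0. \<forall>n. i < k \<longrightarrow> L (Suc i) n \<le> C * L i n powr (1 + \<alpha>)" for i
  proof (cases "i < k")
    case True
    obtain S where S: "finite S" "S \<subseteq> ?K i" "\<forall>s\<in>S. inv\<^bsub>\<B>\<^esub> s \<in> S" "?K i = generate \<B> S"
      using unit_bij.fg_subgroup_symmetric[OF unit_bij.kernel_series_fg[OF \<Gamma>(3,2), of i]] by (elim exE conjE)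
    have Sd: "S \<subseteq> diff_unit \<alpha>" using S(2) Kd by blast
    obtain C where C: "0 \<le> C" "\<And>s. s \<in> S \<Longrightarrow> displacement_const \<alpha> s C"
      using displacement_const_finite[OF S(1) Sd \<alpha>] by blast
    have "L (Suc i) n \<le> C * L i n powr (1 + \<alpha>)" for n
    proof -
      have i: "i \<le> k" "Suc i \<le> k" using True by auto
      have ne: "a i \<le> a (Suc i)" "b (Suc i) \<le> b i" "a (Suc i) \<noteq> a i \<or> b (Suc i) \<noteq> b i"
        using nest[OF True] by auto
      have le: "F n (a i) \<le> F n (a (Suc i))" "F n (b (Suc i)) \<le> F n (b i)"
        unfolding diff_unit_le_iff[OF Fd U(1)[OF i(1)] U(1)[OF i(2)], of n]
          diff_unit_le_iff[OF Fd U(2)[OF i(2)] U(2)[OF i(1)], of n] by (fact ne)+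
      have neq: "(F n (a (Suc i)), F n (b (Suc i))) \<noteq> (F n (a i), F n (b i))"
      proof (cases "a (Suc i) = a i")
        case True
        then have "F n (b (Suc i)) < F n (b i)"
          using ne diff_unit_less_iff[OF Fd U(2)[OF i(2)] U(2)[OF i(1)], of n] by simp
        then show ?thesis by simp
      next
        case False
        then have "F n (a i) < F n (a (Suc i))"
          using ne diff_unit_less_iff[OF Fd U(1)[OF i(1)] U(1)[OF i(2)], of n] by simp
        then show ?thesis by simp
      qed
      have "F n (b (Suc i)) - F n (a (Suc i)) \<le> C * (F n (b i) - F n (a i)) powr (1 + \<alpha>)"
        by (rule inner_gap_size[OF Sd S(4) Kc conj_inv Fgap[OF i(1)] Fgap[OF i(2)] le neq C(2)])
           (use K\<Gamma> in auto)
      then show ?thesis unfolding L_def using i by simp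
    qed
    then show ?thesis using C(1) by blast
  qed auto
  then obtain C where C: "\<And>i. 0 \<le> C i" "\<And>i n. i < k \<Longrightarrow> L (Suc i) n \<le> C i * L i n powr (1 + \<alpha>)" by metis
  obtain E where E: "E \<ge> 0" "\<And>n. L k n \<le> E * L 1 n powr ((1 + \<alpha>) ^ (k - 1))"
    using powr_iterate_bound[where L = L and C = C and k = k and i = k, OF \<alpha> L0 C(1)] C(2) k(1) by auto
  define s where "s n = L k n powr \<alpha>" for n
  have s0: "0 \<le> s n" for n unfolding s_def by simp
  have L1: "L 1 n \<le> 1" for n
    using FU[OF U(1)[of 1], of n] FU[OF U(2)[of 1], of n] k(1) unfolding L_def by auto
  \<comment> \<open>The exponent \<alpha> (1 + \<alpha>)^(k - 1) is at least 1 and the lengths are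
    at most 1, so the exponent may be lowered to 1. This decides how large \<open>k\<close> has to
    be.\<close>
  have s_le: "s n \<le> E powr \<alpha> * L 1 n" for n
  proof -
    have "s n \<le> (E * L 1 n powr ((1 + \<alpha>) ^ (k - 1))) powr \<alpha>"
      unfolding s_def using E(2) L0 \<alpha> by (intro powr_mono2) auto
    also have "\<dots> = E powr \<alpha> * L 1 n powr (\<alpha> * (1 + \<alpha>) ^ (k - 1))"
      using E(1) by (simp add: powr_mult powr_powr mult.commute)
    also have "\<dots> \<le> E powr \<alpha> * L 1 n powr 1"
      using k(2) L0 L1 by (intro mult_left_mono powr_mono') auto
    finally show ?thesis using L0 by simp
  qed
  \<comment> \<open>Since \<open>b 1 \<le> f (a 1)\<close>, the images of the gap follow one another
    from left to right without overlapping, and their total length is at most the distance covered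
    by the left endpoint.\<close>
  have sumL: "(\<Sum>n<m. L 1 n) \<le> F m (a 1) - a 1" for m
  proof (induction m)
    case 0 then show ?case using F0 U k(1) by simp
  next
    case (Suc m)
    have "F m (b 1) \<le> F m (f (a 1))"
      using f(2) diff_unit_le_iff[OF Fd U(2)] unit_bij_mem[OF fc U(1)] k(1) by blast
    then have "F m (b 1) \<le> F (Suc m) (a 1)" using FSuc' U(1)[of 1] k(1) by simp
    then show ?case using Suc k(1) unfolding L_def by simp
  qed
  have "summable s"
  proof (rule summableI_nonneg_bounded[OF s0])
    fix m
    have "sum s {..<m} \<le> (\<Sum>n<m. E powr \<alpha> * L 1 n)" by (intro sum_mono s_le)
    also have "\<dots> \<le> E powr \<alpha> * 1"
      using sumL[of m] FU[OF U(1)[of 1], of m] U(1)[of 1] k(1) unfolding sum_distrib_left[symmetric]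
      by (intro mult_left_mono) auto
    finally show "sum s {..<m} \<le> E powr \<alpha> * 1" .
  qed
  obtain Cf where Cf: "0 \<le> Cf" "\<And>a b x y. 0 \<le> a \<Longrightarrow> a \<le> x \<Longrightarrow> x < y \<Longrightarrow> y \<le> b \<Longrightarrow> b \<le> 1 \<Longrightarrow>
      (f b - f a) * (y - x) \<le> exp (Cf * (b - a) powr \<alpha>) * (f y - f x) * (b - a)"
    using slope_distortion[OF fd \<alpha>] by blast
  define A where "A = exp (Cf * suminf s)"
  have dist: "(y - x) * L k n \<le> A * (F n y - F n x) * L k 0"
    if xy: "a k \<le> x" "x < y" "y \<le> b k" for x y n
  proof -
    have xyU: "x \<in> {0..1}" "y \<in> {0..1}" using xy U[of k] by auto
    have "(y - x) * (F n (b k) - F n (a k)) \<le>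
        exp (Cf * (\<Sum>j<n. (F j (b k) - F j (a k)) powr \<alpha>)) * (F n y - F n x) * (b k - a k)"
      by (rule iterate_distortion[OF fd Cf(2) Fd FSuc F0]) (use xy U[of k] in auto)
    then have "(y - x) * L k n \<le> exp (Cf * (\<Sum>j<n. s j)) * (F n y - F n x) * L k 0"
      unfolding L_def s_def using F0 U(1,2)[of k] by simp
    also have "\<dots> \<le> A * (F n y - F n x) * L k 0"
      unfolding A_def using diff_unit_less_iff[OF Fd xyU, of n] xy(2) L0 Cf(1) sum_le_suminf[OF \<open>summable s\<close>, of "{..<n}"] s0
      by (intro mult_right_mono) (auto intro!: mult_left_mono)
    finally show ?thesis .
  qed
  obtain Ch where Ch: "displacement_const \<alpha> h Ch" using displacement_const_exists h(1) Kd \<alpha> by blast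
  define Q where "Q = A * Ch * L k 0"
  have Q0: "0 \<le> Q" unfolding Q_def A_def using Ch L0 by (simp add: displacement_const_def)
  \<comment> \<open>The iterate \<open>F n\<close> conjugates \<open>w\<close> to \<open>h\<close>,
    so in the \<open>n\<close>-th image the displacement is at most a constant times
    \<open>L k n powr (1 + \<alpha>)\<close>. Bounded distortion carries this back at the price of
    dividing by \<open>L k n\<close>, and \<open>s n\<close> remains.\<close>
  have conj_disp: "\<bar>unit_bij.cj f (- int n) h x - x\<bar> \<le> Q * s n" if x: "x \<in> {a k..b k}" for n x
  proof -
    define w where "w = unit_bij.cj f (- int n) h"
    have w: "w \<in> ?K k" unfolding w_def using unit_bij.kernel_series_cj[OF \<Gamma>g f(1) h(1)] .
    then have wd: "w \<in> diff_unit \<alpha>" and wc: "w \<in> carrier \<B>" using Kd Kc by blast+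
    have wab: "w (a k) = a k" "w (b k) = b k" using w gap[of k] by (auto simp: fixed_gap_def)
    have xU: "x \<in> {0..1}" using x U[of k] by auto
    have wx: "w x \<in> {a k..b k}"
      using diff_unit_le_iff[OF wd U(1)[of k] xU] diff_unit_le_iff[OF wd xU U(2)[of k]] wab x by auto
    have wxU: "w x \<in> {0..1}" using unit_bij_mem[OF wc xU] .
    have "F n \<otimes>\<^bsub>\<B>\<^esub> w = h \<otimes>\<^bsub>\<B>\<^esub> F n"
      unfolding w_def unit_bij.cj_def F_def using fc hc
      by (simp add: unit_bij.int_pow_neg int_pow_int unit_bij.group_word_simps)
    then have Fw: "F n (w x) = h (F n x)"
      using unit_bij_mult[OF Fc wc xU] unit_bij_mult[OF hc Fc xU] by metis
    have FX: "F n (a k) \<le> F n x" "F n x \<le> F n (b k)"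
      using diff_unit_le_iff[OF Fd] U(1,2)[of k] x xU by auto
    have hF: "h (F n (a k)) = F n (a k)" "h (F n (b k)) = F n (b k)" "0 \<le> F n (a k)" "F n (b k) \<le> 1"
      using Fgap[of k n] h(1) by (auto simp: fixed_gap_def)
    have "\<bar>h (F n x) - F n x\<bar> \<le> Ch * (F n (b k) - F n (a k)) powr (1 + \<alpha>)"
      using Ch FX hF unfolding displacement_const_def by blast
    then have hd: "\<bar>F n (w x) - F n x\<bar> \<le> Ch * (L k n powr (1 + \<alpha>))" unfolding Fw L_def by simp
    have "\<bar>w x - x\<bar> * L k n \<le> A * \<bar>F n (w x) - F n x\<bar> * L k 0"
    proof (cases x "w x" rule: linorder_cases)
      case less
      then show ?thesis using dist[of x "w x" n] x wx diff_unit_less_iff[OF Fd xU wxU, of n] by simp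
    next
      case greater
      then show ?thesis using dist[of "w x" x n] x wx diff_unit_less_iff[OF Fd wxU xU, of n] by (simp add: abs_if)
    qed simp
    also have "\<dots> \<le> A * (Ch * (L k n powr (1 + \<alpha>))) * L k 0"
      using hd L0 unfolding A_def by (intro mult_right_mono mult_left_mono) auto
    also have "\<dots> = (Q * s n) * L k n"
      using Lpos[of k n] unfolding Q_def s_def by (simp add: powr_add)
    finally show ?thesis unfolding w_def using Lpos[of k n] by (simp add: mult_le_cancel_right)
  qed
  have small: "\<bar>h z - z\<bar> \<le> 2 * Q * (\<Sum>l. s (l + m))" if m: "1 \<le> m" for m
  proof -
    \<comment> \<open>The conjugates of \<open>h\<close> by negative powers of \<open>f\<close> are
      small, whereas the coincidence uses positive powers of \<open>t\<close>; hence the inverse.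
      Taking the \<open>m\<close>-th iterate makes all exponents at least \<open>m\<close> in
      absolute value.\<close>
    define t where "t = inv\<^bsub>\<B>\<^esub> (F m)"
    have t\<Gamma>: "t \<in> \<Gamma>" unfolding t_def using F\<Gamma> by (rule subgroup.m_inv_closed[OF \<Gamma>g])
    then have tc: "t \<in> carrier \<B>" using \<Gamma>g by (metis subgroup.mem_carrier)
    have tf: "t = f [^]\<^bsub>\<B>\<^esub> (- int m)" unfolding t_def F_def using fc by (simp add: unit_bij.int_pow_neg int_pow_int)
    have cjt: "unit_bij.cj t (int i) h = unit_bij.cj f (- int (m * i)) h" for i
      unfolding unit_bij.cj_def tf using fc by (simp add: unit_bij.int_pow_pow)
    obtain bs bs' where hW: "h = t \<otimes>\<^bsub>\<B>\<^esub> (unit_bij.conj_word t h bs \<otimes>\<^bsub>\<B>\<^esub> inv\<^bsub>\<B>\<^esub> (unit_bij.conj_word t h bs')) \<otimes>\<^bsub>\<B>\<^esub> inv\<^bsub>\<B>\<^esub> t"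
      using unit_bij.conj_word_coincidence[OF \<Gamma>(3) subgroup.subset[OF \<Gamma>g] t\<Gamma> _ hc]
        subgroup.m_closed[OF \<Gamma>g _ t\<Gamma>, of h] h(1) K\<Gamma> by blast
    let ?P = "\<lambda>bs. unit_bij.cj t 1 (unit_bij.conj_word t h bs)"
    have cjK: "unit_bij.cj t i h \<in> ?K k" for i using unit_bij.kernel_series_cj[OF \<Gamma>g t\<Gamma> h(1)] .
    have PK: "?P bs \<in> ?K k" for bs by (rule unit_bij.cj_conj_word_in_subgroup[OF Kg tc hc cjK])
    have Pc: "?P bs \<in> carrier \<B>" for bs using PK Kc by blast
    \<comment> \<open>The indices \<open>m * (1 + i)\<close> are distinct and not below
      \<open>m\<close>, so the sum over them is part of the tail. The bound is independent of
      \<open>n\<close>, which is essential because nothing controls the lengths of the coinciding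
      words as \<open>m\<close> varies.\<close>
    have T: "(\<Sum>i<n. s (m * (1 + i))) \<le> (\<Sum>l. s (l + m))" for n
    proof -
      have "(\<Sum>i<n. s (m * (1 + i))) = (\<Sum>l\<in>(\<lambda>i. m * i) ` {..<n}. s (l + m))"
        using m by (subst sum.reindex) (auto simp: inj_on_def add.commute)
      also have "\<dots> \<le> (\<Sum>l. s (l + m))"
        using \<open>summable s\<close> s0 by (intro sum_le_suminf) (auto simp: summable_iff_shift)
      finally show ?thesis .
    qed
    have Pdisp: "\<bar>?P bs x - x\<bar> \<le> Q * (\<Sum>l. s (l + m))" if x: "x \<in> {a k..b k}" for bs x
    proof -
      have "\<bar>unit_bij.cj t (int 1) (unit_bij.conj_word t h bs) x - x\<bar> \<le> (\<Sum>i<length bs. Q * s (m * (1 + i)))"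
      proof (rule conj_word_displacement[OF Kg Kd tc hc cjK])
        show "\<bar>unit_bij.cj t (int i) h y - y\<bar> \<le> Q * s (m * i)" if "y \<in> {a k..b k}" for i y
          unfolding cjt using conj_disp[OF that] .
      qed (use U[of k] gap[of k] Q0 s0 x in \<open>auto simp: fixed_gap_def\<close>)
      also have "\<dots> \<le> Q * (\<Sum>l. s (l + m))"
        unfolding sum_distrib_left[symmetric] using T Q0 by (intro mult_left_mono) auto
      finally show ?thesis by simp
    qed
    have zU: "z \<in> {a k..b k}" using zab by simp
    define y where "y = (inv\<^bsub>\<B>\<^esub> (?P bs')) z"
    have iK: "inv\<^bsub>\<B>\<^esub> (?P bs') \<in> ?K k" using PK by (rule subgroup.m_inv_closed[OF Kg])
    then have id: "inv\<^bsub>\<B>\<^esub> (?P bs') \<in> diff_unit \<alpha>" using Kd by blast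
    have "(inv\<^bsub>\<B>\<^esub> (?P bs')) (a k) = a k" "(inv\<^bsub>\<B>\<^esub> (?P bs')) (b k) = b k"
      using iK gap[of k] by (auto simp: fixed_gap_def)
    then have y: "y \<in> {a k..b k}"
      using diff_unit_le_iff[OF id U(1)[of k] z(1)] diff_unit_le_iff[OF id z(1) U(2)[of k]] zU
      unfolding y_def by auto
    have "h = ?P bs \<otimes>\<^bsub>\<B>\<^esub> inv\<^bsub>\<B>\<^esub> (?P bs')"
      by (subst hW) (use tc hc in \<open>simp add: unit_bij.cj_1 unit_bij.group_word_simps\<close>)
    then have "h z = ?P bs y"
      unfolding y_def using unit_bij_mult[OF Pc unit_bij.inv_closed[OF Pc] z(1)] by metis
    moreover have "?P bs' y = z" unfolding y_def using unit_bij_inv(2)[OF Pc z(1)] .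
    ultimately show ?thesis using Pdisp[OF y, of bs] Pdisp[OF y, of bs'] by linarith
  qed
  \<comment> \<open>The summand 1 keeps the denominator positive when \<open>Q\<close> is 0 and
    makes the final comparison strict.\<close>
  define \<epsilon> where "\<epsilon> = \<bar>h z - z\<bar> / (2 * Q + 1)"
  have \<epsilon>: "\<epsilon> > 0" unfolding \<epsilon>_def using z(2) Q0 by simp
  obtain M where M: "\<And>m. m \<ge> M \<Longrightarrow> norm (\<Sum>l. s (l + m)) < \<epsilon>"
    using suminf_exist_split[OF \<epsilon> \<open>summable s\<close>] by blast
  have "\<bar>h z - z\<bar> \<le> 2 * Q * (\<Sum>l. s (l + Suc M))" by (rule small) simp
  also have "\<dots> \<le> 2 * Q * \<epsilon>" using M[of "Suc M"] Q0 by (intro mult_left_mono) auto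
  also have "\<dots> < (2 * Q + 1) * \<epsilon>" using \<epsilon> by (simp add: distrib_right)
  also have "\<dots> = \<bar>h z - z\<bar>" unfolding \<epsilon>_def using Q0 by simp
  finally show False by simp
qed

section \<open>Polynomial distortion\<close>

text \<open>Monotonicity is included so that radii may be enlarged and bounds composed;
  \<open>n + 1\<close> keeps the bound from vanishing at 0 when the exponent is positive.\<close>

definition poly_bound :: "(nat \<Rightarrow> nat) \<Rightarrow> bool"
  where "poly_bound q \<longleftrightarrow> mono q \<and> (\<exists>C k. \<forall>n. q n \<le> C * (n + 1) ^ k)"

lemma poly_bound_mono: "poly_bound q \<Longrightarrow> m \<le> n \<Longrightarrow> q m \<le> q n"
  by (auto simp: poly_bound_def mono_def)

lemma poly_bound_const [intro]: "poly_bound (\<lambda>_. c)"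
proof -
  have "c \<le> c * (n + 1) ^ 0" for n :: nat by simp
  then show ?thesis unfolding poly_bound_def mono_def by blast
qed

lemma poly_bound_id [intro]: "poly_bound (\<lambda>n. n)"
  unfolding poly_bound_def by (auto simp: mono_def intro!: exI[of _ 1] exI[of _ 1])

lemma poly_bound_Suc [intro]: "poly_bound Suc"
  unfolding poly_bound_def by (auto simp: mono_def intro!: exI[of _ 1] exI[of _ 1])

lemma poly_bound_add [intro]:
  assumes "poly_bound p" "poly_bound q"
  shows "poly_bound (\<lambda>n. p n + q n)"
proof -
  obtain C k where C: "\<And>n. p n \<le> C * (n + 1) ^ k" using assms by (auto simp: poly_bound_def)
  obtain D l where D: "\<And>n. q n \<le> D * (n + 1) ^ l" using assms by (auto simp: poly_bound_def)
  have "p n + q n \<le> (C + D) * (n + 1) ^ (k + l)" for n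
  proof -
    have "C * (n + 1) ^ k \<le> C * (n + 1) ^ (k + l)" "D * (n + 1) ^ l \<le> D * (n + 1) ^ (k + l)"
      by (intro mult_left_mono power_increasing; simp)+
    then show ?thesis using C[of n] D[of n] unfolding distrib_right by linarith
  qed
  moreover have "mono (\<lambda>n. p n + q n)" using assms unfolding poly_bound_def mono_def by (auto intro: add_mono)
  ultimately show ?thesis unfolding poly_bound_def by blast
qed

lemma poly_bound_mult [intro]:
  assumes "poly_bound p" "poly_bound q"
  shows "poly_bound (\<lambda>n. p n * q n)"
proof -
  obtain C k where C: "\<And>n. p n \<le> C * (n + 1) ^ k" using assms by (auto simp: poly_bound_def)
  obtain D l where D: "\<And>n. q n \<le> D * (n + 1) ^ l" using assms by (auto simp: poly_bound_def)
  have "p n * q n \<le> (C * D) * (n + 1) ^ (k + l)" for n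
  proof -
    have "p n * q n \<le> (C * (n + 1) ^ k) * (D * (n + 1) ^ l)" using C D by (intro mult_mono) auto
    then show ?thesis by (simp add: power_add mult_ac)
  qed
  moreover have "mono (\<lambda>n. p n * q n)" using assms unfolding poly_bound_def mono_def by (auto intro: mult_mono)
  ultimately show ?thesis unfolding poly_bound_def by blast
qed

lemma poly_bound_power [intro]: "poly_bound p \<Longrightarrow> poly_bound (\<lambda>n. p n ^ k)"
  by (induction k) (auto intro: poly_bound_mult)

lemma poly_bound_compose:
  assumes "poly_bound p" "poly_bound q"
  shows "poly_bound (\<lambda>n. p (q n))"
proof -
  obtain C k where C: "\<And>n. p n \<le> C * (n + 1) ^ k" using assms by (auto simp: poly_bound_def)
  obtain D l where D: "\<And>n. q n \<le> D * (n + 1) ^ l" using assms by (auto simp: poly_bound_def)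
  have "p (q n) \<le> (C * (D + 1) ^ k) * (n + 1) ^ (l * k)" for n
  proof -
    have "1 \<le> (n + 1) ^ l" by (rule one_le_power) simp
    then have "q n + 1 \<le> (D + 1) * (n + 1) ^ l" using D[of n] unfolding distrib_right by linarith
    then have "C * (q n + 1) ^ k \<le> C * ((D + 1) * (n + 1) ^ l) ^ k" by (intro mult_left_mono power_mono) auto
    then show ?thesis 
      using C[of "q n"] unfolding power_mult_distrib power_mult mult.assoc by linarith
  qed
  moreover have "mono (\<lambda>n. p (q n))" using assms unfolding poly_bound_def mono_def by auto
  ultimately show ?thesis unfolding poly_bound_def by blast
qed

context group
begin

text \<open>Polynomial distortion of word length under conjugation by powers of \<open>t\<close> of
  both signs; \<open>t\<close> may lie outside the group generated by \<open>X\<close>.\<close>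

definition tame :: "'a set \<Rightarrow> 'a \<Rightarrow> bool"
  where "tame X t \<longleftrightarrow> (\<exists>q. poly_bound q \<and> (\<forall>i. \<forall>s\<in>X. cj t i s \<in> word_ball G X (q (nat \<bar>i\<bar>))))"

lemma cj_word_ball:
  assumes X: "X \<subseteq> carrier G" and Y: "Y \<subseteq> carrier G" and t: "t \<in> carrier G"
    and c: "\<And>s. s \<in> X \<Longrightarrow> cj t i s \<in> word_ball G Y c"
  shows "x \<in> word_ball G X n \<Longrightarrow> cj t i x \<in> word_ball G Y (n * c)"
proof (induction n arbitrary: x)
  case 0 then show ?case using t by simp
next
  case (Suc n)
  consider "x = \<one>" | s z where "s \<in> X" "z \<in> word_ball G X n" "x = s \<otimes> z"
    using Suc.prems by (auto simp: word_ball_Suc)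
  then show ?case
  proof cases
    case 1 then show ?thesis using t one_in_word_ball by simp
  next
    case 2
    then have "cj t i x = cj t i s \<otimes> cj t i z" using X t word_ball_closed[OF _ X] by (auto intro!: cj_mult)
    then show ?thesis using word_ball_mult[OF Y c[OF 2(1)] Suc.IH[OF 2(2)]] by simp
  qed
qed

text \<open>Powers of \<open>t\<close> are collected at the right end of the word. Each letter of
  \<open>X\<close> is conjugated by the power of \<open>t\<close> standing before it, whose exponent
  is at most \<open>n\<close> in absolute value.\<close>

lemma cyclic_extension_normal_form:
  assumes X: "X \<subseteq> carrier G" and t: "t \<in> carrier G"
    and q: "poly_bound q" "\<And>i s. s \<in> X \<Longrightarrow> cj t i s \<in> word_ball G X (q (nat \<bar>i\<bar>))"
    and w: "w \<in> word_ball G (insert t (insert (inv t) X)) n"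
  shows "\<exists>j h. \<bar>j\<bar> \<le> int n \<and> h \<in> word_ball G X (n * q n) \<and> w = h \<otimes> t [^] (j::int)"
proof -
  \<comment> \<open>The induction treats these conjugates as single letters; expanding them by
    \<open>q\<close> is left to the end, so the estimate is not compounded from step to
    step.\<close>
  define Z where "Z n = {cj t i s | i s. s \<in> X \<and> \<bar>i\<bar> \<le> int n}" for n
  have Zc: "Z n \<subseteq> carrier G" for n unfolding Z_def using X t by auto
  have inZ: "cj t i s \<in> Z n" if "s \<in> X" "\<bar>i\<bar> \<le> int n" for i s n unfolding Z_def using that by blast
  have "\<exists>j h. \<bar>j\<bar> \<le> int n \<and> h \<in> word_ball G (Z n) n \<and> w = h \<otimes> t [^] (j::int)"
    using w
  proof (induction n arbitrary: w)
    case 0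
    then have "\<bar>0\<bar> \<le> int 0 \<and> \<one> \<in> word_ball G (Z 0) 0 \<and> w = \<one> \<otimes> t [^] (0::int)" by simp
    then show ?case by blast
  next
    case (Suc n)
    have up: "word_ball G (Z n) n \<subseteq> word_ball G (Z (Suc n)) n"
    proof (rule word_ball_mono)
      show "Z n \<subseteq> Z (Suc n)" unfolding Z_def by fastforce
    qed simp
    have shift: "\<exists>j h. \<bar>j\<bar> \<le> int (Suc n) \<and> h \<in> word_ball G (Z (Suc n)) (Suc n) \<and> t [^] k \<otimes> z = h \<otimes> t [^] (j::int)"
      if k: "\<bar>k\<bar> = 1" and z: "z \<in> word_ball G (insert t (insert (inv t) X)) n" for k :: int and z
    proof -
      obtain j :: int and h where jh: "\<bar>j\<bar> \<le> int n" "h \<in> word_ball G (Z n) n" "z = h \<otimes> t [^] j"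
        using Suc.IH[OF z] by blast
      have hc: "h \<in> carrier G" using jh(2) Zc by (rule word_ball_closed)
      have "cj t k h \<in> word_ball G (Z (Suc n)) (n * 1)"
      proof (rule cj_word_ball[OF Zc Zc t _ jh(2)])
        fix s assume "s \<in> Z n"
        then obtain i x where ix: "s = cj t i x" "x \<in> X" "\<bar>i\<bar> \<le> int n" unfolding Z_def by blast
        then have "cj t k s = cj t (k + i) x" using t X by (auto intro!: cj_add)
        moreover have "\<bar>k + i\<bar> \<le> int (Suc n)" using ix(3) k by auto
        ultimately have "cj t k s \<in> Z (Suc n)" using inZ[OF ix(2)] by simp
        then show "cj t k s \<in> word_ball G (Z (Suc n)) 1" using Zc by (intro word_ball_incl) auto
      qed
      then have "cj t k h \<in> word_ball G (Z (Suc n)) (Suc n)"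
        using word_ball_mono[of "Z (Suc n)" "Z (Suc n)" n "Suc n" G] by auto
      moreover have "t [^] k \<otimes> z = cj t k h \<otimes> t [^] (k + j)"
        unfolding jh(3) cj_def using t hc by (simp add: int_pow_mult group_word_simps)
      moreover have "\<bar>k + j\<bar> \<le> int (Suc n)" using jh(1) k by auto
      ultimately show ?thesis by blast
    qed
    consider "w = \<one>" | z where "z \<in> word_ball G (insert t (insert (inv t) X)) n" "w = t \<otimes> z"
      | z where "z \<in> word_ball G (insert t (insert (inv t) X)) n" "w = inv t \<otimes> z"
      | s z where "s \<in> X" "z \<in> word_ball G (insert t (insert (inv t) X)) n" "w = s \<otimes> z"
      using Suc.prems by (auto simp: word_ball_Suc)
    then show ?case
    proof cases
      case 1
      then have "\<bar>0\<bar> \<le> int (Suc n) \<and> \<one> \<in> word_ball G (Z (Suc n)) (Suc n) \<and> w = \<one> \<otimes> t [^] (0::int)"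
        by (simp add: one_in_word_ball)
      then show ?thesis by blast
    next
      case 2
      have "w = t [^] (1::int) \<otimes> z" using 2(2) t by simp
      then show ?thesis using shift[OF _ 2(1), of 1] by simp
    next
      case 3
      have "w = t [^] (- 1 :: int) \<otimes> z" using 3(2) int_pow_neg[OF t, of 1] t by simp
      then show ?thesis using shift[OF _ 3(1), of "- 1"] by simp
    next
      case 4
      obtain j :: int and h where jh: "\<bar>j\<bar> \<le> int n" "h \<in> word_ball G (Z n) n" "z = h \<otimes> t [^] j"
        using Suc.IH[OF 4(2)] by blast
      have hc: "h \<in> carrier G" using jh(2) Zc by (rule word_ball_closed)
      have "s \<in> Z (Suc n)" using inZ[OF 4(1), of 0 "Suc n"] 4(1) X by auto
      then have "s \<otimes> h \<in> word_ball G (Z (Suc n)) (Suc n)" using jh(2) up by (intro word_ball_Suc_step) auto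
      moreover have "w = s \<otimes> h \<otimes> t [^] j" unfolding 4(3) jh(3) using 4(1) X hc t by (auto simp: m_assoc)
      moreover have "\<bar>j\<bar> \<le> int (Suc n)" using jh(1) by simp
      ultimately show ?thesis by blast
    qed
  qed
  then obtain j :: int and h where jh: "\<bar>j\<bar> \<le> int n" "h \<in> word_ball G (Z n) n" "w = h \<otimes> t [^] j" by blast
  have "Z n \<subseteq> word_ball G X (q n)"
  proof
    fix x assume "x \<in> Z n"
    then obtain i s where xs: "x = cj t i s" "s \<in> X" "\<bar>i\<bar> \<le> int n" unfolding Z_def by blast
    then have "q (nat \<bar>i\<bar>) \<le> q n" using poly_bound_mono[OF q(1), of "nat \<bar>i\<bar>" n] by simp
    then show "x \<in> word_ball G X (q n)" using q(2)[OF xs(2), of i] xs(1) word_ball_mono[of X X _ "q n" G] by auto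
  qed
  then have "h \<in> word_ball G X (n * q n)" using word_ball_subst[OF X] jh(2) by blast
  then show ?thesis using jh by blast
qed

text \<open>Conjugating \<open>y\<close> by the \<open>n\<close>-th power of \<open>t\<close>
  multiplies it by conjugates of the commutator under the lower powers of \<open>t\<close>. There
  are \<open>n\<close> of these, each of length at most \<open>c * q n\<close>: the behaviour of a
  unipotent action.\<close>

lemma commutator_pow_bound:
  assumes X: "X \<subseteq> carrier G" and t: "t \<in> carrier G" and y: "y \<in> carrier G"
    and q: "poly_bound q" "\<And>n s. s \<in> X \<Longrightarrow> cj t (int n) s \<in> word_ball G X (q n)"
    and c: "t \<otimes> y \<otimes> inv t \<otimes> inv y \<in> word_ball G X c"
  shows "\<exists>m\<in>word_ball G X (n * (c * q n)). cj t (int n) y = m \<otimes> y"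
proof (induction n)
  case 0 then show ?case using y by simp
next
  case (Suc n)
  let ?k = "t \<otimes> y \<otimes> inv t \<otimes> inv y"
  obtain m where m: "m \<in> word_ball G X (n * (c * q n))" "cj t (int n) y = m \<otimes> y" using Suc by blast
  have mc: "m \<in> carrier G" using m(1) X by (rule word_ball_closed)
  have "cj t (int (Suc n)) y = cj t (int n) (cj t 1 y)" using t y by (simp add: cj_add add.commute)
  also have "cj t 1 y = ?k \<otimes> y" using t y by (simp add: cj_1 group_word_simps)
  also have "cj t (int n) (?k \<otimes> y) = cj t (int n) ?k \<otimes> (m \<otimes> y)"
    using t y m(2) by (subst cj_mult) auto
  also have "\<dots> = (cj t (int n) ?k \<otimes> m) \<otimes> y" using t y mc by (simp add: m_assoc)
  finally have eq: "cj t (int (Suc n)) y = (cj t (int n) ?k \<otimes> m) \<otimes> y" .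
  have "cj t (int n) ?k \<in> word_ball G X (c * q n)" using cj_word_ball[OF X X t q(2) c] .
  then have "cj t (int n) ?k \<otimes> m \<in> word_ball G X (c * q n + n * (c * q n))"
    using m(1) by (intro word_ball_mult X)
  moreover have "c * q n + n * (c * q n) \<le> Suc n * (c * q (Suc n))"
    using poly_bound_mono[OF q(1), of n "Suc n"] by (simp add: add_mono mult_le_mono)
  ultimately have "cj t (int n) ?k \<otimes> m \<in> word_ball G X (Suc n * (c * q (Suc n)))"
    using word_ball_mono[of X X _ "Suc n * (c * q (Suc n))" G] by blast
  then show ?case using eq by blast
qed

end

section \<open>Eigenvalues of conjugation on the quotients\<close>

fun digit_value :: "complex \<Rightarrow> bool list \<Rightarrow> complex" where
  "digit_value \<mu> [] = 0"
| "digit_value \<mu> (b # bs) = of_bool b + \<mu> * digit_value \<mu> bs"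

lemma digit_step:
  fixes \<mu> x d :: complex
  assumes \<mu>: "2 \<le> norm \<mu>" and x: "x = 0 \<or> 1 \<le> norm x" and d: "norm d \<le> 1" "d = 0 \<or> norm d = 1"
  shows "d + \<mu> * x = 0 \<or> 1 \<le> norm (d + \<mu> * x)"
proof (cases "x = 0")
  case True then show ?thesis using d by auto
next
  case False
  then have "2 * 1 \<le> norm \<mu> * norm x" using \<mu> x by (intro mult_mono) auto
  then have "1 \<le> norm (\<mu> * x) - norm d" using d by (simp add: norm_mult)
  also have "\<dots> \<le> norm (d + \<mu> * x)" using norm_diff_ineq[of "\<mu> * x" d] by (simp add: add.commute)
  finally show ?thesis by simp
qed

text \<open>Differences of expansions in base \<open>\<mu>\<close> with bits as digits are
  expansions with digits -1, 0 and 1. In Horner's scheme a nonzero value keeps norm at least 1,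
  since multiplication by \<open>\<mu>\<close> at least doubles the norm and a digit takes away at
  most 1.\<close>

lemma digit_value_gap:
  assumes \<mu>: "2 \<le> norm \<mu>"
  shows "digit_value \<mu> as - digit_value \<mu> bs = 0 \<or> 1 \<le> norm (digit_value \<mu> as - digit_value \<mu> bs)"
proof (induction as arbitrary: bs)
  case Nil
  show ?case
  proof (induction bs)
    case (Cons b bs)
    then show ?case using digit_step[OF \<mu>, of "0 - digit_value \<mu> bs" "- of_bool b"] by (simp add: algebra_simps)
  qed simp
next
  case (Cons a as)
  show ?case
  proof (cases bs)
    case Nil
    have "digit_value \<mu> as = 0 \<or> 1 \<le> norm (digit_value \<mu> as)" using Cons.IH[of "[]"] by simp
    then show ?thesis using Nil digit_step[OF \<mu>, of "digit_value \<mu> as" "of_bool a"] by simp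
  next
    case (Cons b bs')
    have "norm (of_bool a - of_bool b :: complex) \<le> 1" "of_bool a - of_bool b = (0::complex) \<or> norm (of_bool a - of_bool b :: complex) = 1"
      by (cases a; cases b; simp)+
    then have "(of_bool a - of_bool b) + \<mu> * (digit_value \<mu> as - digit_value \<mu> bs') = 0 \<or>
        1 \<le> norm ((of_bool a - of_bool b) + \<mu> * (digit_value \<mu> as - digit_value \<mu> bs'))"
      using digit_step[OF \<mu> Cons.IH[of bs']] by blast
    moreover have "digit_value \<mu> (a # as) - digit_value \<mu> bs =
        (of_bool a - of_bool b) + \<mu> * (digit_value \<mu> as - digit_value \<mu> bs')"
      unfolding Cons by (simp add: algebra_simps)
    ultimately show ?thesis by (simp only:)
  qed
qed

context group
begin

lemma conj_word_additive:
  assumes N: "subgroup N G" and \<psi>: "additive_on G N (\<psi> :: 'a \<Rightarrow> complex)" and h: "h \<in> N"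
    and t: "t \<in> carrier G" "\<And>x. x \<in> N \<Longrightarrow> cj t 1 x \<in> N \<and> \<psi> (cj t 1 x) = \<mu> * \<psi> x"
  shows "conj_word t h bs \<in> N \<and> \<psi> (conj_word t h bs) = \<psi> h * digit_value \<mu> bs"
proof (induction bs)
  case Nil
  then show ?case using additive_on_one[OF N \<psi>] subgroup.one_closed[OF N] by simp
next
  case (Cons b bs)
  let ?u = "if b then h else \<one>" and ?W = "conj_word t h bs"
  have u: "?u \<in> N" "\<psi> ?u = \<psi> h * of_bool b"
    using h additive_on_one[OF N \<psi>] subgroup.one_closed[OF N] by auto
  have W: "cj t 1 ?W \<in> N" "\<psi> (cj t 1 ?W) = \<mu> * (\<psi> h * digit_value \<mu> bs)" using t(2) Cons by auto
  have "conj_word t h (b # bs) = ?u \<otimes> cj t 1 ?W" using t(1) by (simp add: cj_1)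
  then show ?case
    using u W subgroup.m_closed[OF N u(1) W(1)] additive_on_mult[OF \<psi> u(1) W(1)] by (simp add: algebra_simps)
qed

text \<open>After passing to a power of \<open>t\<close> whose eigenvalue \<open>\<mu>\<close> has
  norm at least 2, the eigenfunctional turns conjugate words into \<open>\<psi> h\<close> times
  expansions in base \<open>\<mu>\<close>. The coincidence then makes 1 equal to
  \<open>\<mu>\<close> times a difference of two expansions. This difference is nonzero, hence of
  norm at least 1, and the product has norm at least 2.\<close>

lemma eigenvalue_le_1:
  assumes SE: "subexponential_group G \<Gamma>" and \<Gamma>: "subgroup \<Gamma> G" and N: "subgroup N G" "N \<subseteq> \<Gamma>"
    and \<psi>: "additive_on G N (\<psi> :: 'a \<Rightarrow> complex)" and h: "h \<in> N" "\<psi> h \<noteq> 0"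
    and t: "t \<in> \<Gamma>" "\<And>x. x \<in> N \<Longrightarrow> cj t 1 x \<in> N \<and> \<psi> (cj t 1 x) = \<kappa> * \<psi> x"
  shows "norm \<kappa> \<le> 1"
proof (rule ccontr)
  assume "\<not> norm \<kappa> \<le> 1"
  then obtain m where m: "2 < norm \<kappa> ^ m" using real_arch_pow[of "norm \<kappa>" 2] by auto
  define \<mu> where "\<mu> = \<kappa> ^ m"
  have \<mu>: "2 \<le> norm \<mu>" unfolding \<mu>_def using m by (simp add: norm_power)
  have tc: "t \<in> carrier G" using \<Gamma> t(1) by (rule subgroup.mem_carrier)
  have hc: "h \<in> carrier G" using N(1) h(1) by (rule subgroup.mem_carrier)
  define u where "u = t [^] int m"
  have u: "u \<in> \<Gamma>" unfolding u_def using \<Gamma> t(1) by (rule subgroup_int_pow_closed)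
  have uc: "u \<in> carrier G" using \<Gamma> u by (rule subgroup.mem_carrier)
  have pow: "cj t (int n) x \<in> N \<and> \<psi> (cj t (int n) x) = \<kappa> ^ n * \<psi> x" if x: "x \<in> N" for n x
  proof (induction n)
    case 0 then show ?case using x subgroup.mem_carrier[OF N(1) x] by simp
  next
    case (Suc n)
    have "cj t (int (Suc n)) x = cj t 1 (cj t (int n) x)"
      using tc subgroup.mem_carrier[OF N(1) x] by (simp add: cj_add)
    then show ?case using t(2) Suc by simp
  qed
  have cu: "cj u 1 x = cj t (int m) x" for x unfolding cj_def u_def using tc by simp
  have tu: "cj u 1 x \<in> N \<and> \<psi> (cj u 1 x) = \<mu> * \<psi> x" if "x \<in> N" for x
    unfolding cu \<mu>_def using pow[OF that] .
  obtain as bs where eq: "h = u \<otimes> (conj_word u h as \<otimes> inv (conj_word u h bs)) \<otimes> inv u"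
    using conj_word_coincidence[OF SE subgroup.subset[OF \<Gamma>] u _ hc] subgroup.m_closed[OF \<Gamma> _ u, of h] h(1) N(2) by blast
  have W: "conj_word u h as \<in> N" "conj_word u h bs \<in> N"
    "\<psi> (conj_word u h as) = \<psi> h * digit_value \<mu> as" "\<psi> (conj_word u h bs) = \<psi> h * digit_value \<mu> bs"
    using conj_word_additive[OF N(1) \<psi> h(1) uc tu] by auto
  note iW = subgroup.m_inv_closed[OF N(1) W(2)]
  have "h = cj u 1 (conj_word u h as \<otimes> inv (conj_word u h bs))" using eq uc by (simp add: cj_1)
  then have "\<psi> h = \<mu> * \<psi> (conj_word u h as \<otimes> inv (conj_word u h bs))"
    using tu[OF subgroup.m_closed[OF N(1) W(1) iW]] by simp
  also have "\<psi> (conj_word u h as \<otimes> inv (conj_word u h bs)) = \<psi> h * (digit_value \<mu> as - digit_value \<mu> bs)"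
    unfolding additive_on_mult[OF \<psi> W(1) iW] additive_on_inv[OF N(1) \<psi> W(2)] W(3,4)
    by (simp add: right_diff_distrib)
  finally have "\<psi> h * 1 = \<psi> h * (\<mu> * (digit_value \<mu> as - digit_value \<mu> bs))" by (simp add: algebra_simps)
  then have one: "\<mu> * (digit_value \<mu> as - digit_value \<mu> bs) = 1" using h(2) by simp
  then have "digit_value \<mu> as - digit_value \<mu> bs \<noteq> 0" by auto
  then have "1 \<le> norm (digit_value \<mu> as - digit_value \<mu> bs)" using digit_value_gap[OF \<mu>] by blast
  then have "2 * 1 \<le> norm \<mu> * norm (digit_value \<mu> as - digit_value \<mu> bs)" using \<mu> by (intro mult_mono) auto
  then show False using one by (simp flip: norm_mult)
qed

end

lemma (in group) int_pow_word_ball: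
  assumes S: "S \<subseteq> carrier G" and s: "s \<in> S" "inv s \<in> S"
  shows "s [^] (e::int) \<in> word_ball G S (nat \<bar>e\<bar>)"
proof -
  have nat: "x [^] n \<in> word_ball G S n" if "x \<in> S" for x and n :: nat
  proof (induction n)
    case 0 then show ?case by simp
  next
    case (Suc n)
    have "x [^] Suc n = x \<otimes> x [^] n" using that S by (intro nat_pow_Suc2) auto
    then show ?case using word_ball_Suc_step[OF that Suc] by simp
  qed
  have sc: "s \<in> carrier G" using s S by blast
  show ?thesis
  proof (cases e rule: int_cases2)
    case (nonneg n) then show ?thesis using nat[OF s(1), of n] by (simp add: int_pow_int)
  next
    case (nonpos n)
    have "s [^] e = (inv s) [^] n" using nonpos sc by (simp add: int_pow_neg int_pow_int nat_pow_inv)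
    then show ?thesis using nat[OF s(2), of n] nonpos by simp
  qed
qed

text \<open>One level of the series: \<open>N\<close> modulo \<open>M\<close> is free abelian with basis \<open>g\<close>, coordinates \<open>c\<close>, and
  conjugation by elements of the ambient group \<open>\<Gamma>\<close> distorts word length in \<open>M\<close> polynomially.\<close>

locale abelian_step = group G for G (structure) +
  fixes \<Gamma> N M X :: "'a set" and d :: nat and g :: "nat \<Rightarrow> 'a" and c :: "nat \<Rightarrow> 'a \<Rightarrow> int"
  assumes \<Gamma>: "subgroup \<Gamma> G" and subexp: "subexponential_group G \<Gamma>"
    and N: "subgroup N G" "N \<subseteq> \<Gamma>" and N_cj: "t \<in> \<Gamma> \<Longrightarrow> x \<in> N \<Longrightarrow> cj t z x \<in> N"
    and M_eq: "M = {x \<in> N. \<forall>i<d. c i x = 0}" and M_cj: "t \<in> \<Gamma> \<Longrightarrow> x \<in> M \<Longrightarrow> cj t z x \<in> M"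
    and g_mem: "i < d \<Longrightarrow> g i \<in> N" and c_add: "i < d \<Longrightarrow> additive_on G N (c i)"
    and dual: "i < d \<Longrightarrow> j < d \<Longrightarrow> c i (g j) = (if i = j then 1 else 0)"
    and X_finite: "finite X" and X_inv: "s \<in> X \<Longrightarrow> inv s \<in> X" and X_sub: "X \<subseteq> carrier G"
    and X_gen: "M = generate G X" and X_tame: "t \<in> \<Gamma> \<Longrightarrow> tame X t"
begin

lemma N_carrier: "x \<in> N \<Longrightarrow> x \<in> carrier G"
  using N(1) by (rule subgroup.mem_carrier)

lemma \<Gamma>_carrier: "x \<in> \<Gamma> \<Longrightarrow> x \<in> carrier G"
  using \<Gamma> by (rule subgroup.mem_carrier)

lemmas N_closed = subgroup.m_closed[OF N(1)] subgroup.m_inv_closed[OF N(1)] subgroup.one_closed[OF N(1)]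

lemma M_subset_N: "M \<subseteq> N"
  unfolding M_eq by blast

lemma M_subgroup: "subgroup M G"
  unfolding X_gen by (rule generate_is_subgroup[OF X_sub])

section \<open>Normal forms in one abelian step\<close>

primrec gp :: "nat \<Rightarrow> (nat \<Rightarrow> int) \<Rightarrow> 'a" where
  "gp 0 e = \<one>"
| "gp (Suc k) e = gp k e \<otimes> g k [^] e k"

text \<open>The basis elements are adjoined one at a time, so that each stage is handled as a cyclic
  extension of the preceding one; \<open>Y 0\<close> generates \<open>M\<close> and
  \<open>Y d\<close> generates \<open>N\<close>.\<close>

definition Y :: "nat \<Rightarrow> 'a set" where "Y k = X \<union> (\<Union>i<k. {g i, inv (g i)})"

lemma Y_0 [simp]: "Y 0 = X"
  by (simp add: Y_def)

lemma Y_Suc: "Y (Suc k) = insert (g k) (insert (inv (g k)) (Y k))"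
  by (auto simp: Y_def less_Suc_eq)

lemma X_Y: "X \<subseteq> Y k"
  by (auto simp: Y_def)

lemma Y_finite: "finite (Y k)"
  unfolding Y_def using X_finite by simp

lemma X_N: "X \<subseteq> N"
  using M_subset_N unfolding X_gen by (auto intro: generate.incl)

lemma Y_N: "k \<le> d \<Longrightarrow> Y k \<subseteq> N"
  unfolding Y_def using X_N g_mem N_closed(2) by fastforce

lemma Y_carrier: "k \<le> d \<Longrightarrow> Y k \<subseteq> carrier G"
  using Y_N N_carrier by blast

lemma Y_inv: "k \<le> d \<Longrightarrow> s \<in> Y k \<Longrightarrow> inv s \<in> Y k"
  unfolding Y_def using X_inv g_mem N_carrier by fastforce

lemma gp_N: "k \<le> d \<Longrightarrow> gp k e \<in> N"
  by (induction k) (auto simp: N_closed g_mem intro!: N_closed(1) subgroup_int_pow_closed[OF N(1)])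

lemma gp_cong: "(\<And>i. i < k \<Longrightarrow> e i = e' i) \<Longrightarrow> gp k e = gp k e'"
  by (induction k) auto

lemma gp_zero: "k \<le> d \<Longrightarrow> (\<And>i. i < k \<Longrightarrow> e i = 0) \<Longrightarrow> gp k e = \<one>"
  by (induction k) auto

lemma gp_unit:
  assumes "j < d"
  shows "gp d (\<lambda>i. if i = j then 1 else 0) = g j"
proof -
  have "k \<le> d \<Longrightarrow> gp k (\<lambda>i. if i = j then 1 else 0) = (if j < k then g j else \<one>)" for k
    using N_carrier[OF g_mem] by (induction k) (auto simp: less_Suc_eq)
  then show ?thesis using assms by simp
qed

lemma additive_on_gp:
  assumes \<psi>: "additive_on G N (\<psi> :: 'a \<Rightarrow> 'c::comm_ring_1)" and "k \<le> d"
  shows "\<psi> (gp k e) = (\<Sum>l<k. of_int (e l) * \<psi> (g l))"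
  using assms(2)
proof (induction k)
  case 0 then show ?case using additive_on_one[OF N(1) \<psi>] by simp
next
  case (Suc k)
  have "g k \<in> N" using g_mem Suc.prems by simp
  then have "\<psi> (gp k e \<otimes> g k [^] e k) = \<psi> (gp k e) + of_int (e k) * \<psi> (g k)"
    using additive_on_mult[OF \<psi> gp_N subgroup_int_pow_closed[OF N(1)]] additive_on_int_pow[OF N(1) \<psi>] Suc.prems by simp
  then show ?case using Suc by simp
qed

lemma c_gp: "i < d \<Longrightarrow> c i (gp d e) = e i"
proof -
  assume i: "i < d"
  have "c i (gp d e) = (\<Sum>l<d. e l * (if i = l then 1 else 0))"
    using additive_on_gp[OF c_add[OF i], of d e] dual[OF i] by simp
  then show ?thesis using i by (simp add: if_distrib[of "\<lambda>z. _ * z"] cong: if_cong)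
qed

text \<open>The ordered products \<open>gp d e\<close> are coset representatives of \<open>M\<close>
  in \<open>N\<close>, one for each vector of coordinates.\<close>

lemma residue_in_M: "x \<in> N \<Longrightarrow> (\<And>i. i < d \<Longrightarrow> e i = c i x) \<Longrightarrow> x \<otimes> inv (gp d e) \<in> M"
  unfolding M_eq
  by (auto simp: N_closed gp_N c_gp additive_on_mult[OF c_add] additive_on_inv[OF N(1) c_add])

lemma commutator_in_M: "x \<in> N \<Longrightarrow> y \<in> N \<Longrightarrow> x \<otimes> y \<otimes> inv x \<otimes> inv y \<in> M"
  unfolding M_eq
  by (auto simp: N_closed additive_on_mult[OF c_add] additive_on_inv[OF N(1) c_add])

lemma word_ball_X_Y: "m \<le> n \<Longrightarrow> word_ball G X m \<subseteq> word_ball G (Y k) n"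
  by (rule word_ball_mono[OF X_Y])

lemma gp_word_ball: "k \<le> d \<Longrightarrow> gp k e \<in> word_ball G (Y k) (\<Sum>i<k. nat \<bar>e i\<bar>)"
proof (induction k)
  case 0 then show ?case by simp
next
  case (Suc k)
  have "gp k e \<in> word_ball G (Y (Suc k)) (\<Sum>i<k. nat \<bar>e i\<bar>)"
    using Suc word_ball_mono[of "Y k" "Y (Suc k)" "\<Sum>i<k. nat \<bar>e i\<bar>" "\<Sum>i<k. nat \<bar>e i\<bar>" G] by (auto simp: Y_Suc)
  moreover have "g k [^] e k \<in> word_ball G (Y (Suc k)) (nat \<bar>e k\<bar>)"
    by (rule int_pow_word_ball[OF Y_carrier[OF Suc.prems]]) (simp_all add: Y_Suc)
  ultimately show ?case using word_ball_mult[OF Y_carrier[OF Suc.prems]] by simp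
qed

text \<open>Elements of \<open>N\<close> act trivially on the abelian quotient by \<open>M\<close>,
  so their commutators with the basis lie in \<open>M\<close> and
  \<open>commutator_pow_bound\<close> applies. General elements of \<Gamma> may act nontrivially
  there; for them the eigenvalue bound is used.\<close>

lemma tame_Y:
  assumes t: "t \<in> N" and k: "k \<le> d"
  shows "tame (Y k) t"
proof -
  have t\<Gamma>: "t \<in> \<Gamma>" using t N(2) by blast
  have tc: "t \<in> carrier G" using t by (rule N_carrier)
  obtain q where q: "poly_bound q" "\<And>i s. s \<in> X \<Longrightarrow> cj t i s \<in> word_ball G X (q (nat \<bar>i\<bar>))"
    using X_tame[OF t\<Gamma>] unfolding tame_def by blast
  \<comment> \<open>Commutators with \<open>inv t\<close> are included because negative powers of
    \<open>t\<close> are handled as positive powers of \<open>inv t\<close>.\<close>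
  let ?T = "(\<Union>i<k. {t \<otimes> g i \<otimes> inv t \<otimes> inv (g i), inv t \<otimes> g i \<otimes> inv (inv t) \<otimes> inv (g i)})"
  have gi: "g i \<in> N" if "i < k" for i using g_mem that k by simp
  have "?T \<subseteq> generate G X"
    unfolding X_gen[symmetric] using commutator_in_M[OF t gi] commutator_in_M[OF N_closed(2)[OF t] gi] by auto
  then obtain b where b: "?T \<subseteq> word_ball G X b"
    using finite_subset_word_ball[OF X_sub X_inv, of ?T] by auto
  define q' where "q' n = q n + n * (b * q n) + 1" for n
  have q': "poly_bound q'"
    unfolding q'_def using q(1) by (intro poly_bound_add poly_bound_mult poly_bound_const poly_bound_id)
  have pos: "cj t' (int n) (g i) \<in> word_ball G (Y k) (q' n)"
    if t': "t' = t \<or> t' = inv t" and i: "i < k" for t' n i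
  proof -
    have t'c: "t' \<in> carrier G" using t' tc by auto
    have "\<exists>m\<in>word_ball G X (n * (b * q n)). cj t' (int n) (g i) = m \<otimes> g i"
    proof (rule commutator_pow_bound[OF X_sub t'c N_carrier[OF gi[OF i]] q(1)])
      show "cj t' (int n) s \<in> word_ball G X (q n)" if "s \<in> X" for n s
        using t' q(2)[OF that, of "int n"] q(2)[OF that, of "- int n"] tc by (auto simp: cj_inv_left)
      show "t' \<otimes> g i \<otimes> inv t' \<otimes> inv (g i) \<in> word_ball G X b" using b t' i by auto
    qed
    then obtain m where m: "m \<in> word_ball G X (n * (b * q n))" "cj t' (int n) (g i) = m \<otimes> g i" by blast
    have "g i \<in> word_ball G (Y k) 1" using i k Y_carrier by (intro word_ball_incl) (auto simp: Y_def)
    then have "m \<otimes> g i \<in> word_ball G (Y k) (n * (b * q n) + 1)"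
      using m(1) word_ball_X_Y[OF order_refl] by (intro word_ball_mult Y_carrier k) auto
    moreover have "n * (b * q n) + 1 \<le> q' n" unfolding q'_def by simp
    ultimately show ?thesis using m(2) word_ball_mono[of "Y k" "Y k" _ "q' n" G] by fastforce
  qed
  have gen: "cj t i (g j) \<in> word_ball G (Y k) (q' (nat \<bar>i\<bar>))" if j: "j < k" for i j
  proof (cases i rule: int_cases2)
    case (nonneg n) then show ?thesis using pos[of t j n] j by simp
  next
    case (nonpos n) then show ?thesis using pos[of "inv t" j n] j tc by (simp add: cj_inv_left)
  qed
  have "cj t i s \<in> word_ball G (Y k) (q' (nat \<bar>i\<bar>))" if s: "s \<in> Y k" for i s
  proof -
    consider "s \<in> X" | j where "j < k" "s = g j" | j where "j < k" "s = inv (g j)"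
      using s unfolding Y_def by auto
    then show ?thesis
    proof cases
      case 1
      have "q (nat \<bar>i\<bar>) \<le> q' (nat \<bar>i\<bar>)" unfolding q'_def by simp
      then show ?thesis using q(2)[OF 1, of i] word_ball_X_Y by blast
    next
      case 2 then show ?thesis using gen by simp
    next
      case 3
      then have "cj t i s = inv (cj t i (g j))" using tc N_carrier[OF gi] by (simp add: cj_inv)
      then show ?thesis using word_ball_inv[OF Y_carrier[OF k] Y_inv[OF k] gen[OF 3(1)]] by simp
    qed
  qed
  then show ?thesis unfolding tame_def using q' by blast
qed

text \<open>Each new basis element is collected on the right by
  \<open>cyclic_extension_normal_form\<close>, which applies because it is tame on the preceding
  stage. Polynomial bounds survive the composition at each of the \<open>k\<close> stages.\<close>

lemma normal_form:
  assumes "k \<le> d"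
  shows "\<exists>q. poly_bound q \<and> (\<forall>n. \<forall>w\<in>word_ball G (Y k) n. \<exists>m\<in>word_ball G X (q n). \<exists>e.
    (\<forall>i<k. \<bar>e i\<bar> \<le> int (q n)) \<and> w = m \<otimes> gp k e)"
  using assms
proof (induction k)
  case 0
  have "\<exists>e. w = w \<otimes> gp 0 e" if "w \<in> word_ball G X n" for w n using word_ball_closed[OF that X_sub] by simp
  then show ?case by (intro exI[of _ "\<lambda>n. n"]) (auto intro!: poly_bound_id)
next
  case (Suc k)
  have k: "k \<le> d" and gk: "g k \<in> N" using Suc.prems g_mem by auto
  obtain q where q: "poly_bound q" "\<And>n w. w \<in> word_ball G (Y k) n \<Longrightarrow>
      \<exists>m\<in>word_ball G X (q n). \<exists>e. (\<forall>i<k. \<bar>e i\<bar> \<le> int (q n)) \<and> w = m \<otimes> gp k e"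
    using Suc.IH[OF k] by blast
  obtain q' where q': "poly_bound q'" "\<And>i s. s \<in> Y k \<Longrightarrow> cj (g k) i s \<in> word_ball G (Y k) (q' (nat \<bar>i\<bar>))"
    using tame_Y[OF gk k] unfolding tame_def by blast
  define Q where "Q n = q (n * q' n) + n" for n
  have Q: "poly_bound Q"
    unfolding Q_def
    by (rule poly_bound_add[OF poly_bound_compose[OF q(1) poly_bound_mult[OF poly_bound_id q'(1)]] poly_bound_id])
  have "\<exists>m\<in>word_ball G X (Q n). \<exists>e. (\<forall>i<Suc k. \<bar>e i\<bar> \<le> int (Q n)) \<and> w = m \<otimes> gp (Suc k) e"
    if w: "w \<in> word_ball G (Y (Suc k)) n" for w n
  proof -
    obtain j h where jh: "\<bar>j\<bar> \<le> int n" "h \<in> word_ball G (Y k) (n * q' n)" "w = h \<otimes> g k [^] (j::int)"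
      using cyclic_extension_normal_form[OF Y_carrier[OF k] N_carrier[OF gk] q' w[unfolded Y_Suc]] by blast
    obtain m e where me: "m \<in> word_ball G X (q (n * q' n))" "\<forall>i<k. \<bar>e i\<bar> \<le> int (q (n * q' n))" "h = m \<otimes> gp k e"
      using q(2)[OF jh(2)] by blast
    have mc: "m \<in> carrier G" using me(1) X_sub by (rule word_ball_closed)
    have "gp k (e(k := j)) = gp k e" by (rule gp_cong) simp
    then have "w = m \<otimes> gp (Suc k) (e(k := j))"
      unfolding jh(3) me(3) using mc N_carrier[OF gp_N[OF k]] N_carrier[OF gk] by (simp add: m_assoc)
    moreover have "m \<in> word_ball G X (Q n)"
      using me(1) word_ball_mono[of X X "q (n * q' n)" "Q n" G] unfolding Q_def by auto
    moreover have "\<forall>i<Suc k. \<bar>(e(k := j)) i\<bar> \<le> int (Q n)"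
      using me(2) jh(1) unfolding Q_def by (auto simp: less_Suc_eq)
    ultimately show ?thesis by blast
  qed
  then show ?case using Q by blast
qed

text \<open>For an element of \<open>M\<close> all coordinates vanish, so its normal form reduces to
  the factor over \<open>X\<close>.\<close>

lemma M_undistorted:
  obtains q where "poly_bound q" "\<And>n x. x \<in> M \<Longrightarrow> x \<in> word_ball G (Y d) n \<Longrightarrow> x \<in> word_ball G X (q n)"
proof -
  obtain q where q: "poly_bound q" "\<And>n w. w \<in> word_ball G (Y d) n \<Longrightarrow>
      \<exists>m\<in>word_ball G X (q n). \<exists>e. (\<forall>i<d. \<bar>e i\<bar> \<le> int (q n)) \<and> w = m \<otimes> gp d e"
    using normal_form[of d] by blast
  show thesis
  proof (rule that[OF q(1)])
    fix n x assume x: "x \<in> M" "x \<in> word_ball G (Y d) n"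
    obtain m e where me: "m \<in> word_ball G X (q n)" "x = m \<otimes> gp d e" using q(2)[OF x(2)] by blast
    have "m \<in> M" using me(1) word_ball_subset_subgroup[OF M_subgroup, of X] unfolding X_gen
      by (auto intro: generate.incl)
    then have m: "m \<in> N" "\<And>i. i < d \<Longrightarrow> c i m = 0" unfolding M_eq by auto
    have "e i = 0" if i: "i < d" for i
    proof -
      have "c i x = c i m + e i"
        unfolding me(2) using additive_on_mult[OF c_add[OF i] m(1) gp_N] c_gp[OF i] by simp
      then show ?thesis using m(2)[OF i] x(1) i unfolding M_eq by simp
    qed
    then have "gp d e = \<one>" by (intro gp_zero) auto
    then have "x = m" using me(2) m N_carrier by simp
    then show "x \<in> word_ball G X (q n)" using me(1) by simp
  qed
qed

lemma card_word_ball_Y: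
  assumes p: "poly_bound p" "\<And>n. card (word_ball G X n) \<le> p n"
  shows "\<exists>q. poly_bound q \<and> (\<forall>n. card (word_ball G (Y d) n) \<le> q n)"
proof -
  obtain q where q: "poly_bound q" "\<And>n w. w \<in> word_ball G (Y d) n \<Longrightarrow>
      \<exists>m\<in>word_ball G X (q n). \<exists>e. (\<forall>i<d. \<bar>e i\<bar> \<le> int (q n)) \<and> w = m \<otimes> gp d e"
    using normal_form[of d] by blast
  have "card (word_ball G (Y d) n) \<le> p (q n) * (2 * q n + 1) ^ d" for n
  proof -
    let ?E = "{..<d} \<rightarrow>\<^sub>E {- int (q n)..int (q n)}"
    have "word_ball G (Y d) n \<subseteq> (\<lambda>(m, e). m \<otimes> gp d e) ` (word_ball G X (q n) \<times> ?E)"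
    proof
      fix w assume "w \<in> word_ball G (Y d) n"
      then obtain m e where me: "m \<in> word_ball G X (q n)" "\<forall>i<d. \<bar>e i\<bar> \<le> int (q n)" "w = m \<otimes> gp d e"
        using q(2) by blast
      have "gp d (restrict e {..<d}) = gp d e" by (rule gp_cong) simp
      moreover have "restrict e {..<d} \<in> ?E" using me(2) by (auto simp: abs_le_iff)
      ultimately show "w \<in> (\<lambda>(m, e). m \<otimes> gp d e) ` (word_ball G X (q n) \<times> ?E)"
        using me by (intro image_eqI[of _ _ "(m, restrict e {..<d})"]) auto
    qed
    then have "card (word_ball G (Y d) n) \<le> card (word_ball G X (q n) \<times> ?E)"
      by (intro surj_card_le) (auto intro!: finite_word_ball X_finite finite_PiE)
    also have "\<dots> = card (word_ball G X (q n)) * (2 * q n + 1) ^ d"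
    proof -
      have "card {- int (q n)..int (q n)} = 2 * q n + 1" by simp
      then show ?thesis by (simp only: card_cartesian_product card_PiE finite_lessThan prod_constant card_lessThan)
    qed
    also have "\<dots> \<le> p (q n) * (2 * q n + 1) ^ d" using p(2) by (intro mult_right_mono) auto
    finally show ?thesis .
  qed
  moreover have "poly_bound (\<lambda>n. p (q n) * (2 * q n + 1) ^ d)"
    by (rule poly_bound_mult[OF poly_bound_compose[OF p(1) q(1)] poly_bound_power[OF poly_bound_add[OF
          poly_bound_mult[OF poly_bound_const q(1)] poly_bound_const]]])
  ultimately show ?thesis by blast
qed

end

section \<open>Conjugation as an integer matrix\<close>

context abelian_step
begin

lemma additive_on_c_cj:
  assumes t: "t \<in> \<Gamma>" and k: "k < d"
  shows "additive_on G N (\<lambda>x. c k (cj t i x))"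
  unfolding additive_on_def
  using N_cj[OF t] cj_mult[OF \<Gamma>_carrier[OF t] N_carrier N_carrier] additive_on_mult[OF c_add[OF k]] by simp

text \<open>A coordinate of the conjugate is additive in \<open>x\<close> and vanishes on
  \<open>M\<close>, which conjugation preserves; it is therefore a linear function of the
  coordinates of \<open>x\<close>.\<close>

lemma c_cj_expand:
  assumes t: "t \<in> \<Gamma>" and k: "k < d" and x: "x \<in> N"
  shows "c k (cj t i x) = (\<Sum>l<d. c l x * c k (cj t i (g l)))"
proof -
  let ?\<psi> = "\<lambda>x. c k (cj t i x)" and ?e = "\<lambda>l. c l x"
  note \<psi> = additive_on_c_cj[OF t k, of i]
  have m: "x \<otimes> inv (gp d ?e) \<in> M" using residue_in_M[OF x] by simp
  have "0 = ?\<psi> (x \<otimes> inv (gp d ?e))" using M_cj[OF t m] k unfolding M_eq by simp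
  also have "\<dots> = ?\<psi> x - ?\<psi> (gp d ?e)"
    using additive_on_mult[OF \<psi> x N_closed(2)[OF gp_N]] additive_on_inv[OF N(1) \<psi> gp_N] by simp
  finally show ?thesis using additive_on_gp[OF \<psi> order_refl, of ?e] by simp
qed

text \<open>Row \<open>j\<close> lists the coordinates of the conjugate of \<open>g j\<close>. The
  integer entries are read as complex numbers to make eigenvectors and the spectral radius
  available.\<close>

definition conj_matrix :: "'a \<Rightarrow> complex mat"
  where "conj_matrix t = mat d d (\<lambda>(j, k). of_int (c k (cj t 1 (g j))))"

lemma conj_matrix_carrier: "conj_matrix t \<in> carrier_mat d d"
  by (simp add: conj_matrix_def)

lemma conj_matrix_pow:
  assumes t: "t \<in> \<Gamma>" and j: "j < d"
  shows "k < d \<Longrightarrow> (conj_matrix t ^\<^sub>m n) $$ (j, k) = of_int (c k (cj t (int n) (g j)))"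
proof (induction n arbitrary: k)
  case 0
  then show ?case using j dual[of k j] N_carrier[OF g_mem] conj_matrix_carrier[of t] by auto
next
  case (Suc n)
  note P = pow_carrier_mat[OF conj_matrix_carrier, of t n]
  have gj: "g j \<in> carrier G" using N_carrier[OF g_mem[OF j]] .
  have "(conj_matrix t ^\<^sub>m Suc n) $$ (j, k) =
      (\<Sum>l<d. (conj_matrix t ^\<^sub>m n) $$ (j, l) * conj_matrix t $$ (l, k))"
    using P conj_matrix_carrier[of t] j Suc.prems by (simp add: scalar_prod_def lessThan_atLeast0)
  also have "\<dots> = (\<Sum>l<d. of_int (c l (cj t (int n) (g j)) * c k (cj t 1 (g l))))"
    using Suc by (intro sum.cong) (auto simp: conj_matrix_def)
  also have "\<dots> = of_int (c k (cj t 1 (cj t (int n) (g j))))"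
    using c_cj_expand[OF t Suc.prems N_cj[OF t g_mem[OF j]], of 1 "int n"] by simp
  also have "cj t 1 (cj t (int n) (g j)) = cj t (int (Suc n)) (g j)"
    using \<Gamma>_carrier[OF t] gj by (simp add: cj_add)
  finally show ?case .
qed

text \<open>The entries of an eigenvector \<open>v\<close>, used as weights on the coordinates,
  define a functional on \<open>N\<close> that conjugation by \<open>t\<close> multiplies by the
  eigenvalue and that is nonzero on some basis element.\<close>

lemma conj_matrix_spectral_radius:
  assumes t: "t \<in> \<Gamma>" and d: "0 < d"
  shows "spectral_radius (conj_matrix t) \<le> 1"
proof (rule ccontr)
  let ?A = "conj_matrix t"
  note A = conj_matrix_carrier[of t]
  assume "\<not> ?thesis"
  then obtain v \<kappa> where v: "v \<in> carrier_vec d" "norm \<kappa> > 1" "v \<noteq> 0\<^sub>v d" "?A ^\<^sub>m 1 *\<^sub>v v = \<kappa> ^ 1 \<cdot>\<^sub>v v"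
    using spectral_radius_gt_1[OF A d, of 1] by auto
  have Av: "?A *\<^sub>v v = \<kappa> \<cdot>\<^sub>v v" using v(4) A by simp
  have eig: "(\<Sum>k<d. of_int (c k (cj t 1 (g l))) * v $ k) = \<kappa> * v $ l" if l: "l < d" for l
  proof -
    have "(?A *\<^sub>v v) $ l = (\<Sum>k<d. of_int (c k (cj t 1 (g l))) * v $ k)"
      using l v(1) by (simp add: conj_matrix_def scalar_prod_def lessThan_atLeast0)
    then show ?thesis using Av l v(1) by simp
  qed
  define \<psi> :: "'a \<Rightarrow> complex" where "\<psi> x = (\<Sum>k<d. of_int (c k x) * v $ k)" for x
  have \<psi>: "additive_on G N \<psi>"
    unfolding additive_on_def \<psi>_def using additive_on_mult[OF c_add]
    by (simp add: distrib_right sum.distrib)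
  obtain j where j: "j < d" "v $ j \<noteq> 0" using v(1,3) by (metis carrier_vecD eq_vecI index_zero_vec)
  have "\<psi> (g j) = (\<Sum>k<d. if k = j then v $ k else 0)"
    unfolding \<psi>_def using j dual by (intro sum.cong) auto
  then have \<psi>g: "\<psi> (g j) \<noteq> 0" using j by simp
  have "cj t 1 x \<in> N \<and> \<psi> (cj t 1 x) = \<kappa> * \<psi> x" if x: "x \<in> N" for x
  proof -
    have "\<psi> (cj t 1 x) = (\<Sum>k<d. \<Sum>l<d. of_int (c l x) * (of_int (c k (cj t 1 (g l))) * v $ k))"
      unfolding \<psi>_def using c_cj_expand[OF t _ x, of _ 1]
      by (intro sum.cong) (simp_all add: sum_distrib_right mult.assoc)
    also have "\<dots> = (\<Sum>l<d. of_int (c l x) * (\<Sum>k<d. of_int (c k (cj t 1 (g l))) * v $ k))"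
      by (subst sum.swap) (simp add: sum_distrib_left)
    also have "\<dots> = (\<Sum>l<d. of_int (c l x) * (\<kappa> * v $ l))" using eig by (intro sum.cong) auto
    also have "\<dots> = \<kappa> * \<psi> x" unfolding \<psi>_def by (simp add: sum_distrib_left mult.left_commute)
    finally show ?thesis using N_cj[OF t x] by blast
  qed
  then have "norm \<kappa> \<le> 1" using eigenvalue_le_1[OF subexp \<Gamma> N \<psi> g_mem[OF j(1)] \<psi>g t] by blast
  then show False using v(2) by simp
qed

text \<open>By the Jordan normal form, the powers of a \<open>d\<close> by \<open>d\<close> matrix
  of spectral radius at most 1 have entries at most of order \<open>n ^ (d - 1)\<close>.\<close>

lemma coefficient_growth:
  assumes t: "t \<in> \<Gamma>"
  obtains r where "poly_bound r" "\<And>n j k. j < d \<Longrightarrow> k < d \<Longrightarrow> nat \<bar>c k (cj t (int n) (g j))\<bar> \<le> r n"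
proof (cases "d = 0")
  case True then show thesis using that[of "\<lambda>_. 0"] poly_bound_const by auto
next
  case False
  then obtain c1 c2 where b: "\<And>n. norm_bound (conj_matrix t ^\<^sub>m n) (c1 + c2 * of_nat n ^ (d - 1))"
    using spectral_radius_jnf_norm_bound_le_1_upper_triangular[OF conj_matrix_carrier conj_matrix_spectral_radius[OF t]]
    by auto
  define C where "C = nat \<lceil>\<bar>c1\<bar> + \<bar>c2\<bar>\<rceil>"
  have C: "\<bar>c1\<bar> + \<bar>c2\<bar> \<le> real C" unfolding C_def by linarith
  show thesis
  proof (rule that[of "\<lambda>n. C * Suc n ^ (d - 1)"])
    show "poly_bound (\<lambda>n. C * Suc n ^ (d - 1))"
      by (rule poly_bound_mult[OF poly_bound_const poly_bound_power[OF poly_bound_Suc]])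
    fix n j k assume jk: "j < d" "k < d"
    have "norm ((conj_matrix t ^\<^sub>m n) $$ (j, k)) \<le> c1 + c2 * of_nat n ^ (d - 1)"
      using b[of n, unfolded norm_bound_def, rule_format, of j k] jk
        carrier_matD[OF pow_carrier_mat[OF conj_matrix_carrier, of t n]] by simp
    then have "real_of_int \<bar>c k (cj t (int n) (g j))\<bar> \<le> c1 + c2 * of_nat n ^ (d - 1)"
      using conj_matrix_pow[OF t jk] by simp
    also have "\<dots> \<le> \<bar>c1\<bar> * real (Suc n) ^ (d - 1) + \<bar>c2\<bar> * real (Suc n) ^ (d - 1)"
    proof (intro add_mono)
      have "\<bar>c1\<bar> * 1 \<le> \<bar>c1\<bar> * real (Suc n) ^ (d - 1)" by (intro mult_left_mono one_le_power) auto
      then show "c1 \<le> \<bar>c1\<bar> * real (Suc n) ^ (d - 1)" by simp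
      have "c2 * real n ^ (d - 1) \<le> \<bar>c2\<bar> * real n ^ (d - 1)" by (intro mult_right_mono) auto
      also have "\<dots> \<le> \<bar>c2\<bar> * real (Suc n) ^ (d - 1)" by (intro mult_left_mono power_mono) auto
      finally show "c2 * real n ^ (d - 1) \<le> \<bar>c2\<bar> * real (Suc n) ^ (d - 1)" .
    qed
    also have "\<dots> \<le> real C * real (Suc n) ^ (d - 1)"
      unfolding distrib_right[symmetric] using C by (intro mult_right_mono) auto
    also have "\<dots> = real (C * Suc n ^ (d - 1))" by simp
    finally show "nat \<bar>c k (cj t (int n) (g j))\<bar> \<le> C * Suc n ^ (d - 1)"
      by (simp only: nat_le_iff)
  qed
qed

lemma X_word_balls: "x \<in> M \<Longrightarrow> \<exists>n. x \<in> word_ball G X n"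
  using generate_eq_word_balls[OF X_sub X_inv] X_gen by auto

lemma N_word_balls:
  assumes x: "x \<in> N"
  shows "\<exists>n. x \<in> word_ball G (Y d) n"
proof -
  let ?e = "\<lambda>i. c i x"
  have "x \<otimes> inv (gp d ?e) \<in> M" using residue_in_M[OF x] by simp
  then obtain n where n: "x \<otimes> inv (gp d ?e) \<in> word_ball G X n" using X_word_balls by blast
  then have "x \<otimes> inv (gp d ?e) \<in> word_ball G (Y d) n" using word_ball_X_Y[OF order_refl] by blast
  then have "x \<otimes> inv (gp d ?e) \<otimes> gp d ?e \<in> word_ball G (Y d) (n + (\<Sum>i<d. nat \<bar>?e i\<bar>))"
    using gp_word_ball[OF order_refl] by (intro word_ball_mult Y_carrier) auto
  moreover have "x \<otimes> inv (gp d ?e) \<otimes> gp d ?e = x"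
    using N_carrier[OF x] N_carrier[OF gp_N[OF order_refl]] by (simp add: m_assoc)
  ultimately show ?thesis by auto
qed

lemma Y_gen: "N = generate G (Y d)"
proof
  show "N \<subseteq> generate G (Y d)"
    using N_word_balls generate_eq_word_balls[OF Y_carrier[OF order_refl] Y_inv[OF order_refl]] by auto
  show "generate G (Y d) \<subseteq> N" using Y_N by (intro generate_subgroup_incl N) auto
qed

text \<open>The conjugate \<open>x n\<close> is compared with the ordered product \<open>V n\<close>
  of the same coordinates, which is short by \<open>coefficient_growth\<close>. The quotient
  \<open>m n\<close> lies in \<open>M\<close> and obeys a recursion under conjugation by
  \<open>t\<close> with an error \<open>\<rho> n\<close>; this error is short over
  \<open>Y d\<close>, hence over \<open>X\<close> because \<open>M\<close> is undistorted.\<close>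

lemma basis_conj_growth:
  assumes t: "t \<in> \<Gamma>"
  shows "\<exists>Q. poly_bound Q \<and> (\<forall>n j. j < d \<longrightarrow> cj t (int n) (g j) \<in> word_ball G (Y d) (Q n))"
proof -
  have tc: "t \<in> carrier G" using t by (rule \<Gamma>_carrier)
  note Yc = Y_carrier[OF order_refl]
  obtain r where r: "poly_bound r" "\<And>n j k. j < d \<Longrightarrow> k < d \<Longrightarrow> nat \<bar>c k (cj t (int n) (g j))\<bar> \<le> r n"
    using coefficient_growth[OF t] by blast
  obtain q where q: "poly_bound q" "\<And>i s. s \<in> X \<Longrightarrow> cj t i s \<in> word_ball G X (q (nat \<bar>i\<bar>))"
    using X_tame[OF t] unfolding tame_def by blast
  obtain u where u: "poly_bound u" "\<And>n x. x \<in> M \<Longrightarrow> x \<in> word_ball G (Y d) n \<Longrightarrow> x \<in> word_ball G X (u n)"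
    using M_undistorted by blast
  have "cj t 1 ` Y d \<subseteq> generate G (Y d)" using N_cj[OF t] Y_N[OF order_refl] Y_gen by auto
  then obtain b where b: "cj t 1 ` Y d \<subseteq> word_ball G (Y d) b"
    using finite_subset_word_ball[OF Yc Y_inv[OF order_refl], of "cj t 1 ` Y d"] Y_finite by auto
  \<comment> \<open>The argument of \<open>u\<close> bounds the length of \<open>\<rho> n\<close>
    over \<open>Y d\<close>: conjugation by \<open>t\<close> lengthens \<open>V n\<close> at most by
    the factor \<open>b\<close>, and \<open>inv (V (Suc n))\<close> is added. Then \<open>u\<close>
    converts this to a length over \<open>X\<close>.\<close>
  define R where "R n = u (d * r n * b + d * r (Suc n))" for n
  have R: "poly_bound R"
    unfolding R_def
    by (rule poly_bound_compose[OF u(1) poly_bound_add[OF poly_bound_mult[OF poly_bound_mult[OF poly_bound_const r(1)] poly_bound_const]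
          poly_bound_mult[OF poly_bound_const poly_bound_compose[OF r(1) poly_bound_Suc]]]])
  define Q where "Q n = n * (R n * q n) + d * r n" for n
  have Q: "poly_bound Q"
    unfolding Q_def
    by (rule poly_bound_add[OF poly_bound_mult[OF poly_bound_id poly_bound_mult[OF R q(1)]]
          poly_bound_mult[OF poly_bound_const r(1)]])
  have "cj t (int n) (g j) \<in> word_ball G (Y d) (Q n)" if j: "j < d" for n j
  proof -
    define x where "x n = cj t (int n) (g j)" for n
    define V where "V n = gp d (\<lambda>i. c i (x n))" for n
    define m where "m n = x n \<otimes> inv (V n)" for n
    have xN: "x n \<in> N" for n unfolding x_def using N_cj[OF t g_mem[OF j]] .
    have VN: "V n \<in> N" for n unfolding V_def by (rule gp_N) simp
    have xc: "x n \<in> carrier G" and Vc: "V n \<in> carrier G" for n using xN VN N_carrier by blast+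
    have mM: "m n \<in> M" for n unfolding m_def V_def using residue_in_M[OF xN] by simp
    have mc: "m n \<in> carrier G" for n using mM M_subset_N N_carrier by blast
    have xSuc: "cj t 1 (x n) = x (Suc n)" for n
      unfolding x_def using tc N_carrier[OF g_mem[OF j]] by (simp add: cj_add)
    have V_len: "V n \<in> word_ball G (Y d) (d * r n)" for n
    proof -
      have "(\<Sum>i<d. nat \<bar>c i (x n)\<bar>) \<le> (\<Sum>i<d. r n)"
        unfolding x_def using r(2)[OF j] by (intro sum_mono) auto
      then show ?thesis
        using gp_word_ball[OF order_refl, of "\<lambda>i. c i (x n)"] word_ball_mono[of "Y d" "Y d" _ "d * r n" G]
        unfolding V_def by auto
    qed
    define \<rho> where "\<rho> n = cj t 1 (V n) \<otimes> inv (V (Suc n))" for n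
    have \<rho>c: "\<rho> n \<in> carrier G" for n unfolding \<rho>_def using tc Vc by simp
    have mSuc: "m (Suc n) = cj t 1 (m n) \<otimes> \<rho> n" for n
      unfolding m_def \<rho>_def xSuc[symmetric] using tc xc Vc
      by (simp add: cj_mult cj_inv group_word_simps)
    have "\<rho> n = inv (cj t 1 (m n)) \<otimes> m (Suc n)" for n
      unfolding mSuc using tc mc \<rho>c by (simp add: group_word_simps)
    then have \<rho>M: "\<rho> n \<in> M" for n
      using M_cj[OF t mM] mM M_subgroup by (simp add: subgroup.m_closed subgroup.m_inv_closed)
    have \<rho>X: "\<rho> n \<in> word_ball G X (R n)" for n
    proof -
      have "cj t 1 (V n) \<in> word_ball G (Y d) (d * r n * b)"
        using b by (intro cj_word_ball[OF Yc Yc tc _ V_len]) auto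
      moreover have "inv (V (Suc n)) \<in> word_ball G (Y d) (d * r (Suc n))"
        by (rule word_ball_inv[OF Yc Y_inv[OF order_refl] V_len])
      ultimately have "\<rho> n \<in> word_ball G (Y d) (d * r n * b + d * r (Suc n))"
        unfolding \<rho>_def by (rule word_ball_mult[OF Yc])
      then show ?thesis unfolding R_def by (rule u(2)[OF \<rho>M])
    qed
    \<comment> \<open>Generality in \<open>l\<close> makes the unrolled recursion conjugate each
      error by a single power of \<open>t\<close>, to which the polynomial bound \<open>q\<close>
      applies once. Estimating one conjugation by \<open>t\<close> after another would compound to
      an exponential.\<close>
    have m_len: "cj t (int l) (m n) \<in> word_ball G X (n * (R n * q (l + n)))" for l n
    proof (induction n arbitrary: l)
      case 0
      have "x 0 = g j" unfolding x_def using N_carrier[OF g_mem[OF j]] by simp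
      then have "V 0 = gp d (\<lambda>i. if i = j then 1 else 0)" unfolding V_def using dual j by (intro gp_cong) auto
      then have "m 0 = \<one>" unfolding m_def using gp_unit[OF j] \<open>x 0 = g j\<close> N_carrier[OF g_mem[OF j]] by simp
      then show ?case using tc by simp
    next
      case (Suc n)
      have "cj t (int l) (m (Suc n)) = cj t (int (Suc l)) (m n) \<otimes> cj t (int l) (\<rho> n)"
        unfolding mSuc using tc mc \<rho>c by (simp add: cj_mult cj_add add.commute)
      moreover have "cj t (int l) (\<rho> n) \<in> word_ball G X (R n * q l)"
        using q(2)[of _ "int l"] by (intro cj_word_ball[OF X_sub X_sub tc _ \<rho>X]) auto
      ultimately have "cj t (int l) (m (Suc n)) \<in> word_ball G X (n * (R n * q (Suc l + n)) + R n * q l)"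
        using word_ball_mult[OF X_sub Suc.IH[of "Suc l"]] by simp
      moreover have "n * (R n * q (Suc l + n)) + R n * q l \<le> Suc n * (R (Suc n) * q (l + Suc n))"
      proof -
        have "R n * q (l + Suc n) \<le> R (Suc n) * q (l + Suc n)" "R n * q l \<le> R (Suc n) * q (l + Suc n)"
          using poly_bound_mono[OF R, of n "Suc n"] poly_bound_mono[OF q(1), of l "l + Suc n"]
          by (auto intro: mult_le_mono)
        then have "n * (R n * q (l + Suc n)) + R n * q l \<le> n * (R (Suc n) * q (l + Suc n)) + R (Suc n) * q (l + Suc n)"
          by (intro add_mono mult_left_mono) auto
        then show ?thesis by simp
      qed
      ultimately show ?case using word_ball_mono[of X X _ "Suc n * (R (Suc n) * q (l + Suc n))" G] by blast
    qed
    have "m n \<in> word_ball G X (n * (R n * q n))" using m_len[of 0 n] mc by simp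
    then have "m n \<in> word_ball G (Y d) (n * (R n * q n))" using word_ball_X_Y[OF order_refl] by blast
    then have "m n \<otimes> V n \<in> word_ball G (Y d) (Q n)" unfolding Q_def using V_len by (rule word_ball_mult[OF Yc])
    moreover have "m n \<otimes> V n = x n" unfolding m_def using xc Vc by (simp add: m_assoc)
    ultimately show ?thesis unfolding x_def by simp
  qed
  then show ?thesis using Q by blast
qed

lemma tame_extension:
  assumes t: "t \<in> \<Gamma>"
  shows "tame (Y d) t"
proof -
  have tc: "t \<in> carrier G" using t by (rule \<Gamma>_carrier)
  note Yc = Y_carrier[OF order_refl]
  obtain q where q: "poly_bound q" "\<And>i s. s \<in> X \<Longrightarrow> cj t i s \<in> word_ball G X (q (nat \<bar>i\<bar>))"
    using X_tame[OF t] unfolding tame_def by blast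
  obtain P where P: "poly_bound P" "\<And>n j. j < d \<Longrightarrow> cj t (int n) (g j) \<in> word_ball G (Y d) (P n)"
    using basis_conj_growth[OF t] by blast
  obtain Q where Q: "poly_bound Q" "\<And>n j. j < d \<Longrightarrow> cj (inv t) (int n) (g j) \<in> word_ball G (Y d) (Q n)"
    using basis_conj_growth[OF subgroup.m_inv_closed[OF \<Gamma> t]] by blast
  define p where "p n = q n + (P n + Q n)" for n
  have p: "poly_bound p" unfolding p_def by (rule poly_bound_add[OF q(1) poly_bound_add[OF P(1) Q(1)]])
  have gen: "cj t i (g j) \<in> word_ball G (Y d) (p (nat \<bar>i\<bar>))" if j: "j < d" for i j
  proof (cases i rule: int_cases2)
    case (nonneg n)
    then show ?thesis using P(2)[OF j, of n] word_ball_mono[of "Y d" "Y d" "P n" "p n" G] unfolding p_def by auto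
  next
    case (nonpos n)
    then show ?thesis using Q(2)[OF j, of n] word_ball_mono[of "Y d" "Y d" "Q n" "p n" G] tc
      unfolding p_def by (auto simp: cj_inv_left)
  qed
  have "cj t i s \<in> word_ball G (Y d) (p (nat \<bar>i\<bar>))" if s: "s \<in> Y d" for i s
  proof -
    consider "s \<in> X" | j where "j < d" "s = g j" | j where "j < d" "s = inv (g j)"
      using s unfolding Y_def by auto
    then show ?thesis
    proof cases
      case 1
      have "q (nat \<bar>i\<bar>) \<le> p (nat \<bar>i\<bar>)" unfolding p_def by simp
      then show ?thesis using q(2)[OF 1, of i] word_ball_X_Y by blast
    next
      case 2 then show ?thesis using gen by simp
    next
      case 3
      then have "cj t i s = inv (cj t i (g j))" using tc N_carrier[OF g_mem] by (simp add: cj_inv)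
      then show ?thesis using word_ball_inv[OF Yc Y_inv[OF order_refl] gen[OF 3(1)]] by simp
    qed
  qed
  then show ?thesis unfolding tame_def using p by blast
qed

end

section \<open>Induction along the series and conclusion\<close>

context group
begin

text \<open>The induction hypothesis along the series. Tameness is demanded for all \<open>t\<close>
  in the full group \<Gamma>, not only in \<open>H\<close>, because the generators added at later
  steps act on \<open>H\<close> from outside.\<close>

definition tame_generated :: "'a set \<Rightarrow> 'a set \<Rightarrow> bool"
  where "tame_generated \<Gamma> H \<longleftrightarrow> (\<exists>X. finite X \<and> X \<subseteq> carrier G \<and> (\<forall>s\<in>X. inv s \<in> X) \<and> H = generate G X \<and>
    (\<forall>t\<in>\<Gamma>. tame X t) \<and> (\<exists>p. poly_bound p \<and> (\<forall>n. card (word_ball G X n) \<le> p n)))"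

lemma tame_generated_step:
  assumes SE: "subexponential_group G \<Gamma>" and fg: "fg_subgroup G \<Gamma>"
    and IH: "tame_generated \<Gamma> (kernel_series G \<Gamma> (Suc i))"
  shows "tame_generated \<Gamma> (kernel_series G \<Gamma> i)"
proof -
  let ?N = "kernel_series G \<Gamma> i" and ?M = "kernel_series G \<Gamma> (Suc i)"
  have \<Gamma>: "subgroup \<Gamma> G" using fg by (rule fg_subgroup_is_subgroup)
  obtain X p where X: "finite X" "X \<subseteq> carrier G" "\<forall>s\<in>X. inv s \<in> X" "?M = generate G X" "\<forall>t\<in>\<Gamma>. tame X t"
      and p: "poly_bound p" "\<And>n. card (word_ball G X n) \<le> p n"
    using IH unfolding tame_generated_def by blast
  obtain d :: nat and g :: "nat \<Rightarrow> 'a" and c :: "nat \<Rightarrow> 'a \<Rightarrow> int" where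
    b: "\<And>i. i < d \<Longrightarrow> g i \<in> ?N" "\<And>i. i < d \<Longrightarrow> additive_on G ?N (c i)"
    "\<And>i j. i < d \<Longrightarrow> j < d \<Longrightarrow> c i (g j) = (if i = j then 1 else 0)"
    "real_kernel G ?N = {x \<in> ?N. \<forall>i<d. c i x = 0}"
    using dual_basis_exists[OF kernel_series_fg[OF SE fg, of i]] by blast
  interpret abelian_step G \<Gamma> ?N ?M X d g c
  proof (intro abelian_step.intro abelian_step_axioms.intro)
    show "group G" ..
    show "?N \<subseteq> \<Gamma>" using kernel_series_antimono[of 0 i \<Gamma>] by simp
    show "cj t j x \<in> ?N" if "t \<in> \<Gamma>" "x \<in> ?N" for t x j by (rule kernel_series_cj[OF \<Gamma> that])
    show "cj t j x \<in> ?M" if "t \<in> \<Gamma>" "x \<in> ?M" for t x j by (rule kernel_series_cj[OF \<Gamma> that])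
    show "?M = {x \<in> ?N. \<forall>i<d. c i x = 0}" unfolding kernel_series_Suc by (rule b(4))
  qed (use \<Gamma> SE kernel_series_subgroup[OF \<Gamma>] X b in auto)
  have "\<exists>q. poly_bound q \<and> (\<forall>n. card (word_ball G (Y d) n) \<le> q n)" by (rule card_word_ball_Y[OF p])
  then show ?thesis
    unfolding tame_generated_def
  proof (intro exI[of _ "Y d"] conjI ballI)
    show "finite (Y d)" by (rule Y_finite)
    show "Y d \<subseteq> carrier G" by (rule Y_carrier) simp
    show "inv s \<in> Y d" if "s \<in> Y d" for s using that by (intro Y_inv) auto
    show "?N = generate G (Y d)" by (rule Y_gen)
    show "tame (Y d) t" if "t \<in> \<Gamma>" for t using that by (rule tame_extension)
  qed
qed

lemma tame_generated_of_series:
  assumes SE: "subexponential_group G \<Gamma>" and fg: "fg_subgroup G \<Gamma>"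
    and triv: "kernel_series G \<Gamma> k = {\<one>}"
  shows "tame_generated \<Gamma> \<Gamma>"
proof -
  have "tame_generated \<Gamma> (kernel_series G \<Gamma> (k - j))" for j
  proof (induction j)
    case 0
    have "word_ball G {} n = {\<one>}" for n by (induction n) (auto simp: word_ball_Suc)
    moreover have "generate G {} = {\<one>}"
    proof
      show "generate G {} \<subseteq> {\<one>}"
      proof
        fix x assume "x \<in> generate G {}"
        then show "x \<in> {\<one>}" by induction auto
      qed
    qed (simp add: generate.one)
    moreover have "tame {} t" for t unfolding tame_def using poly_bound_id by auto
    ultimately show ?case
      unfolding tame_generated_def using triv by (intro exI[of _ "{}"]) (auto intro: exI[of _ "\<lambda>_. 1"])
  next
    case (Suc j)
    show ?case
    \<comment> \<open>Subtraction is truncated, so from \<open>j = k\<close> on the index stays at 0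
      and there is nothing to prove.\<close>
    proof (cases "k \<le> j")
      case True then show ?thesis using Suc by simp
    next
      case False
      then have "k - j = Suc (k - Suc j)" by simp
      then show ?thesis using tame_generated_step[OF SE fg, of "k - Suc j"] Suc by simp
    qed
  qed
  from this[of k] show ?thesis by simp
qed

lemma tame_generated_polynomial_growth:
  assumes "tame_generated \<Gamma> H" and S: "finite S" "S \<subseteq> H"
  shows "polynomial_growth (\<lambda>n. card (word_ball G S n))"
proof -
  obtain X p where X: "finite X" "X \<subseteq> carrier G" "\<forall>s\<in>X. inv s \<in> X" "H = generate G X"
      and p: "poly_bound p" "\<And>n. card (word_ball G X n) \<le> p n"
    using assms(1) unfolding tame_generated_def by blast
  obtain b where b: "S \<subseteq> word_ball G X b" using finite_subset_word_ball[OF X(2) _ S(1)] X S(2) by auto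
  have "poly_bound (\<lambda>n. p (n * b))"
    by (rule poly_bound_compose[OF p(1) poly_bound_mult[OF poly_bound_id poly_bound_const]])
  then obtain C k where C: "\<And>n. p (n * b) \<le> C * (n + 1) ^ k" unfolding poly_bound_def by blast
  have "real (card (word_ball G S n)) \<le> real (C * 2 ^ k) * real n powr real k" if n: "1 \<le> n" for n
  proof -
    have "card (word_ball G S n) \<le> card (word_ball G X (n * b))"
      using word_ball_subst[OF X(2) b] by (intro card_mono finite_word_ball X(1))
    also have "\<dots> \<le> C * (n + 1) ^ k" using p(2)[of "n * b"] C[of n] by linarith
    also have "\<dots> \<le> C * (2 * n) ^ k" using n by (intro mult_left_mono power_mono) auto
    also have "\<dots> = C * 2 ^ k * n ^ k" by (simp add: power_mult_distrib)
    finally have "real (card (word_ball G S n)) \<le> real (C * 2 ^ k * n ^ k)" by (rule of_nat_mono)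
    then show ?thesis using n by (simp add: powr_realpow)
  qed
  then show ?thesis unfolding polynomial_growth_def by blast
qed

end

theorem mainTheorem5:
  fixes \<alpha> :: real
  assumes "\<alpha> > 0"
  shows "\<not> (\<exists>H. subgroup H (Diff_unit \<alpha>) \<and>
                finitely_generated_group (Diff_unit \<alpha> \<lparr>carrier := H\<rparr>) \<and>
                intermediate_growth (Diff_unit \<alpha> \<lparr>carrier := H\<rparr>))"
proof
  assume "\<exists>H. subgroup H (Diff_unit \<alpha>) \<and>
                finitely_generated_group (Diff_unit \<alpha> \<lparr>carrier := H\<rparr>) \<and>
                intermediate_growth (Diff_unit \<alpha> \<lparr>carrier := H\<rparr>)"
  then obtain H where H: "subgroup H (Diff_unit \<alpha>)" and ig: "intermediate_growth (Diff_unit \<alpha> \<lparr>carrier := H\<rparr>)"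
    by blast
  have upd: "Diff_unit \<alpha> \<lparr>carrier := H\<rparr> = \<B> \<lparr>carrier := H\<rparr>" by (simp add: Diff_unit_def)
  have HB: "subgroup H \<B>"
    using unit_bij.incl_subgroup[OF subgroup_diff_unit[OF assms] H[unfolded Diff_unit_def]] .
  have Hd: "H \<subseteq> diff_unit \<alpha>" using subgroup.subset[OF H] by (simp add: Diff_unit_def)
  obtain S where S: "finite_symmetric_generating (\<B> \<lparr>carrier := H\<rparr>) S"
    "\<not> polynomial_growth (growth_function (\<B> \<lparr>carrier := H\<rparr>) S)"
    "\<not> exponential_growth (growth_function (\<B> \<lparr>carrier := H\<rparr>) S)"
    using ig unfolding intermediate_growth_def upd by blast
  have SE: "subexponential_group \<B> H"
    by (rule unit_bij.not_exponential_imp_subexponential_group[OF S(1) HB S(3)])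
  have Sf: "finite S" "S \<subseteq> H" "generate (\<B> \<lparr>carrier := H\<rparr>) S = H"
    using S(1) unfolding finite_symmetric_generating_def by auto
  have fg: "fg_subgroup \<B> H"
    unfolding fg_subgroup_def using Sf unit_bij.generate_consistent[OF Sf(2) HB] subgroup.subset[OF HB]
    by (intro exI[of _ S]) auto
  \<comment> \<open>The depth of the series depends on \<alpha> alone. The exponent in the condition
    on the depth is one less than the depth, hence \<open>Suc n\<close> below.\<close>
  obtain n where "1 / \<alpha> < (1 + \<alpha>) ^ n" using real_arch_pow[of "1 + \<alpha>" "1 / \<alpha>"] assms by auto
  then have "1 \<le> \<alpha> * (1 + \<alpha>) ^ (Suc n - 1)" using assms by (simp add: field_simps)
  then have "kernel_series \<B> H (Suc n) = {\<one>\<^bsub>\<B>\<^esub>}"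
    by (intro kernel_series_trivial[OF assms Hd fg SE]) auto
  then have "unit_bij.tame_generated H H" by (rule unit_bij.tame_generated_of_series[OF SE fg])
  then have "polynomial_growth (\<lambda>n. card (word_ball \<B> S n))"
    using Sf by (intro unit_bij.tame_generated_polynomial_growth) auto
  moreover have "growth_function (\<B> \<lparr>carrier := H\<rparr>) S = (\<lambda>n. card (word_ball \<B> S n))"
    by (simp add: growth_function_def fun_eq_iff)
  ultimately show False using S(2) by simp
qed

end
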